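(* Let $n,m\ge2$, let $q\in\mathbb{K}$ be a primitive $n$th root of unity, $H=H_{n,m}=R\#_\gamma\Sigma_m$ with $R=\mathbb{K}\mathbb{Z}_n^{\otimes m}$ (defined using $q$), and assume there exists $p\in\mathbb{K}$ with $p^2=q$. Then $$A=\frac{\mathbb{K}\langle u_1,\ldots,u_m\rangle}{\langle u_ju_i-pu_iu_j : i<j\rangle}$$ is a left $H$-module algebra with action of the generators $x_i$ and $z_i$ of $H$ given by $$x_i\cdot u_i=qu_i,\quad x_i\cdot u_j=u_j\ \text{ for } j\ne i,\quad z_i\cdot u_i=u_{i+1},\quad z_i\cdot u_{i+1}=u_i,\quad z_i\cdot u_j=u_j\ \text{ for } j\ne i,i+1.$$ Moreover, $A$ is an inner-faithful $R$-module, and if $n$ is even then $A^H\subseteq\mathbb{K}[u_1^n,\ldots,u_m^n]$.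
   Context: $\mathbb{K}$ is a field of characteristic zero. $H_{n,m}$ is the semisimple Hopf algebra of dimension $n^mm!$ generated as an algebra by $x_1,\dots,x_m,z_1,\dots,z_{m-1}$ with defining relations $x_i^n=1$, $x_ix_j=x_jx_i$, $z_kx_i=x_{s_k(i)}z_k$ where $s_k=(k,k+1)$, $z_kz_l=z_lz_k$ for $|k-l|>1$, $z_kz_{k+1}z_k=z_{k+1}z_kz_{k+1}$, $z_k^2=\frac1n\sum_{i,j=0}^{n-1}q^{-ij}x_k^ix_{k+1}^j$; the $x_i$ are group-like, $\Delta(z_k)=\big(\frac1n\sum_{i,j=0}^{n-1}q^{-ij}x_k^i\otimes x_{k+1}^j\big)(z_k\otimes z_k)$, $\epsilon(z_k)=1$, $S(z_k)=z_k$. It is a crossed product $R\#_\gamma\Sigma_m$, where $R=\mathbb{K}\mathbb{Z}_n^{\otimes m}$ is the Hopf subalgebra generated by $x_1,\dots,x_m$. A module $V$ over a Hopf algebra $K$ is inner-faithful if the only Hopf ideal of $K$ that annihilates $V$ is the zero ideal. $A^H=\{f\in A: h\cdot f=\epsilon(h)f\text{ for all }h\in H\}$. $\mathbb{K}[u_1^n,\dots,u_m^n]$ denotes the subalgebra of $A$ generated by $u_1^n,\dots,u_m^n$ (commutative polynomial ring when $n$ is even). *)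

theory Defs
  imports
    "HOL-Algebra.QuotRing"
    "HOL-Algebra.Module"
    "HOL-Algebra.Subrings"
    "HOL-Library.Poly_Mapping"
    "HOL-Combinatorics.Transposition"
begin

definition primitive_root_of_unity :: "'k::field \<Rightarrow> nat \<Rightarrow> bool" where
  "primitive_root_of_unity q n \<longleftrightarrow> n > 0 \<and> q ^ n = 1 \<and> (\<forall>k. 0 < k \<and> k < n \<longrightarrow> q ^ k \<noteq> 1)"

section \<open>Associative algebras over a field\<close>

text \<open>The scalars form a type of class \<^class>\<open>field\<close>; algebras and modules are records with a
  carrier, because the ones needed here depend on numerical parameters. The locale
  \<^locale>\<open>algebra\<close> of the library only covers commutative algebras.\<close>

definition scalar_alg :: "('k::field, 'k) module" where
  "scalar_alg = \<lparr>carrier = UNIV, mult = (*), one = 1, zero = 0, add = (+), smult = (*)\<rparr>"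

definition k_algebra :: "('k::field, 'a, 'more) module_scheme \<Rightarrow> bool" where
  "k_algebra A \<longleftrightarrow> module scalar_alg A \<and> ring A \<and>
     (\<forall>c. \<forall>a\<in>carrier A. \<forall>b\<in>carrier A.
        (c \<odot>\<^bsub>A\<^esub> a) \<otimes>\<^bsub>A\<^esub> b = c \<odot>\<^bsub>A\<^esub> (a \<otimes>\<^bsub>A\<^esub> b) \<and>
        a \<otimes>\<^bsub>A\<^esub> (c \<odot>\<^bsub>A\<^esub> b) = c \<odot>\<^bsub>A\<^esub> (a \<otimes>\<^bsub>A\<^esub> b))"

definition gen_subalgebra :: "('k::field, 'a, 'more) module_scheme \<Rightarrow> 'a set \<Rightarrow> 'a set" where
  "gen_subalgebra A X =
     \<Inter>{S. subring S A \<and> (\<forall>c. \<forall>s\<in>S. c \<odot>\<^bsub>A\<^esub> s \<in> S) \<and> X \<subseteq> S}"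

definition opposite :: "('k, 'a, 'more) module_scheme \<Rightarrow> ('k, 'a, 'more) module_scheme" where
  "opposite A = A\<lparr>mult := (\<lambda>a b. b \<otimes>\<^bsub>A\<^esub> a)\<rparr>"

definition quotient_algebra ::
    "('k, 'a, 'more) module_scheme \<Rightarrow> 'a set \<Rightarrow> ('k, 'a set) module" where
  "quotient_algebra A I =
     ring.extend (A Quot I) (module.fields (\<lambda>c X. \<Union>a\<in>X. I +>\<^bsub>A\<^esub> (c \<odot>\<^bsub>A\<^esub> a)))"

section \<open>Free algebras and presentations\<close>

text \<open>Words form a monoid under concatenation, written additively so that the convolution product of
  \<^type>\<open>poly_mapping\<close> is the product of the free algebra.\<close>

datatype 'g word = Word (letters: "'g list")

instantiation word :: (type) monoid_add
begin

definition zero_word :: "'a word" where "zero_word = Word []"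

definition plus_word :: "'a word \<Rightarrow> 'a word \<Rightarrow> 'a word" where
  "plus_word v w = Word (letters v @ letters w)"

instance
  by standard (simp_all add: zero_word_def plus_word_def)

end

type_synonym ('g, 'k) free = "'g word \<Rightarrow>\<^sub>0 'k"

definition gen :: "'g \<Rightarrow> ('g, 'k::field) free" where
  "gen g = Poly_Mapping.single (Word [g]) 1"

definition const :: "'k::field \<Rightarrow> ('g, 'k) free" where
  "const c = Poly_Mapping.single 0 c"

definition free_algebra :: "'g set \<Rightarrow> ('k::field, ('g, 'k) free) module" where
  "free_algebra G =
     \<lparr>carrier = {f. \<forall>w\<in>Poly_Mapping.keys f. set (letters w) \<subseteq> G}, mult = (*), one = 1, zero = 0,
      add = (+), smult = (\<lambda>c f. const c * f)\<rparr>"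

definition eval_word :: "('k, 'a, 'more) module_scheme \<Rightarrow> ('g \<Rightarrow> 'a) \<Rightarrow> 'g word \<Rightarrow> 'a" where
  "eval_word B \<phi> w = foldr (\<lambda>g b. \<phi> g \<otimes>\<^bsub>B\<^esub> b) (letters w) \<one>\<^bsub>B\<^esub>"

definition eval_free ::
    "('k::field, 'a, 'more) module_scheme \<Rightarrow> ('g \<Rightarrow> 'a) \<Rightarrow> ('g, 'k) free \<Rightarrow> 'a" where
  "eval_free B \<phi> f = (\<Oplus>\<^bsub>B\<^esub>w\<in>Poly_Mapping.keys f. Poly_Mapping.lookup f w \<odot>\<^bsub>B\<^esub> eval_word B \<phi> w)"

definition presented ::
    "'g set \<Rightarrow> ('g, 'k::field) free set \<Rightarrow> ('k, ('g, 'k) free set) module" where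
  "presented G Rels = quotient_algebra (free_algebra G) (Idl\<^bsub>free_algebra G\<^esub> Rels)"

definition presented_gen ::
    "'g set \<Rightarrow> ('g, 'k::field) free set \<Rightarrow> 'g \<Rightarrow> ('g, 'k) free set" where
  "presented_gen G Rels g = (Idl\<^bsub>free_algebra G\<^esub> Rels) +>\<^bsub>free_algebra G\<^esub> gen g"

text \<open>The algebra homomorphism from a presented algebra to \<open>B\<close> that sends each generator \<open>g\<close> to
  \<open>\<phi> g\<close>. An element \<open>X\<close> of the presented algebra is a coset; the image below is a singleton when
  \<open>\<phi>\<close> respects the relations.\<close>

definition lift_presented ::
    "('k::field, 'a, 'more) module_scheme \<Rightarrow> ('g \<Rightarrow> 'a) \<Rightarrow> ('g, 'k) free set \<Rightarrow> 'a" where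
  "lift_presented B \<phi> X = the_elem (eval_free B \<phi> ` X)"

section \<open>Tensor products\<close>

text \<open>\<open>B \<otimes> C\<close> is the vector space with basis \<open>carrier B \<times> carrier C\<close> modulo the subspace
  \<open>tensor_null B C\<close> spanned by the bilinearity relators; its elements are cosets. The relators carry
  an arbitrary coefficient, so that additive closure already gives a subspace.\<close>

inductive_set tensor_null ::
    "('k::field, 'b, 'm1) module_scheme \<Rightarrow> ('k, 'c, 'm2) module_scheme \<Rightarrow> ('b \<times> 'c \<Rightarrow>\<^sub>0 'k) set"
  for B C where
  zero: "0 \<in> tensor_null B C"
| diff: "\<lbrakk>s \<in> tensor_null B C; t \<in> tensor_null B C\<rbrakk> \<Longrightarrow> s - t \<in> tensor_null B C"
| add_left: "\<lbrakk>b \<in> carrier B; b' \<in> carrier B; c \<in> carrier C\<rbrakk> \<Longrightarrow>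
    Poly_Mapping.single (b \<oplus>\<^bsub>B\<^esub> b', c) k - Poly_Mapping.single (b, c) k
      - Poly_Mapping.single (b', c) k \<in> tensor_null B C"
| add_right: "\<lbrakk>b \<in> carrier B; c \<in> carrier C; c' \<in> carrier C\<rbrakk> \<Longrightarrow>
    Poly_Mapping.single (b, c \<oplus>\<^bsub>C\<^esub> c') k - Poly_Mapping.single (b, c) k
      - Poly_Mapping.single (b, c') k \<in> tensor_null B C"
| smult_left: "\<lbrakk>b \<in> carrier B; c \<in> carrier C\<rbrakk> \<Longrightarrow>
    Poly_Mapping.single (r \<odot>\<^bsub>B\<^esub> b, c) k - Poly_Mapping.single (b, c) (k * r) \<in> tensor_null B C"
| smult_right: "\<lbrakk>b \<in> carrier B; c \<in> carrier C\<rbrakk> \<Longrightarrow>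
    Poly_Mapping.single (b, r \<odot>\<^bsub>C\<^esub> c) k - Poly_Mapping.single (b, c) (k * r) \<in> tensor_null B C"

definition tensor_class ::
    "('k::field, 'b, 'm1) module_scheme \<Rightarrow> ('k, 'c, 'm2) module_scheme \<Rightarrow>
     ('b \<times> 'c \<Rightarrow>\<^sub>0 'k) \<Rightarrow> ('b \<times> 'c \<Rightarrow>\<^sub>0 'k) set" where
  "tensor_class B C t = (\<lambda>s. t + s) ` tensor_null B C"

abbreviation pure_tensor ::
    "('k::field, 'b, 'm1) module_scheme \<Rightarrow> ('k, 'c, 'm2) module_scheme \<Rightarrow>
     'b \<Rightarrow> 'c \<Rightarrow> ('b \<times> 'c \<Rightarrow>\<^sub>0 'k) set" where
  "pure_tensor B C b c \<equiv> tensor_class B C (Poly_Mapping.single (b, c) 1)"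

definition tensor_mult ::
    "('k::field, 'b, 'm1) module_scheme \<Rightarrow> ('k, 'c, 'm2) module_scheme \<Rightarrow>
     ('b \<times> 'c \<Rightarrow>\<^sub>0 'k) \<Rightarrow> ('b \<times> 'c \<Rightarrow>\<^sub>0 'k) \<Rightarrow> ('b \<times> 'c \<Rightarrow>\<^sub>0 'k)" where
  "tensor_mult B C s t =
     (\<Sum>(b, c)\<in>Poly_Mapping.keys s. \<Sum>(b', c')\<in>Poly_Mapping.keys t.
        Poly_Mapping.single (b \<otimes>\<^bsub>B\<^esub> b', c \<otimes>\<^bsub>C\<^esub> c') (Poly_Mapping.lookup s (b, c) * Poly_Mapping.lookup t (b', c')))"

definition tensor_algebra ::
    "('k::field, 'b, 'm1) module_scheme \<Rightarrow> ('k, 'c, 'm2) module_scheme \<Rightarrow>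
     ('k, ('b \<times> 'c \<Rightarrow>\<^sub>0 'k) set) module" where
  "tensor_algebra B C =
     \<lparr>carrier = tensor_class B C ` {t. Poly_Mapping.keys t \<subseteq> carrier B \<times> carrier C},
      mult = (\<lambda>X Y. \<Union>s\<in>X. \<Union>t\<in>Y. tensor_class B C (tensor_mult B C s t)),
      one = pure_tensor B C \<one>\<^bsub>B\<^esub> \<one>\<^bsub>C\<^esub>,
      zero = tensor_null B C,
      add = (\<lambda>X Y. \<Union>s\<in>X. \<Union>t\<in>Y. tensor_class B C (s + t)),
      smult = (\<lambda>r X. \<Union>s\<in>X. tensor_class B C (Poly_Mapping.map ((*) r) s))\<rparr>"

section \<open>Hopf algebras, their modules and module algebras\<close>

record (overloaded) ('k::zero, 'h) hopf = "('k, 'h) module" +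
  comult :: "'h \<Rightarrow> ('h \<times> 'h \<Rightarrow>\<^sub>0 'k) set"
  counit :: "'h \<Rightarrow> 'k"
  antipode :: "'h \<Rightarrow> 'h"

text \<open>The Hopf subalgebra of \<open>H\<close> on a carrier \<open>R\<close>. Over a field, \<open>R \<otimes> R \<rightarrow> H \<otimes> H\<close> is injective, so
  the representatives of \<open>comult H h\<close> supported in \<open>R \<times> R\<close> form exactly one coset, which is the
  comultiplication of \<open>h\<close> in \<open>R \<otimes> R\<close>.\<close>

definition hopf_restrict :: "('k::field, 'h) hopf \<Rightarrow> 'h set \<Rightarrow> ('k, 'h) hopf" where
  "hopf_restrict H R =
     H\<lparr>carrier := R, comult := (\<lambda>h. {t \<in> comult H h. Poly_Mapping.keys t \<subseteq> R \<times> R})\<rparr>"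

text \<open>The existence of \<open>t\<close> below says that the comultiplication of \<open>h\<close> lies in \<open>I \<otimes> H + H \<otimes> I\<close>.\<close>

definition hopf_ideal :: "('k::field, 'h) hopf \<Rightarrow> 'h set \<Rightarrow> bool" where
  "hopf_ideal H I \<longleftrightarrow> ideal I H \<and>
     (\<forall>h\<in>I. \<exists>t\<in>comult H h. Poly_Mapping.keys t \<subseteq> I \<times> carrier H \<union> carrier H \<times> I) \<and>
     (\<forall>h\<in>I. counit H h = 0) \<and>
     (\<forall>h\<in>I. antipode H h \<in> I)"

definition left_module ::
    "('k::field, 'h, 'm1) module_scheme \<Rightarrow> ('k, 'v, 'm2) module_scheme \<Rightarrow> ('h \<Rightarrow> 'v \<Rightarrow> 'v) \<Rightarrow> bool"
  where
  "left_module H V act \<longleftrightarrow> module scalar_alg V \<and>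
     (\<forall>h\<in>carrier H. \<forall>v\<in>carrier V. act h v \<in> carrier V) \<and>
     (\<forall>h\<in>carrier H. \<forall>v\<in>carrier V. \<forall>w\<in>carrier V. act h (v \<oplus>\<^bsub>V\<^esub> w) = act h v \<oplus>\<^bsub>V\<^esub> act h w) \<and>
     (\<forall>g\<in>carrier H. \<forall>h\<in>carrier H. \<forall>v\<in>carrier V. act (g \<oplus>\<^bsub>H\<^esub> h) v = act g v \<oplus>\<^bsub>V\<^esub> act h v) \<and>
     (\<forall>c. \<forall>h\<in>carrier H. \<forall>v\<in>carrier V. act h (c \<odot>\<^bsub>V\<^esub> v) = c \<odot>\<^bsub>V\<^esub> act h v) \<and>
     (\<forall>c. \<forall>h\<in>carrier H. \<forall>v\<in>carrier V. act (c \<odot>\<^bsub>H\<^esub> h) v = c \<odot>\<^bsub>V\<^esub> act h v) \<and>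
     (\<forall>g\<in>carrier H. \<forall>h\<in>carrier H. \<forall>v\<in>carrier V. act (g \<otimes>\<^bsub>H\<^esub> h) v = act g (act h v)) \<and>
     (\<forall>v\<in>carrier V. act \<one>\<^bsub>H\<^esub> v = v)"

definition module_algebra ::
    "('k::field, 'h) hopf \<Rightarrow> ('k, 'a, 'more) module_scheme \<Rightarrow> ('h \<Rightarrow> 'a \<Rightarrow> 'a) \<Rightarrow> bool" where
  "module_algebra H A act \<longleftrightarrow> k_algebra A \<and> left_module H A act \<and>
     (\<forall>h\<in>carrier H. \<forall>a\<in>carrier A. \<forall>b\<in>carrier A. \<forall>t\<in>comult H h.
        act h (a \<otimes>\<^bsub>A\<^esub> b) =
          (\<Oplus>\<^bsub>A\<^esub>gk\<in>Poly_Mapping.keys t. Poly_Mapping.lookup t gk \<odot>\<^bsub>A\<^esub> (act (fst gk) a \<otimes>\<^bsub>A\<^esub> act (snd gk) b))) \<and>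
     (\<forall>h\<in>carrier H. act h \<one>\<^bsub>A\<^esub> = counit H h \<odot>\<^bsub>A\<^esub> \<one>\<^bsub>A\<^esub>)"

definition inner_faithful ::
    "('k::field, 'h) hopf \<Rightarrow> ('k, 'v, 'more) module_scheme \<Rightarrow> ('h \<Rightarrow> 'v \<Rightarrow> 'v) \<Rightarrow> bool" where
  "inner_faithful H V act \<longleftrightarrow> left_module H V act \<and>
     (\<forall>I. hopf_ideal H I \<and> (\<forall>h\<in>I. \<forall>v\<in>carrier V. act h v = \<zero>\<^bsub>V\<^esub>) \<longrightarrow> I = {\<zero>\<^bsub>H\<^esub>})"

definition invariants ::
    "('k::field, 'h) hopf \<Rightarrow> ('k, 'a, 'more) module_scheme \<Rightarrow> ('h \<Rightarrow> 'a \<Rightarrow> 'a) \<Rightarrow> 'a set" where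
  "invariants H A act = {a \<in> carrier A. \<forall>h\<in>carrier H. act h a = counit H h \<odot>\<^bsub>A\<^esub> a}"

section \<open>The Hopf algebra \<open>H\<^sub>n\<^sub>,\<^sub>m\<close>\<close>

datatype hgen = X nat | Z nat

definition Hgens :: "nat \<Rightarrow> hgen set" where
  "Hgens m = X ` {1..m} \<union> Z ` {1..<m}"

definition Hrels :: "nat \<Rightarrow> nat \<Rightarrow> 'k::field \<Rightarrow> (hgen, 'k) free set" where
  "Hrels n m q =
     {gen (X i) ^ n - 1 | i. i \<in> {1..m}} \<union>
     {gen (X i) * gen (X j) - gen (X j) * gen (X i) | i j. i \<in> {1..m} \<and> j \<in> {1..m}} \<union>
     {gen (Z k) * gen (X i) - gen (X (Transposition.transpose k (k + 1) i)) * gen (Z k) | k i.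
        k \<in> {1..<m} \<and> i \<in> {1..m}} \<union>
     {gen (Z k) * gen (Z l) - gen (Z l) * gen (Z k) | k l.
        k \<in> {1..<m} \<and> l \<in> {1..<m} \<and> \<bar>int k - int l\<bar> > 1} \<union>
     {gen (Z k) * gen (Z (k + 1)) * gen (Z k) - gen (Z (k + 1)) * gen (Z k) * gen (Z (k + 1)) | k.
        k \<in> {1..<m} \<and> k + 1 \<in> {1..<m}} \<union>
     {gen (Z k) ^ 2 -
        (\<Sum>i<n. \<Sum>j<n. const (inverse (of_nat n) * inverse (q ^ (i * j))) *
           gen (X k) ^ i * gen (X (k + 1)) ^ j) | k. k \<in> {1..<m}}"

definition Halg :: "nat \<Rightarrow> nat \<Rightarrow> 'k::field \<Rightarrow> ('k, (hgen, 'k) free set) module" where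
  "Halg n m q = presented (Hgens m) (Hrels n m q)"

definition Hgen :: "nat \<Rightarrow> nat \<Rightarrow> 'k::field \<Rightarrow> hgen \<Rightarrow> (hgen, 'k) free set" where
  "Hgen n m q g = presented_gen (Hgens m) (Hrels n m q) g"

fun Hcomult_gen ::
    "nat \<Rightarrow> nat \<Rightarrow> 'k::field \<Rightarrow> hgen \<Rightarrow> ((hgen, 'k) free set \<times> (hgen, 'k) free set \<Rightarrow>\<^sub>0 'k) set"
  where
  "Hcomult_gen n m q (X i) =
     pure_tensor (Halg n m q) (Halg n m q) (Hgen n m q (X i)) (Hgen n m q (X i))"
| "Hcomult_gen n m q (Z k) =
     tensor_class (Halg n m q) (Halg n m q)
       (\<Sum>i<n. \<Sum>j<n.
          Poly_Mapping.single
            (Hgen n m q (X k) [^]\<^bsub>Halg n m q\<^esub> i, Hgen n m q (X (k + 1)) [^]\<^bsub>Halg n m q\<^esub> j)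
            (inverse (of_nat n) * inverse (q ^ (i * j))))
     \<otimes>\<^bsub>tensor_algebra (Halg n m q) (Halg n m q)\<^esub>
     pure_tensor (Halg n m q) (Halg n m q) (Hgen n m q (Z k)) (Hgen n m q (Z k))"

fun Hantipode_gen :: "nat \<Rightarrow> nat \<Rightarrow> 'k::field \<Rightarrow> hgen \<Rightarrow> (hgen, 'k) free set" where
  "Hantipode_gen n m q (X i) = inv\<^bsub>Halg n m q\<^esub> (Hgen n m q (X i))"
| "Hantipode_gen n m q (Z k) = Hgen n m q (Z k)"

definition Hnm :: "nat \<Rightarrow> nat \<Rightarrow> 'k::field \<Rightarrow> ('k, (hgen, 'k) free set) hopf" where
  "Hnm n m q =
     module.extend (Halg n m q)
       (hopf.fields
          (lift_presented (tensor_algebra (Halg n m q) (Halg n m q)) (Hcomult_gen n m q))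
          (lift_presented scalar_alg (\<lambda>g. 1))
          (lift_presented (opposite (Halg n m q)) (Hantipode_gen n m q)))"

abbreviation hx :: "nat \<Rightarrow> nat \<Rightarrow> 'k::field \<Rightarrow> nat \<Rightarrow> (hgen, 'k) free set" where
  "hx n m q i \<equiv> Hgen n m q (X i)"

abbreviation hz :: "nat \<Rightarrow> nat \<Rightarrow> 'k::field \<Rightarrow> nat \<Rightarrow> (hgen, 'k) free set" where
  "hz n m q k \<equiv> Hgen n m q (Z k)"

definition Rnm :: "nat \<Rightarrow> nat \<Rightarrow> 'k::field \<Rightarrow> ('k, (hgen, 'k) free set) hopf" where
  "Rnm n m q = hopf_restrict (Hnm n m q) (gen_subalgebra (Hnm n m q) (hx n m q ` {1..m}))"

section \<open>The quantum polynomial ring\<close>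

definition quantum_rels :: "nat \<Rightarrow> 'k::field \<Rightarrow> (nat, 'k) free set" where
  "quantum_rels m p =
     {gen j * gen i - const p * gen i * gen j | i j. i \<in> {1..m} \<and> j \<in> {1..m} \<and> i < j}"

definition quantum_poly :: "nat \<Rightarrow> 'k::field \<Rightarrow> ('k, (nat, 'k) free set) module" where
  "quantum_poly m p = presented {1..m} (quantum_rels m p)"

definition qvar :: "nat \<Rightarrow> 'k::field \<Rightarrow> nat \<Rightarrow> (nat, 'k) free set" where
  "qvar m p i = presented_gen {1..m} (quantum_rels m p) i"

definition generator_action ::
    "nat \<Rightarrow> nat \<Rightarrow> 'k::field \<Rightarrow> 'k \<Rightarrow>
     ((hgen, 'k) free set \<Rightarrow> (nat, 'k) free set \<Rightarrow> (nat, 'k) free set) \<Rightarrow> bool" where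
  "generator_action n m q p act \<longleftrightarrow>
     (\<forall>i\<in>{1..m}. \<forall>j\<in>{1..m}. act (hx n m q i) (qvar m p j) =
        (if j = i then q \<odot>\<^bsub>quantum_poly m p\<^esub> qvar m p j else qvar m p j)) \<and>
     (\<forall>k\<in>{1..<m}. \<forall>j\<in>{1..m}. act (hz n m q k) (qvar m p j) =
        (if j = k then qvar m p (k + 1) else if j = k + 1 then qvar m p k else qvar m p j))"

end

theory Submission
  imports Defs
begin

text \<open>
  On a word of the free algebra \<open>K\<langle>u\<^sub>1, \<dots>, u\<^sub>m\<rangle>\<close> let \<open>x\<^sub>i\<close> act by \<open>q\<close> to the number of letters \<open>i\<close>, and
  let \<open>z\<^sub>k\<close> exchange the letters \<open>k\<close> and \<open>k + 1\<close> and multiply by \<open>q\<close> to the number of pairs in which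
  \<open>k + 1\<close> occurs before \<open>k\<close>. Counting pairs shows that the relations of \<open>H\<close> hold exactly on the free
  algebra, and that the quantum relations are preserved because \<open>p\<^sup>2 = q\<close>. The
  Fourier sum in \<open>\<Delta>(z\<^sub>k)\<close> multiplies \<open>v \<otimes> w\<close> by \<open>q ^ (a b)\<close> when \<open>x\<^sub>k v = q ^ a v\<close> and
  \<open>x\<^bsub>k+1\<^esub> w = q ^ b w\<close>; this yields both the module algebra law and the one hard relation for \<open>\<Delta>\<close>,
  namely that for \<open>z\<^sub>k\<^sup>2\<close>.

  For an arbitrary such action, an element of \<open>R\<close> acts on a joint eigenvector in \<open>H\<close> and on a word of the
  same weights by the same scalar. Words are nonzero in \<open>A\<close>, and joint eigenvectors of the \<open>x\<^sub>i\<close>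
  span, so an element of \<open>R\<close> that kills \<open>A\<close> is zero. Averaging an invariant over the powers of \<open>x\<^sub>i\<close> leaves
  only words in which every letter occurs a multiple of \<open>n\<close> times, and such a word is a scalar
  multiple of a product of the \<open>u\<^sub>i\<^sup>n\<close>.
\<close>

text \<open>\<open>H\<close> and \<open>A\<close> are known by generators and relations only, and
  neither is given a basis. The maps \<open>comult\<close> and \<open>counit\<close> of
  \<open>Hnm\<close> are of the form \<open>lift_presented\<close>, so they mean something only
  after the images of the generators are shown to satisfy every relation. Without a basis of
  \<open>H \<otimes> H\<close>, equality of polynomials in commuting elements with nth power 1 is
  tested on joint eigenvectors, where it becomes an identity of exponents; for the square of
  \<open>z_k\<close> this is \<open>a b' + a' b + a a' + b b' = (a + b) (a' + b')\<close>. On the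
  side of \<open>A\<close>, a linear functional that is nonzero on every word replaces a normal
  form. The twist in the comultiplication has a combinatorial origin: joining words \<open>v\<close>
  and \<open>w\<close> creates new pairs of \<open>k + 1\<close> before \<open>k\<close>, one for
  each \<open>k + 1\<close> in \<open>v\<close> and each \<open>k\<close> in \<open>w\<close>. Their
  number is bilinear in the weights, and \<open>q\<close> to this power is the value of the Fourier
  sum. The last two claims concern all actions with the prescribed generators. For these it is
  enough to identify the \<open>x_i\<close>, which are group-like and hence act
  multiplicatively.\<close>

abbreviation "single \<equiv> Poly_Mapping.single"
abbreviation "keys \<equiv> Poly_Mapping.keys"
abbreviation "lookup \<equiv> Poly_Mapping.lookup"

section \<open>Algebras over a field\<close>

lemma scalar_alg_simps [simp]:
  "carrier scalar_alg = UNIV" "mult scalar_alg = (*)" "one scalar_alg = 1"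
  "zero scalar_alg = 0" "add scalar_alg = (+)" "smult scalar_alg = (*)"
  by (simp_all add: scalar_alg_def)

lemma cring_scalar_alg: "cring (scalar_alg :: ('k::field, 'k) module)"
proof (rule cringI)
  show "abelian_group (scalar_alg :: ('k, 'k) module)"
  proof (rule abelian_groupI)
    fix x :: 'k
    show "\<exists>y\<in>carrier scalar_alg. y \<oplus>\<^bsub>scalar_alg\<^esub> x = \<zero>\<^bsub>scalar_alg\<^esub>"
      by (rule bexI [of _ "- x"]) auto
  qed auto
  show "Group.comm_monoid (scalar_alg :: ('k, 'k) module)"
    by (rule comm_monoidI) auto
qed (auto simp: algebra_simps)

locale kspace = abelian_group V + V: module scalar_alg V
  for V :: "('k::field, 'v, 'm) module_scheme" (structure)
begin

lemma smult_closed [simp, intro]: "v \<in> carrier V \<Longrightarrow> c \<odot> v \<in> carrier V"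
  by (rule V.smult_closed) auto

lemma smult_add_scalar: "v \<in> carrier V \<Longrightarrow> (c + d) \<odot> v = c \<odot> v \<oplus> d \<odot> v"
  using V.smult_l_distr [of c d v] by simp

lemma smult_add: "v \<in> carrier V \<Longrightarrow> w \<in> carrier V \<Longrightarrow> c \<odot> (v \<oplus> w) = c \<odot> v \<oplus> c \<odot> w"
  using V.smult_r_distr [of c v w] by simp

lemma smult_smult: "v \<in> carrier V \<Longrightarrow> c \<odot> (d \<odot> v) = (c * d) \<odot> v"
  using V.smult_assoc1 [of c d v] by simp

lemma smult_one [simp]: "v \<in> carrier V \<Longrightarrow> 1 \<odot> v = v"
  using V.smult_one [of v] by simp

lemma smult_zero_scalar [simp]: "v \<in> carrier V \<Longrightarrow> 0 \<odot> v = \<zero>"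
  using V.smult_l_null [of v] by simp

lemma smult_zero [simp]: "c \<odot> \<zero> = \<zero>"
  using V.smult_r_null [of c] by simp

lemma smult_minus_one: "v \<in> carrier V \<Longrightarrow> (-1) \<odot> v = \<ominus> v"
  using smult_add_scalar [of v "-1" 1] by (simp add: minus_equality)

lemma smult_finsum:
  assumes "\<And>x. x \<in> S \<Longrightarrow> f x \<in> carrier V"
  shows "c \<odot> finsum V f S = (\<Oplus>x\<in>S. c \<odot> f x)"
  using assms
proof (induction S rule: infinite_finite_induct)
  case (insert x F)
  then have "f \<in> F \<rightarrow> carrier V" "(\<lambda>x. c \<odot> f x) \<in> F \<rightarrow> carrier V" by auto
  with insert show ?case by (simp add: smult_add)
qed auto

end

locale kalg = ring A + kspace A for A :: "('k::field, 'a, 'm) module_scheme" (structure) +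
  assumes smult_mult_left:
      "a \<in> carrier A \<Longrightarrow> b \<in> carrier A \<Longrightarrow> (c \<odot> a) \<otimes> b = c \<odot> (a \<otimes> b)"
    and smult_mult_right:
      "a \<in> carrier A \<Longrightarrow> b \<in> carrier A \<Longrightarrow> a \<otimes> (c \<odot> b) = c \<odot> (a \<otimes> b)"

lemma kspace_iff: "kspace V \<longleftrightarrow> module scalar_alg V"
  unfolding kspace_def module_def by auto

lemma k_algebra_iff: "k_algebra A \<longleftrightarrow> kalg A"
  unfolding k_algebra_def kalg_def kalg_axioms_def kspace_iff by auto

lemma kspaceI:
  assumes "abelian_group V"
    and "\<And>c v. v \<in> carrier V \<Longrightarrow> c \<odot>\<^bsub>V\<^esub> v \<in> carrier V"
    and "\<And>c d v. v \<in> carrier V \<Longrightarrow> (c + d) \<odot>\<^bsub>V\<^esub> v = c \<odot>\<^bsub>V\<^esub> v \<oplus>\<^bsub>V\<^esub> d \<odot>\<^bsub>V\<^esub> v"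
    and "\<And>c v w. v \<in> carrier V \<Longrightarrow> w \<in> carrier V \<Longrightarrow>
           c \<odot>\<^bsub>V\<^esub> (v \<oplus>\<^bsub>V\<^esub> w) = c \<odot>\<^bsub>V\<^esub> v \<oplus>\<^bsub>V\<^esub> c \<odot>\<^bsub>V\<^esub> w"
    and "\<And>c d v. v \<in> carrier V \<Longrightarrow> (c * d) \<odot>\<^bsub>V\<^esub> v = c \<odot>\<^bsub>V\<^esub> (d \<odot>\<^bsub>V\<^esub> v)"
    and "\<And>v. v \<in> carrier V \<Longrightarrow> 1 \<odot>\<^bsub>V\<^esub> v = v"
  shows "kspace V"
  unfolding kspace_iff by (rule moduleI) (use assms in \<open>auto simp: cring_scalar_alg\<close>)

lemma kalg_scalar_alg: "kalg (scalar_alg :: ('k::field, 'k) module)"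
proof -
  interpret S: cring "scalar_alg :: ('k, 'k) module" by (rule cring_scalar_alg)
  show ?thesis
    unfolding kalg_def
    by (intro conjI kspaceI kalg_axioms.intro S.ring_axioms S.abelian_group_axioms)
      (simp_all add: algebra_simps)
qed

text \<open>The axioms are identities and the existence of negatives, so they pass along a
  surjection that commutes with the operations. Quotients, tensor products and \<open>Hnm\<close>
  (with the identity map) get their axioms in this way.\<close>

lemma kalg_image:
  assumes A: "kalg A" and carr: "carrier B = \<pi> ` carrier A"
    and one: "\<one>\<^bsub>B\<^esub> = \<pi> \<one>\<^bsub>A\<^esub>" and zero: "\<zero>\<^bsub>B\<^esub> = \<pi> \<zero>\<^bsub>A\<^esub>"
    and mult: "\<And>a b. a \<in> carrier A \<Longrightarrow> b \<in> carrier A \<Longrightarrow> \<pi> a \<otimes>\<^bsub>B\<^esub> \<pi> b = \<pi> (a \<otimes>\<^bsub>A\<^esub> b)"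
    and add: "\<And>a b. a \<in> carrier A \<Longrightarrow> b \<in> carrier A \<Longrightarrow> \<pi> a \<oplus>\<^bsub>B\<^esub> \<pi> b = \<pi> (a \<oplus>\<^bsub>A\<^esub> b)"
    and smult: "\<And>c a. a \<in> carrier A \<Longrightarrow> c \<odot>\<^bsub>B\<^esub> \<pi> a = \<pi> (c \<odot>\<^bsub>A\<^esub> a)"
  shows "kalg B"
proof -
  interpret A: kalg A by fact
  note [simp] = carr one zero mult add smult
  have ab: "abelian_group B"
  proof (rule abelian_groupI)
    fix x assume "x \<in> carrier B"
    then obtain a where "a \<in> carrier A" "x = \<pi> a" by auto
    then show "\<exists>y\<in>carrier B. y \<oplus>\<^bsub>B\<^esub> x = \<zero>\<^bsub>B\<^esub>"
      by (intro bexI [of _ "\<pi> (\<ominus>\<^bsub>A\<^esub> a)"]) (auto simp: A.l_neg)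
  qed (auto simp: A.a_ac)
  have ring: "ring B"
  proof (rule ringI)
    show "Group.monoid B" by (rule monoidI) (auto simp: A.m_assoc)
  qed (auto simp: ab A.l_distr A.r_distr)
  have "kspace B"
    by (rule kspaceI)
      (auto simp: ab A.smult_add A.smult_add_scalar A.smult_smult)
  then show ?thesis
    unfolding kalg_def kalg_axioms_def
    by (auto simp: ring A.smult_mult_left A.smult_mult_right)
qed

section \<open>Linear extension\<close>

text \<open>Induction on the number of keys. Splitting off the term at one key keeps the rest inside
  \<open>S\<close>, and carriers of free and tensor algebras are described by such sets of
  keys.\<close>

lemma poly_mapping_induct_keys [consumes 1, case_names zero single add]:
  fixes f :: "'x \<Rightarrow>\<^sub>0 'b::ab_group_add"
  assumes "keys f \<subseteq> S" and "P 0"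
    and "\<And>x c. x \<in> S \<Longrightarrow> P (single x c)"
    and add: "\<And>f g. keys f \<subseteq> S \<Longrightarrow> keys g \<subseteq> S \<Longrightarrow>
      P f \<Longrightarrow> P g \<Longrightarrow> P (f + g)"
  shows "P f"
  using assms(1)
proof (induction "card (keys f)" arbitrary: f)
  case 0
  then have "f = 0" by simp
  then show ?case using assms(2) by simp
next
  case (Suc k)
  then obtain x where x: "x \<in> keys f" by fastforce
  define s where "s = single x (lookup f x)"
  have "keys (f - s) = keys f - {x}"
    by (auto simp: s_def in_keys_iff lookup_minus lookup_single when_def split: if_splits)
  moreover have "keys s \<subseteq> S"
    using x Suc.prems by (auto simp: s_def)
  moreover have "P s" using x Suc.prems assms(3) by (auto simp: s_def)
  moreover have "P (f - s)"
    using Suc.hyps(2) Suc.prems x \<open>keys (f - s) = keys f - {x}\<close>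
    by (intro Suc.hyps(1)) auto
  ultimately have "P (s + (f - s))"
    using Suc.prems by (intro add) auto
  then show ?case by simp
qed

text \<open>\<open>eval_free\<close>, the right-hand side of the module algebra law and the
  functional that detects words all have this shape.\<close>

definition lin_ext ::
    "('k::field, 'v, 'm) module_scheme \<Rightarrow> ('x \<Rightarrow> 'v) \<Rightarrow> ('x \<Rightarrow>\<^sub>0 'k) \<Rightarrow> 'v" where
  "lin_ext V \<psi> f = (\<Oplus>\<^bsub>V\<^esub>x\<in>keys f. lookup f x \<odot>\<^bsub>V\<^esub> \<psi> x)"

context kspace
begin

lemma lin_ext_closed:
  "(\<And>x. x \<in> keys f \<Longrightarrow> \<psi> x \<in> carrier V) \<Longrightarrow> lin_ext V \<psi> f \<in> carrier V"
  unfolding lin_ext_def by (rule finsum_closed) auto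

text \<open>Cancellation may make \<open>keys (f + g)\<close> smaller than the union of the keys; a
  common index set turns additivity into a termwise statement.\<close>

lemma lin_ext_superset:
  assumes "finite S" "keys f \<subseteq> S" "\<And>x. x \<in> S \<Longrightarrow> \<psi> x \<in> carrier V"
  shows "lin_ext V \<psi> f = (\<Oplus>x\<in>S. lookup f x \<odot> \<psi> x)"
proof -
  have "(\<Oplus>x\<in>S. lookup f x \<odot> \<psi> x)
      = (\<Oplus>x\<in>keys f. lookup f x \<odot> \<psi> x)"
    by (rule add.finprod_mono_neutral_cong_left[symmetric])
       (use assms in \<open>auto simp: in_keys_iff\<close>)
  then show ?thesis by (simp add: lin_ext_def)
qed

lemma lin_ext_zero [simp]: "lin_ext V \<psi> 0 = \<zero>"
  by (simp add: lin_ext_def)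

lemma lin_ext_single: "\<psi> x \<in> carrier V \<Longrightarrow> lin_ext V \<psi> (single x c) = c \<odot> \<psi> x"
  using lin_ext_superset [of "{x}" "single x c" \<psi>] by simp

lemma lin_ext_add:
  assumes "\<And>x. x \<in> keys f \<union> keys g \<Longrightarrow> \<psi> x \<in> carrier V"
  shows "lin_ext V \<psi> (f + g) = lin_ext V \<psi> f \<oplus> lin_ext V \<psi> g"
proof -
  let ?S = "keys f \<union> keys g"
  have "lin_ext V \<psi> h = (\<Oplus>x\<in>?S. lookup h x \<odot> \<psi> x)"
    if "keys h \<subseteq> ?S" for h
    using that assms by (intro lin_ext_superset) auto
  note * = this
  have "lin_ext V \<psi> (f + g)
      = (\<Oplus>x\<in>?S. lookup f x \<odot> \<psi> x \<oplus> lookup g x \<odot> \<psi> x)"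
    unfolding * [OF keys_add [of f g]] using assms
    by (intro finsum_cong') (auto simp: lookup_add smult_add_scalar)
  also have "\<dots> = lin_ext V \<psi> f \<oplus> lin_ext V \<psi> g"
    using assms by (subst finsum_addf) (auto simp: *)
  finally show ?thesis .
qed

lemma lin_ext_scale:
  assumes "\<And>x. x \<in> keys f \<Longrightarrow> \<psi> x \<in> carrier V"
  shows "lin_ext V \<psi> (Poly_Mapping.map ((*) c) f) = c \<odot> lin_ext V \<psi> f"
proof -
  have "lookup (Poly_Mapping.map ((*) c) f) x = c * lookup f x" for x
    by (simp add: map.rep_eq when_def)
  then have "lin_ext V \<psi> (Poly_Mapping.map ((*) c) f)
      = (\<Oplus>x\<in>keys f. (c * lookup f x) \<odot> \<psi> x)"
    using assms
    by (subst lin_ext_superset [of "keys f"]) (auto simp: in_keys_iff)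
  also have "\<dots> = (\<Oplus>x\<in>keys f. c \<odot> (lookup f x \<odot> \<psi> x))"
    by (rule finsum_cong') (use assms in \<open>auto simp: smult_smult\<close>)
  also have "\<dots> = c \<odot> lin_ext V \<psi> f"
    unfolding lin_ext_def using assms by (subst smult_finsum) auto
  finally show ?thesis .
qed

lemma lin_ext_uminus:
  assumes "\<And>x. x \<in> keys f \<Longrightarrow> \<psi> x \<in> carrier V"
  shows "lin_ext V \<psi> (- f) = \<ominus> lin_ext V \<psi> f"
proof -
  have "- f = Poly_Mapping.map ((*) (-1)) f"
    by (rule poly_mapping_eqI) (simp add: map.rep_eq when_def)
  then show ?thesis
    using lin_ext_scale [of f \<psi> "-1"] assms lin_ext_closed [of f \<psi>] by (simp add: smult_minus_one)
qed

lemma lin_ext_diff: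
  assumes "\<And>x. x \<in> keys f \<union> keys g \<Longrightarrow> \<psi> x \<in> carrier V"
  shows "lin_ext V \<psi> (f - g) = lin_ext V \<psi> f \<ominus> lin_ext V \<psi> g"
  using lin_ext_add [of f "- g" \<psi>] lin_ext_uminus [of g \<psi>] assms
  by (simp add: a_minus_def keys_minus)

end

section \<open>Free algebras\<close>

lemma letters_zero [simp]: "letters 0 = []" and letters_plus [simp]: "letters (v + w) = letters v @ letters w"
  by (simp_all add: zero_word_def plus_word_def)

lemma const_mult_eq_map: "const c * f = Poly_Mapping.map ((*) c) f"
  by (simp add: const_def mult_map_scale_conv_mult)

lemma const_central: "const c * f = f * const c"
proof -
  have "keys f \<subseteq> UNIV" by simp
  then show ?thesis
    by (induction f rule: poly_mapping_induct_keys)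
      (auto simp: algebra_simps const_def mult_single)
qed

lemma const_0 [simp]: "const 0 = 0" and const_1 [simp]: "const 1 = 1"
  by (simp_all add: const_def)

lemma const_add: "const (c + d) = const c + const d"
  by (simp add: const_def single_add)

lemma const_mult: "const (c * d) = const c * const d"
  by (simp add: const_def mult_single)

lemma free_algebra_simps [simp]:
  "mult (free_algebra G) = (*)" "one (free_algebra G) = 1" "zero (free_algebra G) = 0"
  "add (free_algebra G) = (+)" "smult (free_algebra G) = (\<lambda>c f. const c * f)"
  by (simp_all add: free_algebra_def)

lemma free_carrier: "f \<in> carrier (free_algebra G) \<longleftrightarrow>
    keys f \<subseteq> {w. set (letters w) \<subseteq> G}"
  by (auto simp: free_algebra_def)

lemma free_carrier_zero [simp]: "0 \<in> carrier (free_algebra G)"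
  and free_carrier_one [simp]: "1 \<in> carrier (free_algebra G)"
  and free_carrier_const [simp]: "const c \<in> carrier (free_algebra G)"
  and free_carrier_gen [simp]: "gen g \<in> carrier (free_algebra G) \<longleftrightarrow> g \<in> G"
  and free_carrier_UNIV [simp]: "f' \<in> carrier (free_algebra UNIV)"
  by (auto simp: free_carrier const_def gen_def)

lemma free_carrier_single [simp]:
  "set (letters w) \<subseteq> G \<Longrightarrow> single w c \<in> carrier (free_algebra G)"
  by (auto simp: free_carrier)

lemma free_carrier_add [simp]:
    "f \<in> carrier (free_algebra G) \<Longrightarrow> g \<in> carrier (free_algebra G) \<Longrightarrow> f + g \<in> carrier (free_algebra G)"
  and free_carrier_uminus [simp]:
    "f \<in> carrier (free_algebra G) \<Longrightarrow> - f \<in> carrier (free_algebra G)"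
  and free_carrier_mult [simp]:
    "f \<in> carrier (free_algebra G) \<Longrightarrow> g \<in> carrier (free_algebra G) \<Longrightarrow> f * g \<in> carrier (free_algebra G)"
  using keys_add [of f g] keys_mult [of f g]
  by (fastforce simp: free_carrier keys_minus)+

lemma free_carrier_diff [simp]:
    "f \<in> carrier (free_algebra G) \<Longrightarrow> g \<in> carrier (free_algebra G) \<Longrightarrow> f - g \<in> carrier (free_algebra G)"
  using free_carrier_add [of f G "- g"] by simp

lemma free_carrier_power [simp]:
  "f \<in> carrier (free_algebra G) \<Longrightarrow> f ^ n \<in> carrier (free_algebra G)"
  by (induction n) auto

lemma free_carrier_sum [simp]:
  "(\<And>x. x \<in> S \<Longrightarrow> f x \<in> carrier (free_algebra G)) \<Longrightarrow> sum f S \<in> carrier (free_algebra G)"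
  by (induction S rule: infinite_finite_induct) auto

lemma kalg_free_algebra: "kalg (free_algebra G)"
proof -
  have ab: "abelian_group (free_algebra G)"
  proof (rule abelian_groupI)
    fix x assume "x \<in> carrier (free_algebra G)"
    then show "\<exists>y\<in>carrier (free_algebra G). y \<oplus>\<^bsub>free_algebra G\<^esub> x = \<zero>\<^bsub>free_algebra G\<^esub>"
      by (intro bexI [of _ "- x"]) auto
  qed (auto simp: algebra_simps)
  have ring: "ring (free_algebra G)"
  proof (rule ringI)
    show "Group.monoid (free_algebra G)" by (rule monoidI) (auto simp: mult.assoc)
  qed (auto simp: ab distrib_left distrib_right)
  moreover have "kspace (free_algebra G)"
    by (rule kspaceI) (auto simp: ab distrib_left distrib_right const_add const_mult mult.assoc)
  ultimately show ?thesis
    unfolding kalg_def kalg_axioms_def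
    by (auto simp: mult.assoc) (metis const_central mult.assoc)
qed

interpretation free: kalg "free_algebra G" for G :: "'g set"
  by (rule kalg_free_algebra)

lemma free_a_minus [simp]:
  assumes "f \<in> carrier (free_algebra G)" "g \<in> carrier (free_algebra G)"
  shows "f \<ominus>\<^bsub>free_algebra G\<^esub> g = f - g"
  using free.minus_equality [of G "- g" g] assms by (simp add: a_minus_def)

lemma free_induct [consumes 1, case_names single add]:
  assumes "f \<in> carrier (free_algebra G)"
    and single: "\<And>w c. set (letters w) \<subseteq> G \<Longrightarrow> P (single w c)"
    and add: "\<And>f g. f \<in> carrier (free_algebra G) \<Longrightarrow> g \<in> carrier (free_algebra G) \<Longrightarrow>
      P f \<Longrightarrow> P g \<Longrightarrow> P (f + g)"
  shows "P f"
proof -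
  have "P 0" using single [of 0 0] by simp
  have "keys f \<subseteq> {w. set (letters w) \<subseteq> G}" using assms(1) by (simp add: free_carrier)
  then show ?thesis
    by (induction f rule: poly_mapping_induct_keys) (auto simp: free_carrier \<open>P 0\<close> intro: single add)
qed

lemma gen_mult_single [simp]:
  "gen g * single w c = single (Word (g # letters w)) c"
  by (simp add: gen_def mult_single plus_word_def)

lemma word_induct [consumes 1, case_names Nil Cons]:
  assumes "set (letters w) \<subseteq> G"
    and "P 0" "\<And>g w. g \<in> G \<Longrightarrow> set (letters w) \<subseteq> G \<Longrightarrow> P w \<Longrightarrow> P (Word (g # letters w))"
  shows "P w"
proof -
  have "set l \<subseteq> G \<Longrightarrow> P (Word l)" for l
  proof (induction l)
    case Nil then show ?case using assms(2) by (simp add: zero_word_def)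
  next
    case (Cons g l) then show ?case using assms(3) [of g "Word l"] by simp
  qed
  from this [of "letters w"] assms(1) show ?thesis by simp
qed

lemma eval_free_eq_lin_ext: "eval_free B \<phi> f = lin_ext B (eval_word B \<phi>) f"
  by (simp add: eval_free_def lin_ext_def)

locale free_eval = kalg A for A :: "('k::field, 'a, 'm) module_scheme" (structure) +
  fixes G :: "'g set" and \<phi> :: "'g \<Rightarrow> 'a"
  assumes phi_closed [simp]: "g \<in> G \<Longrightarrow> \<phi> g \<in> carrier A"
begin

lemma eval_word_closed [simp]:
  "set (letters w) \<subseteq> G \<Longrightarrow> eval_word A \<phi> w \<in> carrier A"
proof -
  have "set l \<subseteq> G \<Longrightarrow> foldr (\<lambda>g b. \<phi> g \<otimes> b) l \<one> \<in> carrier A" for l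
    by (induction l) auto
  then show "set (letters w) \<subseteq> G \<Longrightarrow> ?thesis" by (simp add: eval_word_def)
qed

lemma eval_word_zero [simp]: "eval_word A \<phi> 0 = \<one>"
  by (simp add: eval_word_def)

lemma eval_word_add:
  assumes "set (letters v) \<subseteq> G" "set (letters w) \<subseteq> G"
  shows "eval_word A \<phi> (v + w) = eval_word A \<phi> v \<otimes> eval_word A \<phi> w"
proof -
  have "set l \<subseteq> G \<Longrightarrow> foldr (\<lambda>g b. \<phi> g \<otimes> b) (l @ letters w) \<one>
      = foldr (\<lambda>g b. \<phi> g \<otimes> b) l \<one> \<otimes> eval_word A \<phi> w" for l
  proof (induction l)
    case Nil
    then show ?case using eval_word_closed [of w] assms by (simp add: eval_word_def)
  next
    case (Cons g l)
    then show ?case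
      using eval_word_closed [of "Word l"] eval_word_closed [of w] assms
      by (auto simp: eval_word_def m_assoc)
  qed
  with assms show ?thesis by (simp add: eval_word_def)
qed

lemma eval_closed [simp]: "f \<in> carrier (free_algebra G) \<Longrightarrow> eval_free A \<phi> f \<in> carrier A"
  unfolding eval_free_eq_lin_ext by (rule lin_ext_closed) (auto simp: free_carrier)

lemma eval_zero [simp]: "eval_free A \<phi> 0 = \<zero>"
  by (simp add: eval_free_eq_lin_ext)

lemma eval_single:
  "set (letters w) \<subseteq> G \<Longrightarrow> eval_free A \<phi> (single w c) = c \<odot> eval_word A \<phi> w"
  unfolding eval_free_eq_lin_ext by (rule lin_ext_single) simp

lemma eval_one [simp]: "eval_free A \<phi> 1 = \<one>"
  using eval_single [of 0 1] by simp

lemma eval_const: "eval_free A \<phi> (const c) = c \<odot> \<one>"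
  using eval_single [of 0 c] by (simp add: const_def)

lemma eval_gen [simp]: "g \<in> G \<Longrightarrow> eval_free A \<phi> (gen g) = \<phi> g"
  using eval_single [of "Word [g]" 1] by (simp add: gen_def eval_word_def)

lemma eval_add [simp]:
  "f \<in> carrier (free_algebra G) \<Longrightarrow> g \<in> carrier (free_algebra G) \<Longrightarrow>
    eval_free A \<phi> (f + g) = eval_free A \<phi> f \<oplus> eval_free A \<phi> g"
  unfolding eval_free_eq_lin_ext by (rule lin_ext_add) (auto simp: free_carrier)

lemma eval_uminus [simp]:
  "f \<in> carrier (free_algebra G) \<Longrightarrow> eval_free A \<phi> (- f) = \<ominus> eval_free A \<phi> f"
  unfolding eval_free_eq_lin_ext by (rule lin_ext_uminus) (auto simp: free_carrier)

lemma eval_diff [simp]: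
  "f \<in> carrier (free_algebra G) \<Longrightarrow> g \<in> carrier (free_algebra G) \<Longrightarrow>
    eval_free A \<phi> (f - g) = eval_free A \<phi> f \<ominus> eval_free A \<phi> g"
  unfolding eval_free_eq_lin_ext by (rule lin_ext_diff) (auto simp: free_carrier)

lemma eval_smult [simp]:
  "f \<in> carrier (free_algebra G) \<Longrightarrow> eval_free A \<phi> (const c * f) = c \<odot> eval_free A \<phi> f"
  unfolding eval_free_eq_lin_ext const_mult_eq_map by (rule lin_ext_scale) (auto simp: free_carrier)

lemma eval_mult [simp]:
  assumes f: "f \<in> carrier (free_algebra G)" and g: "g \<in> carrier (free_algebra G)"
  shows "eval_free A \<phi> (f * g) = eval_free A \<phi> f \<otimes> eval_free A \<phi> g"
  using f
proof (induction f rule: free_induct)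
  case (single v c)
  show ?case using g
  proof (induction g rule: free_induct)
    case (single w d)
    with \<open>set (letters v) \<subseteq> G\<close> show ?case
      by (simp add: mult_single eval_single eval_word_add smult_mult_left smult_mult_right smult_smult mult.commute)
  next
    case (add f1 g1)
    with single show ?case
      by (simp add: distrib_left r_distr)
  qed
next
  case (add f1 g1)
  with g show ?case by (simp add: distrib_right l_distr)
qed

lemma eval_power [simp]:
  "f \<in> carrier (free_algebra G) \<Longrightarrow> eval_free A \<phi> (f ^ n) = eval_free A \<phi> f [^] n"
  by (induction n) (auto simp: power_Suc2 simp del: power_Suc)

lemma eval_sum:
  "(\<And>x. x \<in> S \<Longrightarrow> f x \<in> carrier (free_algebra G)) \<Longrightarrow>
    eval_free A \<phi> (sum f S) = (\<Oplus>x\<in>S. eval_free A \<phi> (f x))"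
proof (induction S rule: infinite_finite_induct)
  case (insert x F)
  then have "(\<lambda>x. eval_free A \<phi> (f x)) \<in> F \<rightarrow> carrier A" by auto
  with insert show ?case by simp
qed auto

lemma ring_hom_eval: "ring_hom_ring (free_algebra G) A (eval_free A \<phi>)"
  by (rule ring_hom_ringI) (auto simp: free.ring_axioms ring_axioms)

text \<open>The kernel of an evaluation is a two-sided ideal, so with the relations it contains the
  ideal that they generate.\<close>

lemma eval_eq_zero_on_ideal:
  assumes "R \<subseteq> carrier (free_algebra G)" "\<And>r. r \<in> R \<Longrightarrow> eval_free A \<phi> r = \<zero>"
    and "f \<in> Idl\<^bsub>free_algebra G\<^esub> R"
  shows "eval_free A \<phi> f = \<zero>"
proof -
  interpret E: ring_hom_ring "free_algebra G" A "eval_free A \<phi>" by (rule ring_hom_eval)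
  have "Idl\<^bsub>free_algebra G\<^esub> R \<subseteq> a_kernel (free_algebra G) A (eval_free A \<phi>)"
  proof (rule free.genideal_minimal [OF E.kernel_is_ideal], rule subsetI)
    fix r assume "r \<in> R"
    with assms(1) have "r \<in> carrier (free_algebra G)" by (rule subsetD)
    moreover have "eval_free A \<phi> r = \<zero>" using \<open>r \<in> R\<close> by (rule assms(2))
    ultimately show "r \<in> a_kernel (free_algebra G) A (eval_free A \<phi>)"
      unfolding a_kernel_def' by (intro CollectI conjI)
  qed
  then have "f \<in> a_kernel (free_algebra G) A (eval_free A \<phi>)" using assms(3) by (rule subsetD)
  then show ?thesis unfolding a_kernel_def' by blast
qed

end

section \<open>Quotients and presentations\<close>

lemma quotient_algebra_simps [simp]:
  "carrier (quotient_algebra A I) = a_rcosets\<^bsub>A\<^esub> I"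
  "mult (quotient_algebra A I) = rcoset_mult A I"
  "one (quotient_algebra A I) = I +>\<^bsub>A\<^esub> \<one>\<^bsub>A\<^esub>"
  "zero (quotient_algebra A I) = I"
  "add (quotient_algebra A I) = set_add A"
  "smult (quotient_algebra A I) = (\<lambda>c X. \<Union>a\<in>X. I +>\<^bsub>A\<^esub> (c \<odot>\<^bsub>A\<^esub> a))"
  by (simp_all add: quotient_algebra_def ring.defs module.defs FactRing_def)

context kalg
begin

lemma ideal_smult_closed:
  assumes "ideal I A" "a \<in> I"
  shows "c \<odot> a \<in> I"
proof -
  interpret I: ideal I A by fact
  have "(c \<odot> \<one>) \<otimes> a \<in> I" using assms by (intro I.I_l_closed) auto
  then show ?thesis using assms by (simp add: smult_mult_left I.a_Hcarr)
qed

text \<open>The definition forms a union over all representatives. Their multiples differ by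
  elements \<open>c \<odot> h\<close> with \<open>h\<close> in the ideal, so only one coset enters
  the union.\<close>

lemma quotient_smult_coset:
  assumes "ideal I A" "a \<in> carrier A"
  shows "c \<odot>\<^bsub>quotient_algebra A I\<^esub> (I +> a) = I +> (c \<odot> a)"
proof -
  interpret I: ideal I A by fact
  have "I +> (c \<odot> b) = I +> (c \<odot> a)" if b: "b \<in> I +> a" for b
  proof -
    obtain h where h: "h \<in> I" "b = h \<oplus> a" using b by (auto simp: a_r_coset_def')
    have "c \<odot> b = c \<odot> h \<oplus> c \<odot> a" using h assms by (simp add: smult_add I.a_Hcarr)
    moreover have "c \<odot> h \<in> I" using assms h by (intro ideal_smult_closed)
    ultimately have "c \<odot> b \<in> I +> (c \<odot> a)" by (auto simp: a_r_coset_def')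
    then show ?thesis
      by (rule I.a_repr_independence' [OF _ smult_closed [OF assms(2)], symmetric])
  qed
  moreover have "I +> a \<noteq> {}" using I.a_rcos_self [OF assms(2)] by blast
  ultimately show ?thesis unfolding quotient_algebra_simps by (intro SUP_eq_const)
qed

lemma kalg_quotient:
  assumes "ideal I A"
  shows "kalg (quotient_algebra A I)"
proof (rule kalg_image [of A _ "\<lambda>a. I +> a"])
  interpret I: ideal I A by fact
  show "carrier (quotient_algebra A I) = (+>) I ` carrier A"
    by (auto simp: A_RCOSETS_def')
  show "\<zero>\<^bsub>quotient_algebra A I\<^esub> = I +> \<zero>"
    using I.a_subset by simp
qed (use assms kalg_axioms in \<open>auto simp: ideal.rcoset_mult_add ideal.a_rcos_sum
        quotient_smult_coset simp del: quotient_algebra_simps(6)\<close>)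

end

locale presentation =
  fixes G :: "'g set" and Rels :: "('g, 'k::field) free set"
  assumes rels_closed: "Rels \<subseteq> carrier (free_algebra G)"
begin

abbreviation "I \<equiv> Idl\<^bsub>free_algebra G\<^esub> Rels"
abbreviation "F \<equiv> carrier (free_algebra G :: ('k, ('g, 'k) free) module)"
abbreviation "P \<equiv> presented G Rels"

definition cls :: "('g, 'k) free \<Rightarrow> ('g, 'k) free set" where
  "cls f = I +>\<^bsub>free_algebra G\<^esub> f"

sublocale I: ideal I "free_algebra G"
  by (rule free.genideal_ideal [OF rels_closed])

lemma rels_in_ideal: "r \<in> Rels \<Longrightarrow> r \<in> I"
  using free.genideal_self [OF rels_closed] by blast

lemma kalg_presented: "kalg P"
  unfolding presented_def by (rule free.kalg_quotient [OF I.is_ideal])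

sublocale kalg P by (rule kalg_presented)

lemma carrier_presented: "carrier P = cls ` F"
  by (auto simp: presented_def cls_def A_RCOSETS_def')

lemma cls_closed [simp]: "f \<in> F \<Longrightarrow> cls f \<in> carrier P"
  by (simp add: carrier_presented)

lemma cls_mult [simp]: "f \<in> F \<Longrightarrow> g \<in> F \<Longrightarrow> cls f \<otimes>\<^bsub>P\<^esub> cls g = cls (f * g)"
  using I.rcoset_mult_add [of f g] by (simp add: presented_def cls_def)

lemma cls_add [simp]: "f \<in> F \<Longrightarrow> g \<in> F \<Longrightarrow> cls f \<oplus>\<^bsub>P\<^esub> cls g = cls (f + g)"
  using I.a_rcos_sum [of f g] by (simp add: presented_def cls_def)

lemma cls_smult [simp]: "f \<in> F \<Longrightarrow> c \<odot>\<^bsub>P\<^esub> cls f = cls (const c * f)"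
  using free.quotient_smult_coset [OF I.is_ideal, of f c] by (simp add: presented_def cls_def)

lemma cls_one: "\<one>\<^bsub>P\<^esub> = cls 1"
  by (simp add: presented_def cls_def)

lemma cls_zero: "\<zero>\<^bsub>P\<^esub> = cls 0"
  using free.a_coset_add_zero [OF I.a_subset] by (simp add: presented_def cls_def)

lemma cls_eq_iff: "f \<in> F \<Longrightarrow> g \<in> F \<Longrightarrow> cls f = cls g \<longleftrightarrow> f - g \<in> I"
  using I.a_rcos_module_minus [of g f] I.a_repr_independence' [of f g] I.a_rcos_self [of f]
  by (auto simp: cls_def free.ring_axioms)

lemma cls_power [simp]: "f \<in> F \<Longrightarrow> cls f [^]\<^bsub>P\<^esub> (n::nat) = cls (f ^ n)"
  by (induction n) (auto simp: cls_one power_Suc2 simp del: power_Suc)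

lemma presented_gen_eq: "presented_gen G Rels g = cls (gen g)"
  by (simp add: presented_gen_def cls_def)

lemma self_in_cls: "f \<in> F \<Longrightarrow> f \<in> cls f"
  unfolding cls_def by (rule I.a_rcos_self)

lemma in_cls: "f \<in> F \<Longrightarrow> h \<in> cls f \<Longrightarrow> h \<in> F \<and> cls h = cls f"
  unfolding cls_def using I.a_repr_independence' I.a_elemrcos_carrier by blast

text \<open>A property closed under the algebra operations has to be checked on generators only;
  facts about the comultiplication and the counit of the action reach all of \<open>H\<close> in
  this way.\<close>

lemma presented_induct [consumes 1, case_names one gen add smult mult]:
  assumes "x \<in> carrier P"
    and one: "Q \<one>\<^bsub>P\<^esub>"
    and gen: "\<And>g. g \<in> G \<Longrightarrow> Q (cls (gen g))"
    and add: "\<And>x y. x \<in> carrier P \<Longrightarrow> y \<in> carrier P \<Longrightarrow> Q x \<Longrightarrow> Q y \<Longrightarrow> Q (x \<oplus>\<^bsub>P\<^esub> y)"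
    and smult: "\<And>c x. x \<in> carrier P \<Longrightarrow> Q x \<Longrightarrow> Q (c \<odot>\<^bsub>P\<^esub> x)"
    and mult: "\<And>x y. x \<in> carrier P \<Longrightarrow> y \<in> carrier P \<Longrightarrow> Q x \<Longrightarrow> Q y \<Longrightarrow> Q (x \<otimes>\<^bsub>P\<^esub> y)"
  shows "Q x"
proof -
  obtain f where "f \<in> F" and x: "x = cls f" using assms(1) by (auto simp: carrier_presented)
  from \<open>f \<in> F\<close> have "Q (cls f)"
  proof (induction f rule: free_induct)
    case (single w c)
    then have "Q (cls (single w 1))"
    proof (induction w rule: word_induct)
      case Nil then show ?case using one by (simp add: cls_one)
    next
      case (Cons g w)
      then show ?case using mult [of "cls (gen g)" "cls (single w 1)"] gen by simp
    qed
    with smult [of "cls (single w 1)" c] single show ?case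
      by (simp add: const_def mult_single)
  next
    case (add f g)
    then show ?case using assms(4) [of "cls f" "cls g"] by simp
  qed
  with x show ?thesis by simp
qed

text \<open>\<open>Q\<close> is not assumed to be stable under multiplication. The proof passes to
  the elements all of whose two-sided word multiples satisfy \<open>Q\<close>; these form an ideal
  because \<open>Q\<close> is closed under addition and negation.\<close>

lemma ideal_induct [consumes 1, case_names zero add uminus rel]:
  assumes "f \<in> I" and "Q 0"
    and add: "\<And>f g. f \<in> F \<Longrightarrow> g \<in> F \<Longrightarrow> Q f \<Longrightarrow> Q g \<Longrightarrow> Q (f + g)"
    and uminus: "\<And>f. f \<in> F \<Longrightarrow> Q f \<Longrightarrow> Q (- f)"
    and rel: "\<And>v w c r. set (letters v) \<subseteq> G \<Longrightarrow> set (letters w) \<subseteq> G \<Longrightarrow> r \<in> Rels \<Longrightarrow>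
      Q (single v c * r * single w 1)"
  shows "Q f"
proof -
  define J where "J = {f \<in> F. \<forall>v w c. set (letters v) \<subseteq> G \<longrightarrow> set (letters w) \<subseteq> G \<longrightarrow>
      Q (single v c * f * single w 1)}"
  have J_add: "f + g \<in> J" if "f \<in> J" "g \<in> J" for f g
    using that by (auto simp: J_def distrib_left distrib_right intro!: add)
  have "ideal J (free_algebra G)"
  proof (rule idealI)
    show "ring (free_algebra G :: ('k, ('g, 'k) free) module)" by (rule free.ring_axioms)
    show "subgroup J (add_monoid (free_algebra G))"
    proof (rule free.add.subgroupI)
      show "J \<noteq> {}" using \<open>Q 0\<close> by (auto simp: J_def intro!: exI [of _ 0])
    next
      fix f assume f: "f \<in> J"
      then have "- f \<in> J" by (auto simp: J_def intro!: uminus)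
      moreover have "\<ominus>\<^bsub>free_algebra G\<^esub> f = - f"
        using f free.minus_equality [of G "- f" f] by (auto simp: J_def)
      ultimately show "\<ominus>\<^bsub>free_algebra G\<^esub> f \<in> J" by simp
    qed (use J_add in \<open>auto simp: J_def\<close>)
  next
    fix f h assume f: "f \<in> J" and "h \<in> F"
    from this(2) have "h * f \<in> J"
    proof (induction h rule: free_induct)
      case (single u d)
      have "Q (single (v + u) (c * d) * f * single w 1)"
        if "set (letters v) \<subseteq> G" "set (letters w) \<subseteq> G" for v w c
        using f that single by (auto simp: J_def)
      then show ?case using single f by (auto simp: J_def mult_single simp flip: mult.assoc)
    qed (auto simp: distrib_right intro: J_add)
    then show "h \<otimes>\<^bsub>free_algebra G\<^esub> f \<in> J" by simp
  next
    fix f h assume f: "f \<in> J" and "h \<in> F"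
    from this(2) have "f * h \<in> J"
    proof (induction h rule: free_induct)
      case (single u d)
      have "Q (single v c * (f * single u d) * single w 1)"
        if "set (letters v) \<subseteq> G" "set (letters w) \<subseteq> G" for v w c
      proof -
        \<comment> \<open>The scalar \<open>d\<close> stands to the right of \<open>f\<close>; it
          has to move into the left coefficient \<open>c\<close> before membership of
          \<open>f\<close> in \<open>J\<close> applies.\<close>
        have "single u d * single w 1
            = const d * single (u + w) 1"
          by (simp add: mult_single const_def)
        then have "single v c * (f * single u d) * single w 1
            = (single v c * f) * const d * single (u + w) 1"
          by (simp add: mult.assoc)
        also have "\<dots> = const d * (single v c * f) * single (u + w) 1"
          by (simp only: const_central)
        also have "\<dots> = single v (c * d) * f * single (u + w) 1"
          by (simp add: mult_single const_def mult.commute flip: mult.assoc [where 'a = "'g word \<Rightarrow>\<^sub>0 'k"])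
        also have "Q \<dots>" using f that single by (auto simp: J_def)
        finally show ?thesis .
      qed
      then show ?case using single f by (auto simp: J_def)
    qed (auto simp: distrib_left intro: J_add)
    then show "f \<otimes>\<^bsub>free_algebra G\<^esub> h \<in> J" by simp
  qed
  moreover have "Rels \<subseteq> J" using rels_closed rel by (auto simp: J_def)
  ultimately have "I \<subseteq> J" by (rule free.genideal_minimal)
  with \<open>f \<in> I\<close> have "f \<in> J" by blast
  \<comment> \<open>Empty words on both sides give back \<open>f\<close>.\<close>
  then have "set (letters 0) \<subseteq> G \<longrightarrow> set (letters 0) \<subseteq> G \<longrightarrow>
      Q (single 0 1 * f * single 0 1)"
    unfolding J_def by blast
  then show ?thesis by simp
qed

end

locale presentation_lift = presentation G Rels + E: free_eval B G \<phi>
  for G :: "'g set" and Rels :: "('g, 'k::field) free set"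
    and B :: "('k, 'b, 'm) module_scheme" and \<phi> :: "'g \<Rightarrow> 'b" +
  assumes respects: "r \<in> Rels \<Longrightarrow> eval_free B \<phi> r = \<zero>\<^bsub>B\<^esub>"
begin

abbreviation "lift \<equiv> lift_presented B \<phi>"

text \<open>Representatives differ by an element of the ideal, which evaluates to zero; hence the
  image of a coset is a singleton and \<open>the_elem\<close> picks its element.\<close>

lemma lift_cls: 
  assumes "f \<in> F" shows "lift (cls f) = eval_free B \<phi> f"
proof -
  have "eval_free B \<phi> h = eval_free B \<phi> f" if "h \<in> cls f" for h
  proof -
    have h: "h \<in> F" "cls h = cls f" using in_cls [OF assms that] by auto
    then have "h - f \<in> I" using assms cls_eq_iff by blast
    then have "eval_free B \<phi> (h - f) = \<zero>\<^bsub>B\<^esub>"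
      by (rule E.eval_eq_zero_on_ideal [OF rels_closed respects, rotated])
    then have "eval_free B \<phi> h \<ominus>\<^bsub>B\<^esub> eval_free B \<phi> f = \<zero>\<^bsub>B\<^esub>"
      by (simp only: E.eval_diff [OF h(1) assms])
    then show ?thesis
      using E.r_right_minus_eq [OF E.eval_closed [OF h(1)] E.eval_closed [OF assms]] by (rule iffD1 [rotated])
  qed
  then have "eval_free B \<phi> ` cls f = {eval_free B \<phi> f}"
    using self_in_cls [OF assms] by blast
  then show ?thesis by (simp add: lift_presented_def)
qed

lemma lift_closed [simp]: "x \<in> carrier P \<Longrightarrow> lift x \<in> carrier B"
  by (auto simp: carrier_presented lift_cls)

lemma lift_one [simp]: "lift \<one>\<^bsub>P\<^esub> = \<one>\<^bsub>B\<^esub>"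
  by (simp add: cls_one lift_cls)

lemma lift_zero [simp]: "lift \<zero>\<^bsub>P\<^esub> = \<zero>\<^bsub>B\<^esub>"
  by (simp add: cls_zero lift_cls)

lemma lift_gen [simp]: "g \<in> G \<Longrightarrow> lift (cls (gen g)) = \<phi> g"
  by (simp add: lift_cls)

lemma lift_add [simp]: "x \<in> carrier P \<Longrightarrow> y \<in> carrier P \<Longrightarrow> lift (x \<oplus>\<^bsub>P\<^esub> y) = lift x \<oplus>\<^bsub>B\<^esub> lift y"
  by (auto simp: carrier_presented lift_cls)

lemma lift_mult [simp]: "x \<in> carrier P \<Longrightarrow> y \<in> carrier P \<Longrightarrow> lift (x \<otimes>\<^bsub>P\<^esub> y) = lift x \<otimes>\<^bsub>B\<^esub> lift y"
  by (auto simp: carrier_presented lift_cls)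

lemma lift_smult [simp]: "x \<in> carrier P \<Longrightarrow> lift (c \<odot>\<^bsub>P\<^esub> x) = c \<odot>\<^bsub>B\<^esub> lift x"
  by (auto simp: carrier_presented lift_cls simp del: E.eval_mult)

end

section \<open>Tensor products of algebras\<close>

lemma lookup_scale [simp]:
  "lookup (Poly_Mapping.map ((*) (r::'k::field)) s) x = r * lookup s x"
  by (simp add: map.rep_eq when_def)

lemma scale_add: "Poly_Mapping.map ((*) (r::'k::field)) (s + t)
    = Poly_Mapping.map ((*) r) s + Poly_Mapping.map ((*) r) t"
  by (rule poly_mapping_eqI) (simp add: lookup_add distrib_left)

lemma scale_diff: "Poly_Mapping.map ((*) (r::'k::field)) (s - t)
    = Poly_Mapping.map ((*) r) s - Poly_Mapping.map ((*) r) t"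
  by (rule poly_mapping_eqI) (simp add: lookup_minus right_diff_distrib)

lemma scale_single [simp]: "Poly_Mapping.map ((*) (r::'k::field)) (single x k)
    = single x (r * k)"
  by (rule poly_mapping_eqI) (simp add: lookup_single when_def)

lemma scale_zero [simp]: "Poly_Mapping.map ((*) (r::'k::field)) 0 = 0"
  by (rule poly_mapping_eqI) simp

lemma keys_scale: "keys (Poly_Mapping.map ((*) (r::'k::field)) s) \<subseteq> keys s"
  by (auto simp: in_keys_iff)

text \<open>As for \<open>lin_ext\<close>, fixed index sets make biadditivity a rearrangement of
  finite sums.\<close>

lemma tensor_mult_superset:
  assumes "finite S" "keys s \<subseteq> S" "finite U" "keys t \<subseteq> U"
  shows "tensor_mult B C s t = (\<Sum>x\<in>S. \<Sum>y\<in>U.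
    single (fst x \<otimes>\<^bsub>B\<^esub> fst y, snd x \<otimes>\<^bsub>C\<^esub> snd y)
      (lookup s x * lookup t y))"
proof -
  have "(\<Sum>y\<in>U. single (fst x \<otimes>\<^bsub>B\<^esub> fst y, snd x \<otimes>\<^bsub>C\<^esub> snd y)
      (lookup s x * lookup t y))
    = (\<Sum>y\<in>keys t. single (fst x \<otimes>\<^bsub>B\<^esub> fst y, snd x \<otimes>\<^bsub>C\<^esub> snd y)
      (lookup s x * lookup t y))" for x
    using assms by (intro sum.mono_neutral_right) (auto simp: in_keys_iff)
  moreover have "(\<Sum>x\<in>S. \<Sum>y\<in>keys t.
      single (fst x \<otimes>\<^bsub>B\<^esub> fst y, snd x \<otimes>\<^bsub>C\<^esub> snd y)
      (lookup s x * lookup t y)) = tensor_mult B C s t"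
    unfolding tensor_mult_def case_prod_unfold
    using assms by (intro sum.mono_neutral_cong_right) (auto simp: in_keys_iff)
  ultimately show ?thesis by simp
qed

lemma tensor_mult_single [simp]:
  "tensor_mult B C (single (b, c) k) (single (b', c') k')
    = single (b \<otimes>\<^bsub>B\<^esub> b', c \<otimes>\<^bsub>C\<^esub> c') (k * k')"
  by (subst tensor_mult_superset [of "{(b, c)}" _ "{(b', c')}"]) auto

lemma tensor_mult_zero [simp]: "tensor_mult B C 0 t = 0" "tensor_mult B C s 0 = 0"
  by (simp_all add: tensor_mult_def)

lemma tensor_mult_add_left:
  "tensor_mult B C (s + s') t = tensor_mult B C s t + tensor_mult B C s' t"
proof -
  let ?S = "keys s \<union> keys s'"
  note * = tensor_mult_superset [of ?S _ "keys t" t]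
  show ?thesis
    using keys_add [of s s']
    by (simp add: * lookup_add distrib_right single_add sum.distrib)
qed

lemma tensor_mult_add_right:
  "tensor_mult B C s (t + t') = tensor_mult B C s t + tensor_mult B C s t'"
proof -
  let ?S = "keys t \<union> keys t'"
  note * = tensor_mult_superset [of "keys s" s ?S]
  show ?thesis
    using keys_add [of t t']
    by (simp add: * lookup_add distrib_left single_add sum.distrib)
qed

lemma tensor_mult_diff_left:
  "tensor_mult B C (s - s') t = tensor_mult B C s t - tensor_mult B C s' t"
  using tensor_mult_add_left [of B C "s - s'" s' t] by (simp add: algebra_simps)

lemma tensor_mult_diff_right:
  "tensor_mult B C s (t - t') = tensor_mult B C s t - tensor_mult B C s t'"
  using tensor_mult_add_right [of B C s "t - t'" t'] by (simp add: algebra_simps)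

lemma scale_sum: "Poly_Mapping.map ((*) (r::'k::field)) (sum f S)
    = (\<Sum>x\<in>S. Poly_Mapping.map ((*) r) (f x))"
  by (induction S rule: infinite_finite_induct) (auto simp: scale_add)

lemma tensor_mult_scale_left:
  "tensor_mult B C (Poly_Mapping.map ((*) r) s) t = Poly_Mapping.map ((*) r) (tensor_mult B C s t)"
proof -
  note * = tensor_mult_superset [of "keys s" _ "keys t" t]
  show ?thesis
    using keys_scale [of r s] by (simp add: * scale_sum mult.assoc)
qed

lemma tensor_mult_scale_right:
  "tensor_mult B C s (Poly_Mapping.map ((*) r) t) = Poly_Mapping.map ((*) r) (tensor_mult B C s t)"
proof -
  note * = tensor_mult_superset [of "keys s" s "keys t"]
  show ?thesis
    using keys_scale [of r t] by (simp add: * scale_sum mult_ac)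
qed

lemma tensor_null_add: "s \<in> tensor_null B C \<Longrightarrow> t \<in> tensor_null B C \<Longrightarrow> s + t \<in> tensor_null B C"
  using tensor_null.diff [OF _ tensor_null.diff [OF tensor_null.zero], of s B C t] by simp

lemma tensor_null_scale:
  "s \<in> tensor_null B C \<Longrightarrow> Poly_Mapping.map ((*) r) s \<in> tensor_null B C"
proof (induction rule: tensor_null.induct)
  case (smult_left b c r' k)
  then show ?case using tensor_null.smult_left [OF smult_left, of r' "r * k"]
    by (simp add: scale_diff mult.assoc)
next
  case (smult_right b c r' k)
  then show ?case using tensor_null.smult_right [OF smult_right, of r' "r * k"]
    by (simp add: scale_diff mult.assoc)
qed (auto simp: scale_diff intro: tensor_null.intros)

lemma tensor_class_eq_iff: "tensor_class B C s = tensor_class B C t \<longleftrightarrow> s - t \<in> tensor_null B C"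
proof
  assume "tensor_class B C s = tensor_class B C t"
  moreover have "s \<in> tensor_class B C s"
    unfolding tensor_class_def using tensor_null.zero by force
  ultimately obtain u where "u \<in> tensor_null B C" "s = t + u" by (auto simp: tensor_class_def)
  then show "s - t \<in> tensor_null B C" by simp
next
  assume st: "s - t \<in> tensor_null B C"
  have sub: "tensor_class B C s \<subseteq> tensor_class B C t" if "s - t \<in> tensor_null B C" for s t
  proof
    fix u assume "u \<in> tensor_class B C s"
    then have "u - s \<in> tensor_null B C" by (auto simp: tensor_class_def)
    then have "u - t \<in> tensor_null B C" using tensor_null_add [OF _ that, of "u - s"] by simp
    then show "u \<in> tensor_class B C t" unfolding tensor_class_def by (rule rev_image_eqI) simp
  qed
  note sub [OF st]
  moreover have "t - s \<in> tensor_null B C"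
    using tensor_null.diff [OF tensor_null.zero st] by simp
  ultimately show "tensor_class B C s = tensor_class B C t"
    using sub by blast
qed

lemma in_tensor_class_iff: "s \<in> tensor_class B C t \<longleftrightarrow> s - t \<in> tensor_null B C"
  unfolding tensor_class_def by (auto intro: rev_image_eqI [where x = "s - t"])

lemma tensor_algebra_simps [simp]:
  "carrier (tensor_algebra B C) = tensor_class B C ` {t. keys t \<subseteq> carrier B \<times> carrier C}"
  "mult (tensor_algebra B C) = (\<lambda>X Y. \<Union>s\<in>X. \<Union>t\<in>Y. tensor_class B C (tensor_mult B C s t))"
  "one (tensor_algebra B C) = pure_tensor B C \<one>\<^bsub>B\<^esub> \<one>\<^bsub>C\<^esub>"
  "zero (tensor_algebra B C) = tensor_null B C"
  "add (tensor_algebra B C) = (\<lambda>X Y. \<Union>s\<in>X. \<Union>t\<in>Y. tensor_class B C (s + t))"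
  "smult (tensor_algebra B C) = (\<lambda>r X. \<Union>s\<in>X. tensor_class B C (Poly_Mapping.map ((*) r) s))"
  by (simp_all add: tensor_algebra_def)

text \<open>The tensor product before passing to the quotient: the monoid algebra on the product of the
  multiplicative monoids.\<close>

definition pretensor ::
    "('k::field, 'b, 'm1) module_scheme \<Rightarrow> ('k, 'c, 'm2) module_scheme \<Rightarrow> ('k, 'b \<times> 'c \<Rightarrow>\<^sub>0 'k) module" where
  "pretensor B C = \<lparr>carrier = {t. keys t \<subseteq> carrier B \<times> carrier C},
     mult = tensor_mult B C, one = single (\<one>\<^bsub>B\<^esub>, \<one>\<^bsub>C\<^esub>) 1, zero = 0, add = (+),
     smult = (\<lambda>r. Poly_Mapping.map ((*) r))\<rparr>"

lemma pretensor_simps [simp]: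
  "mult (pretensor B C) = tensor_mult B C" "one (pretensor B C) = single (\<one>\<^bsub>B\<^esub>, \<one>\<^bsub>C\<^esub>) 1"
  "zero (pretensor B C) = 0" "add (pretensor B C) = (+)"
  "smult (pretensor B C) = (\<lambda>r. Poly_Mapping.map ((*) r))"
  by (simp_all add: pretensor_def)

lemma pretensor_carrier:
  "t \<in> carrier (pretensor B C) \<longleftrightarrow> keys t \<subseteq> carrier B \<times> carrier C"
  by (simp add: pretensor_def)

locale tensor = B: kalg B + C: kalg C
  for B :: "('k::field, 'b, 'm1) module_scheme" and C :: "('k, 'c, 'm2) module_scheme"
begin

abbreviation "T \<equiv> carrier (pretensor B C)"
abbreviation "N \<equiv> tensor_null B C"
abbreviation "BC \<equiv> tensor_algebra B C"
abbreviation "tm \<equiv> tensor_mult B C"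

lemma T_single [simp]: "b \<in> carrier B \<Longrightarrow> c \<in> carrier C \<Longrightarrow> single (b, c) k \<in> T"
  by (auto simp: pretensor_carrier)

lemma T_zero [simp]: "0 \<in> T"
  by (auto simp: pretensor_carrier)

lemma T_add [simp]: "s \<in> T \<Longrightarrow> t \<in> T \<Longrightarrow> s + t \<in> T"
  using keys_add [of s t] by (fastforce simp: pretensor_carrier)

lemma T_uminus [simp]: "s \<in> T \<Longrightarrow> - s \<in> T"
  by (simp add: pretensor_carrier keys_minus)

lemma T_diff [simp]: "s \<in> T \<Longrightarrow> t \<in> T \<Longrightarrow> s - t \<in> T"
  using T_add [of s "- t"] by simp

lemma T_scale [simp]: "s \<in> T \<Longrightarrow> Poly_Mapping.map ((*) r) s \<in> T"
  using keys_scale [of r s] by (auto simp: pretensor_carrier)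

lemma T_induct [consumes 1, case_names single add]:
  assumes "t \<in> T"
    and single: "\<And>b c k. b \<in> carrier B \<Longrightarrow> c \<in> carrier C \<Longrightarrow> Q (single (b, c) k)"
    and add: "\<And>s t. s \<in> T \<Longrightarrow> t \<in> T \<Longrightarrow> Q s \<Longrightarrow> Q t \<Longrightarrow> Q (s + t)"
  shows "Q t"
proof -
  have "Q 0" using single [of "\<one>\<^bsub>B\<^esub>" "\<one>\<^bsub>C\<^esub>" 0] by simp
  have "keys t \<subseteq> carrier B \<times> carrier C" using assms(1) by (simp add: pretensor_carrier)
  then show ?thesis
    by (induction t rule: poly_mapping_induct_keys)
      (auto simp: pretensor_carrier \<open>Q 0\<close> intro: single add)
qed

lemma T_mult [simp]:
  assumes "s \<in> T" "t \<in> T" shows "tm s t \<in> T"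
  using assms(1)
proof (induction s rule: T_induct)
  case (single b c k)
  show ?case using assms(2)
    by (induction t rule: T_induct) (use single in \<open>auto simp: tensor_mult_add_right\<close>)
qed (simp add: tensor_mult_add_left)

lemma N_subset_T: "s \<in> N \<Longrightarrow> s \<in> T"
  by (induction rule: tensor_null.induct) auto

lemma tensor_mult_assoc:
  assumes "s \<in> T" "t \<in> T" "u \<in> T" shows "tm (tm s t) u = tm s (tm t u)"
  using assms(1)
proof (induction s rule: T_induct)
  case (single b c k)
  show ?case using assms(2)
  proof (induction t rule: T_induct)
    case (single b' c' k')
    show ?case using assms(3)
      by (induction u rule: T_induct)
        (use \<open>b \<in> _\<close> \<open>c \<in> _\<close> single in \<open>auto simp: tensor_mult_add_right B.m_assoc C.m_assoc mult.assoc\<close>)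
  qed (simp add: tensor_mult_add_left tensor_mult_add_right)
qed (simp add: tensor_mult_add_left)

lemma tensor_mult_one:
  assumes "t \<in> T"
  shows "tm (single (\<one>\<^bsub>B\<^esub>, \<one>\<^bsub>C\<^esub>) 1) t = t" "tm t (single (\<one>\<^bsub>B\<^esub>, \<one>\<^bsub>C\<^esub>) 1) = t"
  using assms
  by (induction t rule: T_induct) (auto simp: tensor_mult_add_left tensor_mult_add_right)

lemma kalg_pretensor: "kalg (pretensor B C)"
proof -
  have ab: "abelian_group (pretensor B C)"
  proof (rule abelian_groupI)
    fix x assume "x \<in> T"
    then show "\<exists>y\<in>T. y \<oplus>\<^bsub>pretensor B C\<^esub> x = \<zero>\<^bsub>pretensor B C\<^esub>"
      by (intro bexI [of _ "- x"]) auto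
  qed (auto simp: algebra_simps)
  have "ring (pretensor B C)"
  proof (rule ringI)
    show "Group.monoid (pretensor B C)"
      by (rule monoidI) (auto simp: tensor_mult_assoc tensor_mult_one)
  qed (auto simp: ab tensor_mult_add_left tensor_mult_add_right)
  moreover have "kspace (pretensor B C)"
    by (rule kspaceI)
      (auto simp: ab scale_add lookup_add distrib_right mult.assoc intro!: poly_mapping_eqI)
  ultimately show ?thesis
    unfolding kalg_def kalg_axioms_def
    by (auto simp: tensor_mult_scale_left tensor_mult_scale_right)
qed

text \<open>A bilinearity relator times a pure tensor is a relator of the same kind, with the
  coefficients multiplied. Together with \<open>null_mult_right\<close> this makes the null space a
  two-sided ideal.\<close>

lemma null_mult_left:
  assumes "s \<in> N" "t \<in> T" shows "tm s t \<in> N"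
  using assms(2)
proof (induction t rule: T_induct)
  case (single b c k)
  from assms(1) show ?case
  proof (induction rule: tensor_null.induct)
    case (add_left b1 b1' c1 k1)
    then show ?case using single tensor_null.add_left [of "b1 \<otimes>\<^bsub>B\<^esub> b" B "b1' \<otimes>\<^bsub>B\<^esub> b" "c1 \<otimes>\<^bsub>C\<^esub> c" C "k1 * k"]
      by (simp add: tensor_mult_diff_left B.l_distr)
  next
    case (add_right b1 c1 c1' k1)
    then show ?case using single tensor_null.add_right [of "b1 \<otimes>\<^bsub>B\<^esub> b" B "c1 \<otimes>\<^bsub>C\<^esub> c" C "c1' \<otimes>\<^bsub>C\<^esub> c" "k1 * k"]
      by (simp add: tensor_mult_diff_left C.l_distr)
  next
    case (smult_left b1 c1 r k1)
    then show ?case using single tensor_null.smult_left [of "b1 \<otimes>\<^bsub>B\<^esub> b" B "c1 \<otimes>\<^bsub>C\<^esub> c" C r "k1 * k"]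
      by (simp add: tensor_mult_diff_left B.smult_mult_left mult_ac)
  next
    case (smult_right b1 c1 r k1)
    then show ?case using single tensor_null.smult_right [of "b1 \<otimes>\<^bsub>B\<^esub> b" B "c1 \<otimes>\<^bsub>C\<^esub> c" C r "k1 * k"]
      by (simp add: tensor_mult_diff_left C.smult_mult_left mult_ac)
  qed (auto simp: tensor_mult_diff_left intro: tensor_null.intros)
qed (auto simp: tensor_mult_add_right intro: tensor_null_add)

lemma null_mult_right:
  assumes "s \<in> N" "t \<in> T" shows "tm t s \<in> N"
  using assms(2)
proof (induction t rule: T_induct)
  case (single b c k)
  from assms(1) show ?case
  proof (induction rule: tensor_null.induct)
    case (add_left b1 b1' c1 k1)
    then show ?case using single tensor_null.add_left [of "b \<otimes>\<^bsub>B\<^esub> b1" B "b \<otimes>\<^bsub>B\<^esub> b1'" "c \<otimes>\<^bsub>C\<^esub> c1" C "k * k1"]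
      by (simp add: tensor_mult_diff_right B.r_distr)
  next
    case (add_right b1 c1 c1' k1)
    then show ?case using single tensor_null.add_right [of "b \<otimes>\<^bsub>B\<^esub> b1" B "c \<otimes>\<^bsub>C\<^esub> c1" C "c \<otimes>\<^bsub>C\<^esub> c1'" "k * k1"]
      by (simp add: tensor_mult_diff_right C.r_distr)
  next
    case (smult_left b1 c1 r k1)
    then show ?case using single tensor_null.smult_left [of "b \<otimes>\<^bsub>B\<^esub> b1" B "c \<otimes>\<^bsub>C\<^esub> c1" C r "k * k1"]
      by (simp add: tensor_mult_diff_right B.smult_mult_right mult_ac)
  next
    case (smult_right b1 c1 r k1)
    then show ?case using single tensor_null.smult_right [of "b \<otimes>\<^bsub>B\<^esub> b1" B "c \<otimes>\<^bsub>C\<^esub> c1" C r "k * k1"]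
      by (simp add: tensor_mult_diff_right C.smult_mult_right mult_ac)
  qed (auto simp: tensor_mult_diff_right intro: tensor_null.intros)
qed (auto simp: tensor_mult_add_left intro: tensor_null_add)

abbreviation "tc \<equiv> tensor_class B C"

lemma tc_self: "t \<in> tc t"
  by (simp add: in_tensor_class_iff tensor_null.zero)

lemma in_tc_T: "t \<in> T \<Longrightarrow> s \<in> tc t \<Longrightarrow> s \<in> T"
  using T_add [OF N_subset_T, of "s - t" t] by (simp add: in_tensor_class_iff)

lemma tc_mult: 
  assumes "s \<in> T" "t \<in> T" shows "tc s \<otimes>\<^bsub>BC\<^esub> tc t = tc (tm s t)"
proof -
  have "tc (tm s' t') = tc (tm s t)" if "s' \<in> tc s" "t' \<in> tc t" for s' t'
  proof -
    \<comment> \<open>Changing one factor at a time leaves a factor in the null space in each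
      summand.\<close>
    have "tm s' t' - tm s t = tm (s' - s) t' + tm s (t' - t)"
      by (simp add: tensor_mult_diff_left tensor_mult_diff_right)
    also have "\<dots> \<in> N"
      using that assms in_tc_T [of t t']
      by (intro tensor_null_add null_mult_left null_mult_right) (auto simp: in_tensor_class_iff)
    finally show ?thesis by (simp add: tensor_class_eq_iff)
  qed
  moreover note tc_self [of s] tc_self [of t]
  ultimately show ?thesis unfolding tensor_algebra_simps by blast
qed

lemma tc_add: "tc s \<oplus>\<^bsub>BC\<^esub> tc t = tc (s + t)"
proof -
  have "tc (s' + t') = tc (s + t)" if "s' \<in> tc s" "t' \<in> tc t" for s' t'
    using that tensor_null_add [of "s' - s" B C "t' - t"]
    by (simp add: in_tensor_class_iff tensor_class_eq_iff algebra_simps)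
  moreover note tc_self [of s] tc_self [of t]
  ultimately show ?thesis unfolding tensor_algebra_simps by blast
qed

lemma tc_smult: "r \<odot>\<^bsub>BC\<^esub> tc s = tc (Poly_Mapping.map ((*) r) s)"
proof -
  have "tc (Poly_Mapping.map ((*) r) s') = tc (Poly_Mapping.map ((*) r) s)" if "s' \<in> tc s" for s'
    using that tensor_null_scale [of "s' - s" B C r]
    by (simp add: in_tensor_class_iff tensor_class_eq_iff scale_diff)
  moreover note tc_self [of s]
  ultimately show ?thesis unfolding tensor_algebra_simps by blast
qed

lemma carrier_tensor: "carrier BC = tc ` T"
  by (auto simp: pretensor_carrier)

lemma kalg_tensor: "kalg BC"
proof (rule kalg_image [OF kalg_pretensor, of _ tc])
  show "\<zero>\<^bsub>BC\<^esub> = tc \<zero>\<^bsub>pretensor B C\<^esub>" by (simp add: tensor_class_def)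
  show "\<one>\<^bsub>BC\<^esub> = tc \<one>\<^bsub>pretensor B C\<^esub>" by simp
qed (simp_all only: carrier_tensor tc_mult tc_add tc_smult pretensor_simps)

lemma tc_closed [simp]: "t \<in> T \<Longrightarrow> tc t \<in> carrier BC"
  by (simp only: carrier_tensor image_eqI)

text \<open>From here on the operations are computed on representatives through
  \<open>tc_mult\<close>, \<open>tc_add\<close> and \<open>tc_smult\<close>; the unions of the
  definition stay accessible under this name.\<close>

lemmas tensor_structure = tensor_algebra_simps

declare tensor_algebra_simps [simp del]

lemma in_carrier_tensor:
  assumes "x \<in> carrier BC" "t \<in> x" shows "t \<in> T" "tc t = x"
proof -
  obtain s where s: "s \<in> T" "x = tc s" using assms(1) by (auto simp: carrier_tensor)
  with assms(2) in_tc_T [of s t] show "t \<in> T" "tc t = x"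
    by (simp_all add: in_tensor_class_iff tensor_class_eq_iff)
qed

abbreviation "pt \<equiv> pure_tensor B C"

lemma pt_closed [simp]: "b \<in> carrier B \<Longrightarrow> c \<in> carrier C \<Longrightarrow> pt b c \<in> carrier BC"
  by simp

lemma pt_mult: "\<lbrakk>b \<in> carrier B; c \<in> carrier C; b' \<in> carrier B; c' \<in> carrier C\<rbrakk> \<Longrightarrow>
    pt b c \<otimes>\<^bsub>BC\<^esub> pt b' c' = pt (b \<otimes>\<^bsub>B\<^esub> b') (c \<otimes>\<^bsub>C\<^esub> c')"
  by (simp add: tc_mult)

lemma pt_one: "\<one>\<^bsub>BC\<^esub> = pt \<one>\<^bsub>B\<^esub> \<one>\<^bsub>C\<^esub>"
  by (simp add: tensor_structure)

lemma pt_add_left: "\<lbrakk>b \<in> carrier B; b' \<in> carrier B; c \<in> carrier C\<rbrakk> \<Longrightarrow>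
    pt (b \<oplus>\<^bsub>B\<^esub> b') c = pt b c \<oplus>\<^bsub>BC\<^esub> pt b' c"
  using tensor_null.add_left [of b B b' c C 1] by (simp add: tc_add tensor_class_eq_iff algebra_simps)

lemma pt_add_right: "\<lbrakk>b \<in> carrier B; c \<in> carrier C; c' \<in> carrier C\<rbrakk> \<Longrightarrow>
    pt b (c \<oplus>\<^bsub>C\<^esub> c') = pt b c \<oplus>\<^bsub>BC\<^esub> pt b c'"
  using tensor_null.add_right [of b B c C c' 1] by (simp add: tc_add tensor_class_eq_iff algebra_simps)

lemma pt_smult_left: "\<lbrakk>b \<in> carrier B; c \<in> carrier C\<rbrakk> \<Longrightarrow> pt (r \<odot>\<^bsub>B\<^esub> b) c = r \<odot>\<^bsub>BC\<^esub> pt b c"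
  using tensor_null.smult_left [of b B c C r 1] by (simp add: tc_smult tensor_class_eq_iff)

lemma pt_smult_right: "\<lbrakk>b \<in> carrier B; c \<in> carrier C\<rbrakk> \<Longrightarrow> pt b (r \<odot>\<^bsub>C\<^esub> c) = r \<odot>\<^bsub>BC\<^esub> pt b c"
  using tensor_null.smult_right [of b B c C r 1] by (simp add: tc_smult tensor_class_eq_iff)

text \<open>The universal property of the tensor product on the level of representatives: a bilinear
  map kills every relator, so its linear extension is well defined on cosets.\<close>

lemma lin_ext_tensor_null:
  fixes V :: "('k, 'v, 'm) module_scheme"
  assumes V: "kspace V"
    and closed: "\<And>b c. b \<in> carrier B \<Longrightarrow> c \<in> carrier C \<Longrightarrow> \<psi> (b, c) \<in> carrier V"
    and "\<And>b b' c. \<lbrakk>b \<in> carrier B; b' \<in> carrier B; c \<in> carrier C\<rbrakk> \<Longrightarrow>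
      \<psi> (b \<oplus>\<^bsub>B\<^esub> b', c) = \<psi> (b, c) \<oplus>\<^bsub>V\<^esub> \<psi> (b', c)"
    and "\<And>b c c'. \<lbrakk>b \<in> carrier B; c \<in> carrier C; c' \<in> carrier C\<rbrakk> \<Longrightarrow>
      \<psi> (b, c \<oplus>\<^bsub>C\<^esub> c') = \<psi> (b, c) \<oplus>\<^bsub>V\<^esub> \<psi> (b, c')"
    and "\<And>r b c. \<lbrakk>b \<in> carrier B; c \<in> carrier C\<rbrakk> \<Longrightarrow> \<psi> (r \<odot>\<^bsub>B\<^esub> b, c) = r \<odot>\<^bsub>V\<^esub> \<psi> (b, c)"
    and "\<And>r b c. \<lbrakk>b \<in> carrier B; c \<in> carrier C\<rbrakk> \<Longrightarrow> \<psi> (b, r \<odot>\<^bsub>C\<^esub> c) = r \<odot>\<^bsub>V\<^esub> \<psi> (b, c)"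
    and "s \<in> N"
  shows "lin_ext V \<psi> s = \<zero>\<^bsub>V\<^esub>"
proof -
  interpret V: kspace V by fact
  have lin_diff: "lin_ext V \<psi> (s - t) = lin_ext V \<psi> s \<ominus>\<^bsub>V\<^esub> lin_ext V \<psi> t" if "s \<in> T" "t \<in> T" for s t
    using that closed by (intro V.lin_ext_diff) (auto simp: pretensor_carrier)
  have minus: "(x \<oplus>\<^bsub>V\<^esub> y) \<ominus>\<^bsub>V\<^esub> x \<ominus>\<^bsub>V\<^esub> y = \<zero>\<^bsub>V\<^esub>" if "x \<in> carrier V" "y \<in> carrier V" for x y
    using that by (simp add: a_minus_def V.a_comm [of x] V.a_assoc V.r_neg)
  have minus': "x \<ominus>\<^bsub>V\<^esub> x = \<zero>\<^bsub>V\<^esub>" if "x \<in> carrier V" for x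
    using that by (simp add: a_minus_def V.r_neg)
  note [simp] = V.lin_ext_single V.smult_add V.smult_smult
  from \<open>s \<in> N\<close> show ?thesis
  proof (induction rule: tensor_null.induct)
    case (diff s t)
    then show ?case using lin_diff [of s t] by (simp add: N_subset_T minus')
  qed (use assms in \<open>simp_all add: lin_diff minus minus'\<close>)
qed

end

section \<open>Finite Fourier transform\<close>

locale primitive_root =
  fixes n :: nat and q :: "'k::field_char_0"
  assumes primitive: "primitive_root_of_unity q n"
begin

lemma n_pos: "n > 0" and q_power_n: "q ^ n = 1"
  using primitive by (auto simp: primitive_root_of_unity_def)

lemma q_nonzero: "q \<noteq> 0"
  using q_power_n n_pos by (metis power_0_left less_irrefl zero_neq_one)

lemma q_power_mod: "q ^ (a mod n) = q ^ a"
proof -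
  have "q ^ a = q ^ (n * (a div n) + a mod n)" by simp
  also have "\<dots> = q ^ (a mod n)" by (simp only: power_add power_mult q_power_n) simp
  finally show ?thesis by simp
qed

lemma q_power_inj:
  assumes "i < n" "j < n" "q ^ i = q ^ j" shows "i = j"
proof -
  have *: False if "i < j" "j < n" "q ^ i = q ^ j" for i j
  proof -
    have "q ^ j = q ^ i * q ^ (j - i)" using that(1) by (simp flip: power_add)
    then have "q ^ i * q ^ (j - i) = q ^ i" using that(3) by simp
    then have "q ^ (j - i) = 1" using q_nonzero by simp
    then show False using primitive that by (auto simp: primitive_root_of_unity_def)
  qed
  show ?thesis using * [of i j] * [of j i] assms by (metis linorder_neqE_nat)
qed

lemma sum_root_of_unity:
  assumes "(r::'k) ^ n = 1" shows "(\<Sum>j<n. r ^ j) = (if r = 1 then of_nat n else 0)"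
  using power_diff_1_eq [of r n] assms by auto

text \<open>The coefficients shared by the relation for the square of \<open>z_k\<close> and the
  comultiplication of \<open>z_k\<close>. As a matrix they are the inverse of the Fourier matrix
  with entries \<open>q ^ (i * j)\<close>.\<close>

definition fc :: "nat \<Rightarrow> nat \<Rightarrow> 'k" where
  "fc i j = inverse (of_nat n) * inverse (q ^ (i * j))"

text \<open>Orthogonality of characters: up to the factor \<open>1 / n\<close> the summands are the
  powers of the root of unity \<open>q ^ b / q ^ i\<close>, and such a geometric sum vanishes unless
  the root is 1.\<close>

lemma sum_fc: "i < n \<Longrightarrow> (\<Sum>j<n. fc i j * (q ^ b) ^ j) = (if i = b mod n then 1 else 0)"
proof -
  assume i: "i < n"
  let ?r = "q ^ b * inverse (q ^ i)"
  have "fc i j * (q ^ b) ^ j = inverse (of_nat n) * ?r ^ j" for j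
    by (simp add: fc_def power_mult_distrib power_inverse mult_ac flip: power_mult)
  moreover have "?r ^ n = 1"
    by (simp add: power_mult_distrib power_inverse mult.commute [of _ n] power_mult q_power_n flip: power_mult)
       (simp add: power_mult q_power_n)
  moreover have "?r = 1 \<longleftrightarrow> i = b mod n"
  proof -
    have "?r = 1 \<longleftrightarrow> q ^ (b mod n) = q ^ i"
      using q_nonzero by (simp add: q_power_mod field_simps)
    then show ?thesis using q_power_inj [of "b mod n" i] i n_pos by auto
  qed
  ultimately show ?thesis
    using n_pos by (simp add: sum_root_of_unity flip: sum_distrib_left)
qed

text \<open>The inner sum singles out \<open>i = b mod n\<close>, and only
  \<open>(q ^ a) ^ i\<close> remains. Eigenvalues \<open>q ^ a\<close> and \<open>q ^ b\<close> are
  thus turned into the bicharacter \<open>q ^ (a * b)\<close>.\<close>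

lemma fourier: "(\<Sum>i<n. \<Sum>j<n. fc i j * (q ^ a) ^ i * (q ^ b) ^ j) = q ^ (a * b)"
proof -
  have "(\<Sum>i<n. \<Sum>j<n. fc i j * (q ^ a) ^ i * (q ^ b) ^ j)
      = (\<Sum>i<n. (q ^ a) ^ i * (\<Sum>j<n. fc i j * (q ^ b) ^ j))"
    by (simp add: sum_distrib_left mult_ac)
  also have "\<dots> = (\<Sum>i<n. if i = b mod n then (q ^ a) ^ i else 0)"
    by (intro sum.cong) (auto simp: sum_fc)
  also have "\<dots> = (q ^ (b mod n)) ^ a" using n_pos by (simp flip: power_mult add: mult.commute)
  finally show ?thesis by (simp only: q_power_mod) (simp flip: power_mult add: mult.commute)
qed

end

lemma const_sum: "const (sum f S) = (\<Sum>x\<in>S. const (f x))"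
  by (induction S rule: infinite_finite_induct) (auto simp: const_add)

section \<open>Joint eigenvectors\<close>

lemma (in free_eval) eval_commute:
  assumes "y \<in> carrier A" "\<And>g. g \<in> G \<Longrightarrow> y \<otimes> \<phi> g = \<phi> g \<otimes> y" "f \<in> carrier (free_algebra G)"
  shows "y \<otimes> eval_free A \<phi> f = eval_free A \<phi> f \<otimes> y"
  using assms(3)
proof (induction f rule: free_induct)
  case (single w c)
  have "y \<otimes> eval_word A \<phi> w = eval_word A \<phi> w \<otimes> y"
    using single
  proof (induction w rule: word_induct)
    case Nil
    then show ?case using assms by simp
  next
    case (Cons g w)
    have "eval_word A \<phi> (Word (g # letters w)) = \<phi> g \<otimes> eval_word A \<phi> w"
      by (simp add: eval_word_def)
    moreover have "y \<otimes> (\<phi> g \<otimes> eval_word A \<phi> w) = \<phi> g \<otimes> eval_word A \<phi> w \<otimes> y"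
      using Cons assms by (metis m_assoc phi_closed eval_word_closed)
    ultimately show ?case by simp
  qed
  with single show ?case using assms by (simp add: eval_single smult_mult_left smult_mult_right)
next
  case (add f g)
  then show ?case using assms by (simp add: l_distr r_distr)
qed

context primitive_root
begin

text \<open>The spectral idempotent of the group algebra of \<open>Z_n\<close> for the eigenvalue
  \<open>q ^ a\<close>. It lives in the free algebra on one letter so that it can be evaluated at
  any element whose nth power is 1.\<close>

definition idem :: "nat \<Rightarrow> (unit, 'k) free" where
  "idem a = (\<Sum>i<n. const (fc a i) * gen () ^ i)"

lemma sum_idem: "(\<Sum>a<n. idem a) = 1"
proof -
  have "(\<Sum>a<n. idem a) = (\<Sum>i<n. (\<Sum>a<n. const (fc a i)) * gen () ^ i)"
    unfolding idem_def by (subst sum.swap) (simp add: sum_distrib_right)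
  also have "\<dots> = (\<Sum>i<n. if i = 0 then 1 else 0)"
  proof (rule sum.cong)
    fix i assume "i \<in> {..<n}"
    then have "(\<Sum>a<n. fc a i) = (if i = 0 then 1 else 0)"
      \<comment> \<open>\<open>fc\<close> is symmetric, so this is orthogonality with
        \<open>b = 0\<close>.\<close>
      using sum_fc [of i 0] n_pos by (simp add: fc_def mult.commute)
    moreover have "(\<Sum>a<n. const (fc a i) :: (unit, 'k) free) = const (\<Sum>a<n. fc a i)"
      by (simp add: const_sum)
    ultimately show "(\<Sum>a<n. const (fc a i)) * gen () ^ i = (if i = 0 then 1 else 0)"
      by (cases "i = 0") simp_all
  qed simp
  also have "\<dots> = 1" using n_pos by simp
  finally show ?thesis .
qed

text \<open>Multiplication by the letter shifts the coefficients at the cost of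
  \<open>q ^ a\<close>. The difference telescopes, and its two end terms have equal coefficients
  because \<open>q ^ n = 1\<close>.\<close>

lemma gen_mult_idem:
  "gen () * idem a - const (q ^ a) * idem a = const (q ^ a * fc a 0) * (gen () ^ n - 1)"
proof -
  have fc_Suc: "fc a i = q ^ a * fc a (Suc i)" for i
    using q_nonzero by (simp add: fc_def power_add)
  have "gen () * idem a - const (q ^ a) * idem a
      = (\<Sum>i<n. gen () * (const (fc a i) * gen () ^ i) - const (q ^ a) * (const (fc a i) * gen () ^ i))"
    by (simp add: idem_def sum_distrib_left sum_subtractf)
  also have "\<dots> = (\<Sum>i<n. const (q ^ a * fc a (Suc i)) * gen () ^ Suc i - const (q ^ a * fc a i) * gen () ^ i)"
  proof (rule sum.cong)
    fix i
    have "gen () * (const (fc a i) * gen () ^ i) = const (fc a i) * (gen () ^ Suc i)"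
      by (simp add: const_central [of "fc a i"] mult.assoc)
    then show "gen () * (const (fc a i) * gen () ^ i) - const (q ^ a) * (const (fc a i) * gen () ^ i)
        = const (q ^ a * fc a (Suc i)) * gen () ^ Suc i - const (q ^ a * fc a i) * gen () ^ i"
      by (simp add: fc_Suc [symmetric] const_mult mult.assoc)
  qed simp
  also have "\<dots> = const (q ^ a * fc a n) * gen () ^ n - const (q ^ a * fc a 0) * gen () ^ 0"
    by (rule sum_lessThan_telescope)
  also have "fc a n = fc a 0"
    by (simp add: fc_def mult.commute [of a] power_mult q_power_n)
  finally show ?thesis by (simp add: algebra_simps)
qed

text \<open>Elements of order \<open>n\<close> decompose every element into eigenvectors, so it suffices to test
  vanishing on joint eigenvectors.\<close>

lemma joint_eigen:
  fixes A :: "('k, 'a, 'm) module_scheme" (structure)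
  assumes "kalg A" and h: "h \<in> carrier A" and "finite S" and "S \<subseteq> carrier A"
    and order: "\<And>x. x \<in> S \<Longrightarrow> x [^] n = \<one>"
    and commute: "\<And>x y. x \<in> S \<Longrightarrow> y \<in> S \<Longrightarrow> x \<otimes> y = y \<otimes> x"
    and eigen: "\<And>e. e \<in> carrier A \<Longrightarrow> (\<And>x. x \<in> S \<Longrightarrow> \<exists>a. x \<otimes> e = (q ^ a) \<odot> e) \<Longrightarrow> h \<otimes> e = \<zero>"
  shows "h = \<zero>"
proof -
  interpret kalg A by fact
  \<comment> \<open>\<open>U\<close> holds the elements for which \<open>e\<close> is not yet known
    to be an eigenvector; projections remove them one at a time.\<close>
  have "h \<otimes> e = \<zero>"
    if "e \<in> carrier A" "U \<subseteq> S" "\<And>x. x \<in> S - U \<Longrightarrow> \<exists>a. x \<otimes> e = (q ^ a) \<odot> e" for U e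
    using finite_subset [OF that(2) \<open>finite S\<close>] that
  proof (induction U arbitrary: e rule: finite_induct)
    case empty
    then show ?case using eigen by auto
  next
    case (insert x U)
    have x: "x \<in> S" "x \<in> carrier A" using insert assms by auto
    interpret X: free_eval A UNIV "\<lambda>_::unit. x" by unfold_locales (simp add: x)
    let ?E = "eval_free A (\<lambda>_. x)"
    have zero: "h \<otimes> (?E (idem a) \<otimes> e) = \<zero>" for a
    proof (rule insert.IH)
      show "?E (idem a) \<otimes> e \<in> carrier A" using insert by simp
      show "U \<subseteq> S" using insert by simp
      fix y assume y: "y \<in> S - U"
      then have yA: "y \<in> carrier A" using assms by auto
      show "\<exists>b. y \<otimes> (?E (idem a) \<otimes> e) = (q ^ b) \<odot> (?E (idem a) \<otimes> e)"
      proof (cases "y = x")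
        case True
        have "?E (gen () * idem a - const (q ^ a) * idem a) = \<zero>"
          unfolding gen_mult_idem using order [OF x(1)] by (simp add: minus_eq r_neg)
        then have "x \<otimes> ?E (idem a) = (q ^ a) \<odot> ?E (idem a)"
          using x by (simp add: X.eval_const smult_mult_left)
        then have "x \<otimes> (?E (idem a) \<otimes> e) = (q ^ a) \<odot> (?E (idem a) \<otimes> e)"
          using x insert.prems by (simp add: smult_mult_left flip: m_assoc)
        with True show ?thesis by blast
      next
        \<comment> \<open>The projection is a polynomial in \<open>x\<close>, which commutes with
          \<open>y\<close>, so an eigenvector of \<open>y\<close> stays one.\<close>
        case False
        then obtain b where b: "y \<otimes> e = (q ^ b) \<odot> e" using insert.prems(3) [of y] y by auto
        have "y \<otimes> (?E (idem a) \<otimes> e) = ?E (idem a) \<otimes> (y \<otimes> e)"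
          using X.eval_commute [OF yA, of "idem a"] commute [of x y] x y yA insert.prems(1)
          by (simp flip: m_assoc)
        then show ?thesis using b insert.prems(1) by (auto simp: smult_mult_right)
      qed
    qed
    have "h \<otimes> e = h \<otimes> (?E (\<Sum>a<n. idem a) \<otimes> e)"
      using insert.prems h by (simp add: sum_idem)
    also have "\<dots> = h \<otimes> ((\<Oplus>a\<in>{..<n}. ?E (idem a)) \<otimes> e)" by (subst X.eval_sum) auto
    also have "\<dots> = (\<Oplus>a\<in>{..<n}. h \<otimes> (?E (idem a) \<otimes> e))"
      using insert.prems h by (simp add: finsum_ldistr finsum_rdistr Pi_def)
    also have "\<dots> = \<zero>" by (simp add: zero)
    finally show ?case .
  qed
  \<comment> \<open>Nothing is known about eigenvalues on \<open>\<one>\<close>, so \<open>U\<close>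
    starts as all of \<open>S\<close>; and \<open>h \<otimes> \<one>\<close> is
    \<open>h\<close>.\<close>
  from this [of \<one> S] h show ?thesis by simp
qed

end

section \<open>The Hopf algebra\<close>

lemma free_pow [simp]: "f [^]\<^bsub>free_algebra G\<^esub> (k::nat) = f ^ k"
  by (induction k) (auto simp: nat_pow_def power_Suc2 simp del: power_Suc)

lemma free_finsum [simp]:
  "(\<And>x. x \<in> S \<Longrightarrow> f x \<in> carrier (free_algebra G)) \<Longrightarrow> finsum (free_algebra G) f S = sum f S"
proof (induction S rule: infinite_finite_induct)
  case (insert x F)
  then have "f \<in> F \<rightarrow> carrier (free_algebra G)" by auto
  with insert show ?case by simp
qed auto

lemma Hgens_iff [simp]: "X i \<in> Hgens m \<longleftrightarrow> i \<in> {1..m}" "Z i \<in> Hgens m \<longleftrightarrow> i \<in> {1..<m}"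
  by (auto simp: Hgens_def)

lemma transpose_in_range:
  "k \<in> {1..<m} \<Longrightarrow> i \<in> {1..m} \<Longrightarrow> Transposition.transpose k (Suc k) i \<in> {1..m}"
  by (auto simp: Transposition.transpose_def)

locale hopf_Hnm = primitive_root n q for n :: nat and q :: "'k::field_char_0" +
  fixes m :: nat
begin

lemma Hrels_closed: "Hrels n m q \<subseteq> carrier (free_algebra (Hgens m))"
  unfolding Hrels_def using transpose_in_range by (auto simp: Suc_le_eq)

sublocale H: presentation "Hgens m" "Hrels n m q"
  by unfold_locales (rule Hrels_closed)

sublocale HH: tensor H.P H.P
  by unfold_locales

lemma Halg_eq: "Halg n m q = H.P" and Hgen_eq: "Hgen n m q g = H.cls (gen g)"
  by (simp_all add: Halg_def Hgen_def H.presented_gen_eq)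

sublocale HH: kalg HH.BC by (rule HH.kalg_tensor)

text \<open>Calculations in \<open>H \<otimes> H\<close> are carried out in the free algebra on two copies of the
  generators of \<open>H\<close> and compared through the homomorphism \<open>\<theta>\<close> below. It sends generators that are out
  of range to zero, so that every element has an image and no side conditions arise.\<close>

definition dgen :: "hgen + hgen \<Rightarrow> ((hgen, 'k) free set \<times> (hgen, 'k) free set \<Rightarrow>\<^sub>0 'k) set" where
  "dgen s = (case s of
     Inl g \<Rightarrow> if g \<in> Hgens m then HH.pt (H.cls (gen g)) \<one>\<^bsub>H.P\<^esub> else \<zero>\<^bsub>HH.BC\<^esub>
   | Inr g \<Rightarrow> if g \<in> Hgens m then HH.pt \<one>\<^bsub>H.P\<^esub> (H.cls (gen g)) else \<zero>\<^bsub>HH.BC\<^esub>)"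

sublocale D: free_eval HH.BC UNIV dgen
  by unfold_locales (auto simp: dgen_def split: sum.split)

abbreviation \<theta> :: "(hgen + hgen, 'k) free \<Rightarrow> _" where "\<theta> \<equiv> eval_free HH.BC dgen"

text \<open>Moving \<open>x\<close> to the right past \<open>y\<close> turns \<open>y\<close> into
  \<open>y'\<close>. In this form commutation relations extend to sums and products in
  \<open>y\<close> and compose in \<open>x\<close>, so those of composite elements follow from those
  of generators.\<close>

definition conj_rel :: "(hgen + hgen, 'k) free \<Rightarrow> (hgen + hgen, 'k) free \<Rightarrow> (hgen + hgen, 'k) free \<Rightarrow> bool"
  where "conj_rel x y y' \<longleftrightarrow> \<theta> (x * y) = \<theta> (y' * x)"

lemma conj_rel_sym: "conj_rel x y y \<Longrightarrow> conj_rel y x x"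
  by (simp add: conj_rel_def)

lemma conj_rel_mult_right:
  "conj_rel x y y' \<Longrightarrow> conj_rel x z z' \<Longrightarrow> conj_rel x (y * z) (y' * z')"
  unfolding conj_rel_def D.eval_mult [OF free_carrier_UNIV free_carrier_UNIV]
  by (metis HH.m_assoc D.eval_closed free_carrier_UNIV)

lemma conj_rel_mult_left:
  "conj_rel x y y' \<Longrightarrow> conj_rel x' y' y'' \<Longrightarrow> conj_rel (x' * x) y y''"
  unfolding conj_rel_def D.eval_mult [OF free_carrier_UNIV free_carrier_UNIV]
  by (metis HH.m_assoc D.eval_closed free_carrier_UNIV)

lemma conj_rel_add: "conj_rel x y y' \<Longrightarrow> conj_rel x z z' \<Longrightarrow> conj_rel x (y + z) (y' + z')"
  by (simp add: conj_rel_def distrib_left distrib_right)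

lemma conj_rel_const: "conj_rel x (const c) (const c)"
  by (simp add: conj_rel_def const_central [of c x, symmetric] del: D.eval_mult)

lemma conj_rel_sum: "(\<And>i. i \<in> S \<Longrightarrow> conj_rel x (f i) (f' i)) \<Longrightarrow> conj_rel x (sum f S) (sum f' S)"
proof (induction S rule: infinite_finite_induct)
  case (insert i S) then show ?case by (simp add: conj_rel_add)
qed (auto simp: conj_rel_def)

lemma conj_rel_power: "conj_rel x y y' \<Longrightarrow> conj_rel x (y ^ k) (y' ^ k)"
proof (induction k)
  case 0 show ?case by (simp add: conj_rel_def)
next
  case (Suc k) then show ?case by (simp add: conj_rel_mult_right)
qed

definition "xl i = gen (Inl (X i))" definition "xr i = gen (Inr (X i))"
definition "zl k = gen (Inl (Z k))" definition "zr k = gen (Inr (Z k))"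

text \<open>\<open>J k (Suc k)\<close> is the twisting factor in the comultiplication of
  \<open>z_k\<close>. Where \<open>x_s \<otimes> 1\<close> and \<open>1 \<otimes> x_t\<close> have
  eigenvalues \<open>q ^ a\<close> and \<open>q ^ b\<close>, \<open>J s t\<close> acts as
  \<open>q ^ (a * b)\<close>. The indices are left free because conjugation by
  \<open>z_k \<otimes> z_k\<close> permutes them.\<close>

definition J :: "nat \<Rightarrow> nat \<Rightarrow> (hgen + hgen, 'k) free" where
  "J s t = (\<Sum>i<n. \<Sum>j<n. const (fc i j) * xl s ^ i * xr t ^ j)"

lemma conj_rel_J:
  "conj_rel x (xl s) (xl s') \<Longrightarrow> conj_rel x (xr t) (xr t') \<Longrightarrow> conj_rel x (J s t) (J s' t')"
  unfolding J_def
  by (intro conj_rel_sum conj_rel_mult_right conj_rel_const conj_rel_power)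

lemma pt_zero_left: "b \<in> carrier H.P \<Longrightarrow> HH.pt \<zero>\<^bsub>H.P\<^esub> b = \<zero>\<^bsub>HH.BC\<^esub>"
  using HH.pt_smult_left [of "\<one>\<^bsub>H.P\<^esub>" b 0] by simp

lemma pt_zero_right: "b \<in> carrier H.P \<Longrightarrow> HH.pt b \<zero>\<^bsub>H.P\<^esub> = \<zero>\<^bsub>HH.BC\<^esub>"
  using HH.pt_smult_right [of b "\<one>\<^bsub>H.P\<^esub>" 0] by simp

definition left :: "(hgen, 'k) free \<Rightarrow> (hgen + hgen, 'k) free" where
  "left = eval_free (free_algebra UNIV) (\<lambda>g. gen (Inl g))"

definition right :: "(hgen, 'k) free \<Rightarrow> (hgen + hgen, 'k) free" where
  "right = eval_free (free_algebra UNIV) (\<lambda>g. gen (Inr g))"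

sublocale L: free_eval "free_algebra UNIV" UNIV "\<lambda>g. gen (Inl g) :: (hgen + hgen, 'k) free"
  by unfold_locales simp

sublocale Rt: free_eval "free_algebra UNIV" UNIV "\<lambda>g. gen (Inr g) :: (hgen + hgen, 'k) free"
  by unfold_locales simp

lemma word_cls_Cons:
  "g \<in> Hgens m \<Longrightarrow> set (letters w) \<subseteq> Hgens m \<Longrightarrow> H.cls (single (Word (g # letters w)) 1)
     = H.cls (gen g) \<otimes>\<^bsub>H.P\<^esub> H.cls (single w 1)"
  by simp

lemma eval_word_free_Cons:
  "eval_word (free_algebra UNIV) \<phi> (Word (g # letters w)) = \<phi> g * eval_word (free_algebra UNIV) \<phi> w"
  by (simp add: eval_word_def)

lemma theta_left: "f \<in> H.F \<Longrightarrow> \<theta> (left f) = HH.pt (H.cls f) \<one>\<^bsub>H.P\<^esub>"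
proof (induction f rule: free_induct)
  case (single w c)
  then have "\<theta> (eval_word (free_algebra UNIV) (\<lambda>g. gen (Inl g)) w)
      = HH.pt (H.cls (single w 1)) \<one>\<^bsub>H.P\<^esub>"
  proof (induction w rule: word_induct)
    case Nil
    show ?case using HH.pt_one by (simp add: H.cls_one)
  next
    case (Cons g w)
    then show ?case
      by (simp only: word_cls_Cons eval_word_free_Cons D.eval_mult free_carrier_UNIV D.eval_gen UNIV_I)
        (simp add: dgen_def HH.pt_mult del: gen_mult_single H.cls_mult)
  qed
  moreover have "H.cls (single w c) = c \<odot>\<^bsub>H.P\<^esub> H.cls (single w 1)"
    using single by (simp add: const_def mult_single)
  ultimately show ?case
    using single by (simp add: left_def L.eval_single HH.pt_smult_left D.eval_const HH.smult_mult_left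
        del: H.cls_smult)
next
  case (add f g)
  then show ?case by (simp add: left_def HH.pt_add_left flip: H.cls_add)
qed

lemma theta_right: "f \<in> H.F \<Longrightarrow> \<theta> (right f) = HH.pt \<one>\<^bsub>H.P\<^esub> (H.cls f)"
proof (induction f rule: free_induct)
  case (single w c)
  then have "\<theta> (eval_word (free_algebra UNIV) (\<lambda>g. gen (Inr g)) w)
      = HH.pt \<one>\<^bsub>H.P\<^esub> (H.cls (single w 1))"
  proof (induction w rule: word_induct)
    case Nil
    show ?case using HH.pt_one by (simp add: H.cls_one)
  next
    case (Cons g w)
    then show ?case
      by (simp only: word_cls_Cons eval_word_free_Cons D.eval_mult free_carrier_UNIV D.eval_gen UNIV_I)
        (simp add: dgen_def HH.pt_mult del: gen_mult_single H.cls_mult)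
  qed
  moreover have "H.cls (single w c) = c \<odot>\<^bsub>H.P\<^esub> H.cls (single w 1)"
    using single by (simp add: const_def mult_single)
  ultimately show ?case
    using single by (simp add: right_def Rt.eval_single HH.pt_smult_right D.eval_const HH.smult_mult_left
        del: H.cls_smult)
next
  case (add f g)
  then show ?case by (simp add: right_def HH.pt_add_right flip: H.cls_add)
qed

text \<open>An element that is zero in \<open>H\<close> stays zero after tensoring with 1 on either
  side. The defining relations thus become available in each tensor factor.\<close>

lemma theta_left_rel: "r \<in> Hrels n m q \<Longrightarrow> \<theta> (left r) = \<zero>\<^bsub>HH.BC\<^esub>"
  and theta_right_rel: "r \<in> Hrels n m q \<Longrightarrow> \<theta> (right r) = \<zero>\<^bsub>HH.BC\<^esub>"
proof -
  assume r: "r \<in> Hrels n m q"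
  then have "r \<in> H.F" using Hrels_closed by auto
  moreover have "H.cls r = \<zero>\<^bsub>H.P\<^esub>"
    using H.cls_eq_iff [of r 0] H.rels_in_ideal [OF r] \<open>r \<in> H.F\<close> by (simp add: H.cls_zero)
  ultimately show "\<theta> (left r) = \<zero>\<^bsub>HH.BC\<^esub>" "\<theta> (right r) = \<zero>\<^bsub>HH.BC\<^esub>"
    by (simp_all add: theta_left theta_right pt_zero_left pt_zero_right)
qed

end

text \<open>Lets the relations be rewritten in the doubled free algebra, where substitution is plain
  computation, before they are compared in \<open>H \<otimes> H\<close>.\<close>

lemma (in free_eval) eval_subst:
  fixes \<delta> :: "'h \<Rightarrow> ('g, 'k) free"
  assumes "G = UNIV" "f \<in> carrier (free_algebra K)" "\<And>g. g \<in> K \<Longrightarrow> \<chi> g = eval_free A \<phi> (\<delta> g)"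
  shows "eval_free A \<chi> f = eval_free A \<phi> (eval_free (free_algebra UNIV) \<delta> f)"
proof -
  interpret C: free_eval A K \<chi> by unfold_locales (simp add: assms)
  interpret S: free_eval "free_algebra UNIV" K \<delta> by unfold_locales simp
  show ?thesis using assms(2)
  proof (induction f rule: free_induct)
    case (single w c)
    then have "eval_word A \<chi> w = eval_free A \<phi> (eval_word (free_algebra UNIV) \<delta> w)"
      by (induction w rule: word_induct) (simp_all add: eval_word_def assms)
    with single show ?case using assms(1)
      by (simp add: C.eval_single S.eval_single del: eval_mult)
  next
    case (add f g)
    then show ?case using assms(1) by simp
  qed
qed

context hopf_Hnm
begin

section \<open>The defining relations inside each tensor factor\<close>

lemma Hrels_cases:
  assumes "r \<in> Hrels n m q"
  obtains i where "i \<in> {1..m}" "r = gen (X i) ^ n - 1"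
    | i j where "i \<in> {1..m}" "j \<in> {1..m}" "r = gen (X i) * gen (X j) - gen (X j) * gen (X i)"
    | k i where "k \<in> {1..<m}" "i \<in> {1..m}"
        "r = gen (Z k) * gen (X i) - gen (X (Transposition.transpose k (Suc k) i)) * gen (Z k)"
    | k l where "k \<in> {1..<m}" "l \<in> {1..<m}" "\<bar>int k - int l\<bar> > 1"
        "r = gen (Z k) * gen (Z l) - gen (Z l) * gen (Z k)"
    | k where "k \<in> {1..<m}" "Suc k \<in> {1..<m}"
        "r = gen (Z k) * gen (Z (Suc k)) * gen (Z k) - gen (Z (Suc k)) * gen (Z k) * gen (Z (Suc k))"
    | k where "k \<in> {1..<m}" "r = gen (Z k) ^ 2 - (\<Sum>i<n. \<Sum>j<n. const (fc i j) *
         gen (X k) ^ i * gen (X (Suc k)) ^ j)"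
  using assms unfolding Hrels_def fc_def Suc_eq_plus1 by blast

lemma theta_eqI: "\<theta> (x - y) = \<zero>\<^bsub>HH.BC\<^esub> \<Longrightarrow> \<theta> x = \<theta> y"
  using HH.r_right_minus_eq [of "\<theta> x" "\<theta> y"] by simp

lemma xl_order: "i \<in> {1..m} \<Longrightarrow> \<theta> (xl i ^ n) = \<one>\<^bsub>HH.BC\<^esub>"
  and xr_order: "i \<in> {1..m} \<Longrightarrow> \<theta> (xr i ^ n) = \<one>\<^bsub>HH.BC\<^esub>"
proof -
  assume "i \<in> {1..m}"
  then have r: "gen (X i) ^ n - 1 \<in> Hrels n m q" unfolding Hrels_def by blast
  show "\<theta> (xl i ^ n) = \<one>\<^bsub>HH.BC\<^esub>"
    using theta_eqI [of "xl i ^ n" 1] theta_left_rel [OF r] unfolding left_def by (simp add: xl_def)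
  show "\<theta> (xr i ^ n) = \<one>\<^bsub>HH.BC\<^esub>"
    using theta_eqI [of "xr i ^ n" 1] theta_right_rel [OF r] unfolding right_def by (simp add: xr_def)
qed

lemma xl_xl: "i \<in> {1..m} \<Longrightarrow> j \<in> {1..m} \<Longrightarrow> conj_rel (xl i) (xl j) (xl j)"
  and xr_xr: "i \<in> {1..m} \<Longrightarrow> j \<in> {1..m} \<Longrightarrow> conj_rel (xr i) (xr j) (xr j)"
proof -
  assume "i \<in> {1..m}" "j \<in> {1..m}"
  then have r: "gen (X i) * gen (X j) - gen (X j) * gen (X i) \<in> Hrels n m q" unfolding Hrels_def by blast
  show "conj_rel (xl i) (xl j) (xl j)" unfolding conj_rel_def
    by (rule theta_eqI) (use theta_left_rel [OF r] in \<open>simp add: left_def xl_def\<close>)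
  show "conj_rel (xr i) (xr j) (xr j)" unfolding conj_rel_def
    by (rule theta_eqI) (use theta_right_rel [OF r] in \<open>simp add: right_def xr_def\<close>)
qed

lemma zl_xl: "k \<in> {1..<m} \<Longrightarrow> i \<in> {1..m} \<Longrightarrow>
    conj_rel (zl k) (xl i) (xl (Transposition.transpose k (Suc k) i))"
  and zr_xr: "k \<in> {1..<m} \<Longrightarrow> i \<in> {1..m} \<Longrightarrow>
    conj_rel (zr k) (xr i) (xr (Transposition.transpose k (Suc k) i))"
proof -
  assume "k \<in> {1..<m}" "i \<in> {1..m}"
  then have r: "gen (Z k) * gen (X i) - gen (X (Transposition.transpose k (k + 1) i)) * gen (Z k)
      \<in> Hrels n m q" unfolding Hrels_def by blast
  show "conj_rel (zl k) (xl i) (xl (Transposition.transpose k (Suc k) i))" unfolding conj_rel_def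
    by (rule theta_eqI) (use theta_left_rel [OF r] in \<open>simp add: left_def xl_def zl_def\<close>)
  show "conj_rel (zr k) (xr i) (xr (Transposition.transpose k (Suc k) i))" unfolding conj_rel_def
    by (rule theta_eqI) (use theta_right_rel [OF r] in \<open>simp add: right_def xr_def zr_def\<close>)
qed

lemma zl_zl: "k \<in> {1..<m} \<Longrightarrow> l \<in> {1..<m} \<Longrightarrow> \<bar>int k - int l\<bar> > 1 \<Longrightarrow> conj_rel (zl k) (zl l) (zl l)"
  and zr_zr: "k \<in> {1..<m} \<Longrightarrow> l \<in> {1..<m} \<Longrightarrow> \<bar>int k - int l\<bar> > 1 \<Longrightarrow> conj_rel (zr k) (zr l) (zr l)"
proof -
  assume "k \<in> {1..<m}" "l \<in> {1..<m}" "\<bar>int k - int l\<bar> > 1"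
  then have r: "gen (Z k) * gen (Z l) - gen (Z l) * gen (Z k) \<in> Hrels n m q" unfolding Hrels_def by blast
  show "conj_rel (zl k) (zl l) (zl l)" unfolding conj_rel_def
    by (rule theta_eqI) (use theta_left_rel [OF r] in \<open>simp add: left_def zl_def\<close>)
  show "conj_rel (zr k) (zr l) (zr l)" unfolding conj_rel_def
    by (rule theta_eqI) (use theta_right_rel [OF r] in \<open>simp add: right_def zr_def\<close>)
qed

lemma zl_braid: "k \<in> {1..<m} \<Longrightarrow> Suc k \<in> {1..<m} \<Longrightarrow>
    \<theta> (zl k * zl (Suc k) * zl k) = \<theta> (zl (Suc k) * zl k * zl (Suc k))"
  and zr_braid: "k \<in> {1..<m} \<Longrightarrow> Suc k \<in> {1..<m} \<Longrightarrow>
    \<theta> (zr k * zr (Suc k) * zr k) = \<theta> (zr (Suc k) * zr k * zr (Suc k))"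
proof -
  assume "k \<in> {1..<m}" "Suc k \<in> {1..<m}"
  then have "k \<in> {1..<m} \<and> k + 1 \<in> {1..<m}" by simp
  then have r: "gen (Z k) * gen (Z (k + 1)) * gen (Z k) - gen (Z (k + 1)) * gen (Z k) * gen (Z (k + 1))
      \<in> Hrels n m q" unfolding Hrels_def by blast
  show "\<theta> (zl k * zl (Suc k) * zl k) = \<theta> (zl (Suc k) * zl k * zl (Suc k))"
    by (rule theta_eqI) (use theta_left_rel [OF r] in \<open>simp add: left_def zl_def\<close>)
  show "\<theta> (zr k * zr (Suc k) * zr k) = \<theta> (zr (Suc k) * zr k * zr (Suc k))"
    by (rule theta_eqI) (use theta_right_rel [OF r] in \<open>simp add: right_def zr_def\<close>)
qed

text \<open>The right-hand side of the relation for the square of \<open>z_k\<close>, with free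
  arguments so that it also applies to the images of \<open>x_k\<close> and \<open>x_(k+1)\<close>
  in the tensor square.\<close>

definition "fsum x y = (\<Sum>i<n. \<Sum>j<n. const (fc i j) * x ^ i * y ^ j)"

lemma zl_square: "k \<in> {1..<m} \<Longrightarrow> \<theta> (zl k ^ 2) = \<theta> (fsum (xl k) (xl (Suc k)))"
  and zr_square: "k \<in> {1..<m} \<Longrightarrow> \<theta> (zr k ^ 2) = \<theta> (fsum (xr k) (xr (Suc k)))"
proof -
  assume "k \<in> {1..<m}"
  then have r: "gen (Z k) ^ 2 - (\<Sum>i<n. \<Sum>j<n. const (inverse (of_nat n) * inverse (q ^ (i * j))) *
           gen (X k) ^ i * gen (X (k + 1)) ^ j) \<in> Hrels n m q" unfolding Hrels_def by blast
  show "\<theta> (zl k ^ 2) = \<theta> (fsum (xl k) (xl (Suc k)))"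
    by (rule theta_eqI) (use theta_left_rel [OF r] in
      \<open>simp add: left_def zl_def xl_def fsum_def fc_def L.eval_sum L.eval_const\<close>)
  show "\<theta> (zr k ^ 2) = \<theta> (fsum (xr k) (xr (Suc k)))"
    by (rule theta_eqI) (use theta_right_rel [OF r] in
      \<open>simp add: right_def zr_def xr_def fsum_def fc_def Rt.eval_sum Rt.eval_const\<close>)
qed

section \<open>The images of the generators under the comultiplication\<close>

lemma conj_left_right: "conj_rel (gen (Inl g)) (gen (Inr h)) (gen (Inr h))"
  unfolding conj_rel_def by (simp add: dgen_def HH.pt_mult)

lemma left_right [simp]:
  "conj_rel (xl i) (xr j) (xr j)" "conj_rel (xl i) (zr j) (zr j)"
  "conj_rel (zl i) (xr j) (xr j)" "conj_rel (zl i) (zr j) (zr j)"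
  "conj_rel (xr j) (xl i) (xl i)" "conj_rel (zr j) (xl i) (xl i)"
  "conj_rel (xr j) (zl i) (zl i)" "conj_rel (zr j) (zl i) (zl i)"
  by (simp_all only: xl_def xr_def zl_def zr_def conj_left_right conj_rel_sym)

text \<open>Representatives of \<open>x_i \<otimes> x_i\<close>, of \<open>z_k \<otimes> z_k\<close>
  and of the proposed comultiplication of \<open>z_k\<close>.\<close>

definition "dx i = xl i * xr i"
definition "zz k = zl k * zr k"
definition "dz k = J k (Suc k) * zz k"

text \<open>Each component of \<open>z_k \<otimes> z_k\<close> permutes the \<open>x\<close> of its
  own tensor factor and commutes with those of the other.\<close>

lemma zz_J: "k \<in> {1..<m} \<Longrightarrow> s \<in> {1..m} \<Longrightarrow> t \<in> {1..m} \<Longrightarrow> conj_rel (zz k) (J s t)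
    (J (Transposition.transpose k (Suc k) s) (Transposition.transpose k (Suc k) t))"
  unfolding zz_def
  by (intro conj_rel_J)
    (erule (1) conj_rel_mult_left [OF left_right(6) zl_xl] conj_rel_mult_left [OF zr_xr left_right(3)])+

lemma J_J:
  assumes "s \<in> {1..m}" "t \<in> {1..m}" "s' \<in> {1..m}" "t' \<in> {1..m}"
  shows "conj_rel (J s t) (J s' t') (J s' t')"
  by (intro conj_rel_J conj_rel_sym [OF conj_rel_J] xl_xl xr_xr left_right assms)

lemma order_dx: "i \<in> {1..m} \<Longrightarrow> \<theta> (dx i ^ n) = \<one>\<^bsub>HH.BC\<^esub>"
proof -
  assume i: "i \<in> {1..m}"
  have "\<theta> (dx i ^ k) = \<theta> (xl i ^ k * xr i ^ k)" for k
  proof (induction k)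
    case (Suc k)
    have "\<theta> (dx i ^ Suc k) = \<theta> (dx i) \<otimes>\<^bsub>HH.BC\<^esub> \<theta> (dx i ^ k)" by (simp del: D.eval_power)
    also have "\<dots> = \<theta> (xl i * (xr i * xl i ^ k) * xr i ^ k)"
      unfolding Suc by (simp add: dx_def HH.m_assoc del: D.eval_power)
    also have "\<dots> = \<theta> (xl i * (xl i ^ k * xr i) * xr i ^ k)"
      using conj_rel_power [OF left_right(5), of i i k] unfolding conj_rel_def
      by (simp only: D.eval_mult free_carrier_UNIV left_right)
    finally show ?case by (simp add: HH.m_assoc del: D.eval_power)
  qed simp
  with xl_order [OF i] xr_order [OF i] show ?thesis by simp
qed

lemma dx_dx: "i \<in> {1..m} \<Longrightarrow> j \<in> {1..m} \<Longrightarrow> conj_rel (dx i) (dx j) (dx j)"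
  unfolding dx_def
  by (intro conj_rel_mult_right conj_rel_sym [OF conj_rel_mult_right] xl_xl xr_xr left_right)

lemma dz_dx:
  assumes "k \<in> {1..<m}" "i \<in> {1..m}"
  shows "conj_rel (dz k) (dx i) (dx (Transposition.transpose k (Suc k) i))"
proof -
  let ?i = "Transposition.transpose k (Suc k) i"
  have i: "?i \<in> {1..m}" using assms by (rule transpose_in_range)
  have k: "k \<in> {1..m}" "Suc k \<in> {1..m}" using assms by auto
  have "conj_rel (zz k) (dx i) (dx ?i)"
    unfolding zz_def dx_def
    by (intro conj_rel_mult_right)
      (rule conj_rel_mult_left [OF left_right(6) zl_xl [OF assms]]
        conj_rel_mult_left [OF zr_xr [OF assms] left_right(3)])+
  moreover have "conj_rel (J k (Suc k)) (dx ?i) (dx ?i)"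
    unfolding dx_def
    by (intro conj_rel_sym [OF conj_rel_J] conj_rel_sym [OF conj_rel_mult_right] xl_xl xr_xr left_right i k)
  ultimately show ?thesis unfolding dz_def by (rule conj_rel_mult_left)
qed

lemma zz_zz: "k \<in> {1..<m} \<Longrightarrow> l \<in> {1..<m} \<Longrightarrow> \<bar>int k - int l\<bar> > 1 \<Longrightarrow> conj_rel (zz k) (zz l) (zz l)"
  unfolding zz_def
  by (intro conj_rel_mult_right conj_rel_sym [OF conj_rel_mult_right] zl_zl zr_zr left_right) simp_all

text \<open>For distant \<open>k\<close> and \<open>l\<close>, the transposition of one fixes both
  indices in the twisting factor of the other, so all the factors commute.\<close>

lemma dz_dz:
  assumes "k \<in> {1..<m}" "l \<in> {1..<m}" "\<bar>int k - int l\<bar> > 1"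
  shows "conj_rel (dz k) (dz l) (dz l)"
proof -
  have kl: "k \<in> {1..m}" "Suc k \<in> {1..m}" "l \<in> {1..m}" "Suc l \<in> {1..m}" using assms by auto
  have "conj_rel (zz k) (J l (Suc l)) (J l (Suc l))" "conj_rel (zz l) (J k (Suc k)) (J k (Suc k))"
    using zz_J [of k l "Suc l"] zz_J [of l k "Suc k"] assms kl by (auto simp: Transposition.transpose_def split: if_splits)
  then show ?thesis unfolding dz_def
    by (intro conj_rel_mult_right conj_rel_sym [OF conj_rel_mult_right] J_J kl zz_zz assms)
      (auto intro: conj_rel_sym)
qed

lemma zz_braid:
  assumes "k \<in> {1..<m}" "Suc k \<in> {1..<m}"
  shows "\<theta> (zz k * zz (Suc k) * zz k) = \<theta> (zz (Suc k) * zz k * zz (Suc k))"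
proof -
  \<comment> \<open>The braid relation holds in each tensor factor, so it suffices to separate left
    components from right ones.\<close>
  have split: "\<theta> (zz a * zz b * zz c) = \<theta> (zl a * zl b * zl c) \<otimes>\<^bsub>HH.BC\<^esub> \<theta> (zr a * zr b * zr c)" for a b c
  proof -
    have com: "\<theta> (zr i) \<otimes>\<^bsub>HH.BC\<^esub> \<theta> (zl j) = \<theta> (zl j) \<otimes>\<^bsub>HH.BC\<^esub> \<theta> (zr i)" for i j
      using left_right(8) [of i j] by (simp add: conj_rel_def)
    have com': "\<theta> (zr i) \<otimes>\<^bsub>HH.BC\<^esub> (\<theta> (zl j) \<otimes>\<^bsub>HH.BC\<^esub> y) = \<theta> (zl j) \<otimes>\<^bsub>HH.BC\<^esub> (\<theta> (zr i) \<otimes>\<^bsub>HH.BC\<^esub> y)"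
      if "y \<in> carrier HH.BC" for i j y
      using that by (simp add: com flip: HH.m_assoc)
    show ?thesis by (simp add: zz_def HH.m_assoc com com')
  qed
  show ?thesis using zl_braid [OF assms] zr_braid [OF assms] by (simp only: split)
qed

end

text \<open>Moving \<open>a\<close> and \<open>c\<close> to the front past \<open>u\<close> and
  \<open>v\<close> turns each side into the product of \<open>a\<close>, \<open>b\<close>,
  \<open>c\<close> times a braid word. In the application these three are the twisting factors for
  the index pairs \<open>(k, k+1)\<close>, \<open>(k, k+2)\<close> and
  \<open>(k+1, k+2)\<close>.\<close>

lemma (in monoid) braid_identity:
  assumes c: "a \<in> carrier G" "b \<in> carrier G" "c \<in> carrier G" "u \<in> carrier G" "v \<in> carrier G"
    and comm: "a \<otimes> b = b \<otimes> a" "a \<otimes> c = c \<otimes> a" "b \<otimes> c = c \<otimes> b"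
    and "u \<otimes> c = b \<otimes> u" "v \<otimes> a = b \<otimes> v" "u \<otimes> b = c \<otimes> u" "v \<otimes> b = a \<otimes> v"
    and braid: "u \<otimes> v \<otimes> u = v \<otimes> u \<otimes> v"
  shows "(a \<otimes> u) \<otimes> (c \<otimes> v) \<otimes> (a \<otimes> u) = (c \<otimes> v) \<otimes> (a \<otimes> u) \<otimes> (c \<otimes> v)"
proof -
  have swap: "x \<otimes> (y \<otimes> z) = y' \<otimes> (x \<otimes> z)"
    if "x \<otimes> y = y' \<otimes> x" "x \<in> carrier G" "y \<in> carrier G" "z \<in> carrier G" "y' \<in> carrier G" for x y y' z
    using that by (simp flip: m_assoc)
  have 1: "(a \<otimes> u) \<otimes> (c \<otimes> v) \<otimes> (a \<otimes> u) = a \<otimes> (b \<otimes> (c \<otimes> (u \<otimes> v \<otimes> u)))"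
    using assms(1-5) by (simp add: m_assoc swap [OF assms(9)] swap [OF assms(10)] swap [OF assms(11)])
  have "(c \<otimes> v) \<otimes> (a \<otimes> u) \<otimes> (c \<otimes> v) = c \<otimes> (b \<otimes> (a \<otimes> (v \<otimes> u \<otimes> v)))"
    using assms(1-5) by (simp add: m_assoc swap [OF assms(9)] swap [OF assms(10)] swap [OF assms(12)])
  also have "\<dots> = a \<otimes> (b \<otimes> (c \<otimes> (v \<otimes> u \<otimes> v)))"
    using assms(1-5) comm by (metis m_assoc m_closed)
  finally show ?thesis using 1 braid by simp
qed

context hopf_Hnm
begin

lemma dz_braid:
  assumes "k \<in> {1..<m}" "Suc k \<in> {1..<m}"
  shows "\<theta> (dz k * dz (Suc k) * dz k) = \<theta> (dz (Suc k) * dz k * dz (Suc k))"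
proof -
  have k: "k \<in> {1..m}" "Suc k \<in> {1..m}" "Suc (Suc k) \<in> {1..m}" using assms by auto
  let ?a = "J k (Suc k)" and ?b = "J k (Suc (Suc k))" and ?c = "J (Suc k) (Suc (Suc k))"
  have "conj_rel (zz k) ?c ?b" "conj_rel (zz k) ?b ?c" "conj_rel (zz (Suc k)) ?a ?b" "conj_rel (zz (Suc k)) ?b ?a"
    using zz_J [OF assms(1) k(2,3)] zz_J [OF assms(1) k(1,3)] zz_J [OF assms(2) k(1,2)] zz_J [OF assms(2) k(1,3)]
    by (simp_all add: Transposition.transpose_def)
  note J = this J_J [OF k(1,2) k(1,3)] J_J [OF k(1,2) k(2,3)] J_J [OF k(1,3) k(2,3)]
  show ?thesis
    unfolding dz_def D.eval_mult [OF free_carrier_UNIV free_carrier_UNIV]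
    by (rule HH.braid_identity [where b = "\<theta> ?b"])
      (use J zz_braid [OF assms] in \<open>simp_all add: conj_rel_def\<close>)
qed

text \<open>Once \<open>z_k \<otimes> z_k\<close> is moved to the right and squared, both sides are
  polynomials in \<open>x_k\<close> and \<open>x_(k+1)\<close> of the two tensor factors. These four
  elements commute and have nth power 1, so joint eigenvectors decide.\<close>

lemma dz_square:
  assumes "k \<in> {1..<m}"
  shows "\<theta> (dz k ^ 2) = \<theta> (fsum (dx k) (dx (Suc k)))"
proof -
  have k: "k \<in> {1..m}" "Suc k \<in> {1..m}" using assms by auto
  let ?J = "J k (Suc k)" and ?J' = "J (Suc k) k"
  let ?L = "?J * ?J' * (fsum (xl k) (xl (Suc k)) * fsum (xr k) (xr (Suc k)))"
  let ?R = "fsum (dx k) (dx (Suc k))"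
  have zzJ: "\<theta> (zz k) \<otimes>\<^bsub>HH.BC\<^esub> \<theta> ?J = \<theta> ?J' \<otimes>\<^bsub>HH.BC\<^esub> \<theta> (zz k)"
    using zz_J [OF assms k] by (simp add: conj_rel_def)
  have "\<theta> (zz k) \<otimes>\<^bsub>HH.BC\<^esub> \<theta> (zz k) = \<theta> (zl k ^ 2 * zr k ^ 2)"
  proof -
    have "\<theta> (zr k * zl k) = \<theta> (zl k * zr k)" using left_right(8) [of k k] by (simp add: conj_rel_def)
    then have "\<theta> (zl k * (zr k * zl k) * zr k) = \<theta> (zl k * (zl k * zr k) * zr k)"
      by (simp only: D.eval_mult free_carrier_UNIV)
    then show ?thesis
      unfolding zz_def power2_eq_square D.eval_mult [OF free_carrier_UNIV free_carrier_UNIV]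
      by (simp add: HH.m_assoc)
  qed
  then have zzzz: "\<theta> (zz k) \<otimes>\<^bsub>HH.BC\<^esub> \<theta> (zz k) = \<theta> (fsum (xl k) (xl (Suc k)) * fsum (xr k) (xr (Suc k)))"
    by (simp only: zl_square [OF assms] zr_square [OF assms] D.eval_mult free_carrier_UNIV)
  have "\<theta> (dz k ^ 2) = \<theta> ?J \<otimes>\<^bsub>HH.BC\<^esub> (\<theta> (zz k) \<otimes>\<^bsub>HH.BC\<^esub> \<theta> ?J) \<otimes>\<^bsub>HH.BC\<^esub> \<theta> (zz k)"
    by (simp add: dz_def power2_eq_square HH.m_assoc)
  also have "\<dots> = \<theta> ?J \<otimes>\<^bsub>HH.BC\<^esub> \<theta> ?J' \<otimes>\<^bsub>HH.BC\<^esub> (\<theta> (zz k) \<otimes>\<^bsub>HH.BC\<^esub> \<theta> (zz k))"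
    unfolding zzJ by (simp add: HH.m_assoc)
  also have "\<dots> = \<theta> ?L" by (simp add: zzzz)
  finally have "\<theta> (dz k ^ 2) = \<theta> ?L" .
  also have "\<theta> ?L = \<theta> ?R"
  proof (rule theta_eqI)
    let ?S = "\<theta> ` {xl k, xl (Suc k), xr k, xr (Suc k)}"
    show "\<theta> (?L - ?R) = \<zero>\<^bsub>HH.BC\<^esub>"
    proof (rule joint_eigen [of HH.BC _ ?S])
      show "x [^]\<^bsub>HH.BC\<^esub> n = \<one>\<^bsub>HH.BC\<^esub>" if "x \<in> ?S" for x
        using that k xl_order xr_order by (auto simp del: atLeastAtMost_iff)
      show "x \<otimes>\<^bsub>HH.BC\<^esub> y = y \<otimes>\<^bsub>HH.BC\<^esub> x" if "x \<in> ?S" "y \<in> ?S" for x y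
        using that xl_xl [OF k] xr_xr [OF k] left_right by (auto simp: conj_rel_def)
    next
      fix e assume e: "e \<in> carrier HH.BC" and eig: "\<And>x. x \<in> ?S \<Longrightarrow> \<exists>a. x \<otimes>\<^bsub>HH.BC\<^esub> e = (q ^ a) \<odot>\<^bsub>HH.BC\<^esub> e"
      define ev where "ev f c \<longleftrightarrow> \<theta> f \<otimes>\<^bsub>HH.BC\<^esub> e = c \<odot>\<^bsub>HH.BC\<^esub> e" for f c
      have ev_mult: "ev (f * g) (c * d)" if "ev f c" "ev g d" for f g c d
        using that e by (simp add: ev_def HH.m_assoc HH.smult_mult_right HH.smult_smult mult.commute)
      have ev_add: "ev (f + g) (c + d)" if "ev f c" "ev g d" for f g c d
        using that e by (simp add: ev_def HH.l_distr HH.smult_add_scalar)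
      have ev_const: "ev (const c) c" for c
        using e by (simp add: ev_def D.eval_const HH.smult_mult_left)
      have ev_power: "ev (f ^ i) (c ^ i)" if "ev f c" for f c i
        using that ev_const [of 1] by (induction i) (auto intro: ev_mult)
      have ev_sum: "ev (sum f S) (sum c S)" if "\<And>i. i \<in> S \<Longrightarrow> ev (f i) (c i)" for f c and S :: "nat set"
        using that ev_const [of 0] by (induction S rule: infinite_finite_induct) (auto intro: ev_add)
      have ev_fsum: "ev (\<Sum>i<n. \<Sum>j<n. const (fc i j) * f ^ i * g ^ j) (q ^ (a * b))"
        if "ev f (q ^ a)" "ev g (q ^ b)" for f g a b
        unfolding fourier [symmetric]
        by (intro ev_sum ev_mult ev_const ev_power that)
      obtain a a' b b' where 1: "ev (xl k) (q ^ a)" "ev (xl (Suc k)) (q ^ a')"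
          "ev (xr k) (q ^ b)" "ev (xr (Suc k)) (q ^ b')"
        using eig unfolding ev_def by (metis image_eqI insertCI)
      have "ev ?L (q ^ (a * b') * q ^ (a' * b) * (q ^ (a * a') * q ^ (b * b')))"
        unfolding J_def fsum_def by (intro ev_mult ev_fsum 1)
      \<comment> \<open>With weights \<open>a\<close>, \<open>a'\<close> in the left factor and
        \<open>b\<close>, \<open>b'\<close> in the right one, the four exponents of
        \<open>?L\<close> are the terms of this product when expanded.\<close>
      moreover have "ev ?R (q ^ ((a + b) * (a' + b')))"
        unfolding fsum_def dx_def by (rule ev_fsum) (auto simp: power_add intro: ev_mult 1)
      ultimately have "\<theta> ?L \<otimes>\<^bsub>HH.BC\<^esub> e = \<theta> ?R \<otimes>\<^bsub>HH.BC\<^esub> e"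
        by (simp add: ev_def algebra_simps power_add del: D.eval_mult)
      then show "\<theta> (?L - ?R) \<otimes>\<^bsub>HH.BC\<^esub> e = \<zero>\<^bsub>HH.BC\<^esub>"
        using e by (simp add: HH.minus_eq HH.l_distr HH.l_minus HH.r_neg del: D.eval_mult)
    qed (auto simp: HH.kalg_axioms)
  qed
  finally show ?thesis .
qed

section \<open>The comultiplication as an algebra homomorphism\<close>

lemma tc_sum: "(\<And>x. x \<in> S \<Longrightarrow> f x \<in> HH.T) \<Longrightarrow> HH.tc (sum f S) = finsum HH.BC (\<lambda>x. HH.tc (f x)) S"
proof (induction S rule: infinite_finite_induct)
  case (insert x F)
  then have "(\<lambda>x. HH.tc (f x)) \<in> F \<rightarrow> carrier HH.BC" by auto
  with insert show ?case by (simp flip: HH.tc_add)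
qed (auto simp: HH.tensor_structure tensor_class_def)

lemma theta_xl_power: "i \<in> {1..m} \<Longrightarrow> \<theta> (xl i ^ a) = HH.pt (H.cls (gen (X i)) [^]\<^bsub>H.P\<^esub> a) \<one>\<^bsub>H.P\<^esub>"
  using theta_left [of "gen (X i) ^ a"] by (simp add: left_def xl_def)

lemma theta_xr_power: "i \<in> {1..m} \<Longrightarrow> \<theta> (xr i ^ a) = HH.pt \<one>\<^bsub>H.P\<^esub> (H.cls (gen (X i)) [^]\<^bsub>H.P\<^esub> a)"
  using theta_right [of "gen (X i) ^ a"] by (simp add: right_def xr_def)

lemma theta_J:
  assumes "s \<in> {1..m}" "t \<in> {1..m}"
  shows "\<theta> (J s t) = HH.tc (\<Sum>i<n. \<Sum>j<n. single
     (H.cls (gen (X s)) [^]\<^bsub>H.P\<^esub> i, H.cls (gen (X t)) [^]\<^bsub>H.P\<^esub> j) (fc i j))"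
proof -
  have T_sum: "sum f S \<in> HH.T" if "\<And>x. x \<in> S \<Longrightarrow> f x \<in> HH.T" for f and S :: "nat set"
    using that by (induction S rule: infinite_finite_induct) auto
  have "\<theta> (const c * xl s ^ i * xr t ^ j) = HH.tc (single
      (H.cls (gen (X s)) [^]\<^bsub>H.P\<^esub> i, H.cls (gen (X t)) [^]\<^bsub>H.P\<^esub> j) c)" for c i j
    using assms
    by (simp add: D.eval_const theta_xl_power theta_xr_power HH.smult_mult_left HH.tc_mult HH.tc_smult
        del: D.eval_power H.cls_power atLeastAtMost_iff)
  then show ?thesis unfolding J_def using assms
    by (simp add: D.eval_sum tc_sum T_sum)
qed

definition "delta g = (case g of X i \<Rightarrow> dx i | Z k \<Rightarrow> dz k)"

lemma comult_gen:
  assumes "g \<in> Hgens m" shows "Hcomult_gen n m q g = \<theta> (delta g)"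
proof (cases g)
  case (X i)
  then have "i \<in> {1..m}" using assms by simp
  with theta_xl_power [of i 1] theta_xr_power [of i 1] X show ?thesis
    by (simp add: delta_def dx_def Hgen_eq Halg_eq HH.pt_mult)
next
  case (Z k)
  then have "k \<in> {1..m}" "Suc k \<in> {1..m}" "Z k \<in> Hgens m" using assms by auto
  moreover have "\<theta> (zz k) = HH.pt (H.cls (gen (Z k))) (H.cls (gen (Z k)))"
    using \<open>Z k \<in> Hgens m\<close> by (simp add: zz_def zl_def zr_def dgen_def HH.pt_mult)
  ultimately show ?thesis using Z
    by (simp add: delta_def dz_def Hgen_eq Halg_eq theta_J fc_def del: H.cls_power)
qed

text \<open>With this, \<open>comult\<close> is known to be well defined and multiplicative. Each
  relation is rewritten by \<open>delta\<close> and settled by the corresponding lemma on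
  \<open>dx\<close> and \<open>dz\<close>.\<close>

sublocale Cm: presentation_lift "Hgens m" "Hrels n m q" HH.BC "Hcomult_gen n m q"
proof unfold_locales
  show "Hcomult_gen n m q g \<in> carrier HH.BC" if "g \<in> Hgens m" for g
    using that by (simp add: comult_gen)
  interpret S: free_eval "free_algebra UNIV" "Hgens m" delta by unfold_locales simp
  let ?s = "eval_free (free_algebra UNIV) delta"
  fix r assume r: "r \<in> Hrels n m q"
  have "\<theta> (?s r) = \<zero>\<^bsub>HH.BC\<^esub>"
  proof -
    have sub: "\<theta> x \<ominus>\<^bsub>HH.BC\<^esub> \<theta> y = \<zero>\<^bsub>HH.BC\<^esub>" if "\<theta> x = \<theta> y" for x y
      using that HH.r_right_minus_eq [of "\<theta> x" "\<theta> y"] by simp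
    have diff: "\<theta> (x - y) = \<zero>\<^bsub>HH.BC\<^esub>" if "\<theta> x = \<theta> y" for x y
      using sub [OF that] by simp
    from r show ?thesis
    proof (cases r rule: Hrels_cases)
      case (1 i)
      then have "?s r = dx i ^ n - 1" by (simp add: delta_def)
      with order_dx [OF 1(1)] diff [of "dx i ^ n" 1] show ?thesis by (simp del: D.eval_diff D.eval_power)
    next
      case (2 i j)
      then have "?s r = dx i * dx j - dx j * dx i" by (simp add: delta_def)
      with dx_dx [OF 2(1,2)] diff show ?thesis by (metis conj_rel_def)
    next
      case (3 k i)
      then have "?s r = dz k * dx i - dx (Transposition.transpose k (Suc k) i) * dz k"
        using transpose_in_range [OF 3(1,2)] by (simp add: delta_def)
      with dz_dx [OF 3(1,2)] diff show ?thesis by (metis conj_rel_def)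
    next
      case (4 k l)
      then have "?s r = dz k * dz l - dz l * dz k" by (simp add: delta_def)
      with dz_dz [OF 4(1-3)] diff show ?thesis by (metis conj_rel_def)
    next
      case (5 k)
      then have "?s r = dz k * dz (Suc k) * dz k - dz (Suc k) * dz k * dz (Suc k)" by (simp add: delta_def)
      with dz_braid [OF 5(1,2)] diff show ?thesis by metis
    next
      case (6 k)
      then have "?s r = dz k ^ 2 - fsum (dx k) (dx (Suc k))"
        by (simp add: delta_def fsum_def S.eval_sum S.eval_const)
      with dz_square [OF 6(1)] diff show ?thesis by metis
    qed
  qed
  moreover have "r \<in> H.F" using r Hrels_closed by auto
  ultimately show "eval_free HH.BC (Hcomult_gen n m q) r = \<zero>\<^bsub>HH.BC\<^esub>"
    using D.eval_subst [of r "Hgens m" "Hcomult_gen n m q" delta] comult_gen by simp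
qed

end

lemma (in free_eval) eval_diff_eq_zero:
  "\<lbrakk>f \<in> carrier (free_algebra G); g \<in> carrier (free_algebra G); eval_free A \<phi> f = eval_free A \<phi> g\<rbrakk>
    \<Longrightarrow> eval_free A \<phi> (f - g) = \<zero>"
  by (simp add: minus_eq r_neg)

section \<open>The counit\<close>

lemma scalar_pow [simp]: "(x::'k::field) [^]\<^bsub>scalar_alg\<^esub> (k::nat) = x ^ k"
  by (induction k) (auto simp: nat_pow_def mult.commute)

lemma scalar_finsum [simp]: "finsum scalar_alg (f :: 'x \<Rightarrow> 'k::field) S = sum f S"
proof -
  interpret kalg "scalar_alg :: ('k, 'k) module" by (rule kalg_scalar_alg)
  show ?thesis by (induction S rule: infinite_finite_induct) auto
qed

lemma scalar_a_inv [simp]: "\<ominus>\<^bsub>scalar_alg\<^esub> (x :: 'k::field) = - x"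
proof -
  have "abelian_group (scalar_alg :: ('k, 'k) module)"
    using cring_scalar_alg by (intro ring.is_abelian_group cring.axioms(1))
  from abelian_group.minus_equality [OF this, of "- x" x] show ?thesis by simp
qed

context hopf_Hnm
begin

text \<open>With every generator sent to 1, the relation for the square of \<open>z_k\<close> asks
  that the \<open>fc i j\<close> add up to 1, which is \<open>fourier\<close> with both exponents
  zero.\<close>

sublocale Cu: presentation_lift "Hgens m" "Hrels n m q" scalar_alg "\<lambda>_. 1"
proof -
  interpret kalg "scalar_alg :: ('k, 'k) module" by (rule kalg_scalar_alg)
  interpret E: free_eval scalar_alg "Hgens m" "\<lambda>_. 1 :: 'k" by unfold_locales simp
  show "presentation_lift (Hgens m) (Hrels n m q) scalar_alg (\<lambda>_. 1)"
  proof unfold_locales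
    fix r assume r: "r \<in> Hrels n m q"
    have diff: "eval_free scalar_alg (\<lambda>_. 1) (f - g) = \<zero>\<^bsub>scalar_alg\<^esub>"
      if "f - g \<in> Hrels n m q" "f \<in> H.F" "g \<in> H.F"
        "eval_free scalar_alg (\<lambda>_. 1) f = eval_free scalar_alg (\<lambda>_. 1 :: 'k) g" for f g
      using that by (intro E.eval_diff_eq_zero)
    show "eval_free scalar_alg (\<lambda>_. 1) r = \<zero>\<^bsub>scalar_alg\<^esub>"
      using r transpose_in_range [of _ m] fourier [of 0 0] unfolding Hrels_def
      by (auto simp: E.eval_sum E.eval_const fc_def Suc_le_eq simp del: E.eval_diff scalar_alg_simps
          intro!: E.eval_diff_eq_zero) (auto simp: E.eval_sum E.eval_const fc_def Suc_le_eq)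
  qed
qed

end

section \<open>Monomial operators\<close>

text \<open>The operators for \<open>x_i\<close> and \<open>z_k\<close>, their compositions, and
  averages over powers of \<open>x_i\<close> send each word to a multiple of a word. Identities
  between them reduce to identities of the scalars attached to words.\<close>

definition mop :: "('g word \<Rightarrow> 'g word) \<Rightarrow> ('g word \<Rightarrow> 'k::field) \<Rightarrow> ('g, 'k) free \<Rightarrow> ('g, 'k) free" where
  "mop \<sigma> \<chi> = lin_ext (free_algebra UNIV) (\<lambda>w. single (\<sigma> w) (\<chi> w))"

lemma mop_zero [simp]: "mop \<sigma> \<chi> 0 = 0"
  by (simp add: mop_def)

lemma mop_add: "mop \<sigma> \<chi> (f + g) = mop \<sigma> \<chi> f + mop \<sigma> \<chi> g"
  using free.lin_ext_add [of f g _ UNIV] by (simp add: mop_def)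

lemma mop_diff: "mop \<sigma> \<chi> (f - g) = mop \<sigma> \<chi> f - mop \<sigma> \<chi> g"
  using mop_add [of \<sigma> \<chi> "f - g" g] by (simp add: algebra_simps)

lemma mop_uminus: "mop \<sigma> \<chi> (- f) = - mop \<sigma> \<chi> f"
  using mop_diff [of \<sigma> \<chi> 0 f] by simp

lemma mop_smult: "mop \<sigma> \<chi> (const c * f) = const c * mop \<sigma> \<chi> f"
  using free.lin_ext_scale [of f _ UNIV c] by (simp add: mop_def const_mult_eq_map)

lemma mop_single [simp]: "mop \<sigma> \<chi> (single w c) = single (\<sigma> w) (c * \<chi> w)"
  by (subst mop_def, subst free.lin_ext_single) (simp_all add: const_def mult_single)

lemma free_all_induct [case_names single add]:
  fixes f :: "('g, 'k::field) free"
  assumes "\<And>w c. Q (single w c)" "\<And>f g. Q f \<Longrightarrow> Q g \<Longrightarrow> Q (f + g)"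
  shows "Q f"
  using free_carrier_UNIV [of f] by (induction f rule: free_induct) (auto intro: assms)

lemma mop_mop: "mop \<sigma> \<chi> (mop \<tau> \<psi> f) = mop (\<lambda>w. \<sigma> (\<tau> w)) (\<lambda>w. \<psi> w * \<chi> (\<tau> w)) f"
  by (induction f rule: free_all_induct) (simp_all add: mop_add mult.assoc)

lemma mop_id: "mop (\<lambda>w. w) (\<lambda>_. 1) f = f"
  by (induction f rule: free_all_induct) (simp_all add: mop_add)

lemma mop_sum: "(\<Sum>x\<in>S. mop \<sigma> (\<chi> x) f) = mop \<sigma> (\<lambda>w. \<Sum>x\<in>S. \<chi> x w) f"
proof (induction f rule: free_all_induct)
  case (single w c)
  have "(\<Sum>x\<in>S. single (\<sigma> w) (c * \<chi> x w)) = single (\<sigma> w) (\<Sum>x\<in>S. c * \<chi> x w)"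
    by (induction S rule: infinite_finite_induct) (auto simp: single_add)
  then show ?case by (simp add: sum_distrib_left)
next
  case (add f g)
  then show ?case by (simp add: mop_add sum.distrib)
qed

lemma mop_scale: "const c * mop \<sigma> \<chi> f = mop \<sigma> (\<lambda>w. c * \<chi> w) f"
  by (induction f rule: free_all_induct)
    (simp_all add: mop_add distrib_left const_def mult_single mult.left_commute)

lemma mop_closed:
  assumes "f \<in> carrier (free_algebra G)" "\<And>w. set (letters w) \<subseteq> G \<Longrightarrow> set (letters (\<sigma> w)) \<subseteq> G"
  shows "mop \<sigma> \<chi> f \<in> carrier (free_algebra G)"
  using assms(1) by (induction f rule: free_induct) (auto simp: mop_add assms(2))

section \<open>Operators on a presented algebra\<close>

context presentation
begin

text \<open>Linear operators that preserve the carrier and the ideal, hence descend to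
  \<open>P\<close>. They are linear on the whole type and not only on the carrier, and relations
  between them are proved as equalities of functions.\<close>

definition ops :: "('k, ('g, 'k) free \<Rightarrow> ('g, 'k) free) module" where
  "ops = \<lparr>carrier = {L. (\<forall>f g. L (f + g) = L f + L g) \<and> (\<forall>c f. L (const c * f) = const c * L f) \<and>
       (\<forall>f\<in>F. L f \<in> F) \<and> (\<forall>f\<in>I. L f \<in> I)},
     mult = (\<circ>), one = id, zero = (\<lambda>_. 0), add = (\<lambda>L M f. L f + M f), smult = (\<lambda>c L f. const c * L f)\<rparr>"

lemma ops_simps [simp]:
  "mult ops = (\<circ>)" "one ops = id" "zero ops = (\<lambda>_. 0)" "add ops = (\<lambda>L M f. L f + M f)"
  "smult ops = (\<lambda>c L f. const c * L f)"
  by (simp_all add: ops_def)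

lemma ops_iff: "L \<in> carrier ops \<longleftrightarrow> (\<forall>f g. L (f + g) = L f + L g) \<and>
    (\<forall>c f. L (const c * f) = const c * L f) \<and> (\<forall>f\<in>F. L f \<in> F) \<and> (\<forall>f\<in>I. L f \<in> I)"
  by (simp add: ops_def)

lemma I_add: "f \<in> I \<Longrightarrow> g \<in> I \<Longrightarrow> f + g \<in> I"
  using additive_subgroup.a_closed [OF I.is_additive_subgroup, of f g] by (simp only: free_algebra_simps)

lemma I_smult: "f \<in> I \<Longrightarrow> const c * f \<in> I"
  using I.I_l_closed [of f "const c"] by simp

lemma I_zero: "0 \<in> I"
  using additive_subgroup.zero_closed [OF I.is_additive_subgroup] by (simp only: free_algebra_simps)

lemma ops_diff: "L \<in> carrier ops \<Longrightarrow> L (f - g) = L f - L g"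
  by (metis add_diff_cancel diff_add_cancel ops_iff)

lemma kalg_ops: "kalg ops"
proof -
  have const_const: "const c * (const d * f) = const d * (const c * f)" for c d and f :: "('g, 'k) free"
    by (simp add: mult.commute flip: mult.assoc const_mult)
  have ab: "abelian_group ops"
  proof (rule abelian_groupI)
    fix L assume L: "L \<in> carrier ops"
    show "\<exists>M\<in>carrier ops. M \<oplus>\<^bsub>ops\<^esub> L = \<zero>\<^bsub>ops\<^esub>"
    proof (rule bexI [of _ "\<lambda>f. const (-1) * L f"])
      have "const (-1) = (- 1 :: ('g, 'k) free)" by (simp add: const_def single_uminus)
      then show "(\<lambda>f. const (-1) * L f) \<oplus>\<^bsub>ops\<^esub> L = \<zero>\<^bsub>ops\<^esub>" by (simp add: fun_eq_iff)
      show "(\<lambda>f. const (-1) * L f) \<in> carrier ops"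
        using L by (auto simp: ops_iff distrib_left const_const intro: I_smult)
    qed
  qed (auto simp: ops_iff fun_eq_iff algebra_simps distrib_left intro: I_add I_zero)
  have "ring ops"
  proof (rule ringI)
    show "Group.monoid ops" by (rule monoidI) (auto simp: ops_iff)
  qed (auto simp: ab ops_iff fun_eq_iff)
  moreover have "kspace ops"
    by (rule kspaceI)
      (auto simp: ab ops_iff fun_eq_iff distrib_left distrib_right const_const const_add const_mult
        mult.assoc intro: I_smult)
  ultimately show ?thesis
    unfolding kalg_def kalg_axioms_def by (auto simp: ops_iff fun_eq_iff)
qed

sublocale ops: kalg ops by (rule kalg_ops)

lemma ops_finsum:
  "(\<And>x. x \<in> S \<Longrightarrow> L x \<in> carrier ops) \<Longrightarrow> finsum ops L S f = (\<Sum>x\<in>S. L x f)"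
proof (induction S rule: infinite_finite_induct)
  case (insert x T)
  then have "L \<in> T \<rightarrow> carrier ops" by auto
  with insert show ?case by simp
qed auto

lemma ops_pow: "L [^]\<^bsub>ops\<^esub> (k::nat) = (L ^^ k)"
  by (induction k) (auto simp: nat_pow_def fun_eq_iff funpow_swap1)

definition rep :: "('g, 'k) free set \<Rightarrow> ('g, 'k) free" where
  "rep x = (SOME f. f \<in> F \<and> cls f = x)"

definition induced :: "(('g, 'k) free \<Rightarrow> ('g, 'k) free) \<Rightarrow> ('g, 'k) free set \<Rightarrow> ('g, 'k) free set" where
  "induced L x = cls (L (rep x))"

lemma rep: "f \<in> F \<Longrightarrow> rep (cls f) \<in> F \<and> cls (rep (cls f)) = cls f"
  unfolding rep_def by (rule someI [of _ f]) (rule conjI [OF _ refl])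

text \<open>Two representatives differ by an element of the ideal, which \<open>L\<close> preserves,
  so the choice made by \<open>rep\<close> does not matter.\<close>

lemma induced_cls:
  assumes "L \<in> carrier ops" "f \<in> F" shows "induced L (cls f) = cls (L f)"
proof -
  have r: "rep (cls f) \<in> F" "cls (rep (cls f)) = cls f" using rep [OF assms(2)] by auto
  then have "rep (cls f) - f \<in> I" using cls_eq_iff [OF r(1) assms(2)] by blast
  then have "L (rep (cls f) - f) \<in> I" using assms(1) unfolding ops_iff by blast
  then have "L (rep (cls f)) - L f \<in> I" unfolding ops_diff [OF assms(1)] .
  moreover have "L (rep (cls f)) \<in> F" "L f \<in> F" using r(1) assms unfolding ops_iff by blast+
  ultimately show ?thesis unfolding induced_def by (subst cls_eq_iff)
qed

lemma cls_sum: "(\<And>x. x \<in> S \<Longrightarrow> f x \<in> F) \<Longrightarrow> cls (sum f S) = finsum P (\<lambda>x. cls (f x)) S"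
proof (induction S rule: infinite_finite_induct)
  case (insert x T)
  then have "(\<lambda>x. cls (f x)) \<in> T \<rightarrow> carrier P" by auto
  with insert show ?case by (simp flip: cls_add)
qed (auto simp: cls_zero)

end

section \<open>Inversions\<close>

text \<open>The number of pairs of positions with \<open>a\<close> before \<open>b\<close>; for
  \<open>a = k + 1\<close> and \<open>b = k\<close> it is the exponent in the action of
  \<open>z_k\<close>.\<close>

fun invs :: "'a \<Rightarrow> 'a \<Rightarrow> 'a list \<Rightarrow> nat" where
  "invs a b [] = 0"
| "invs a b (x # l) = (if x = a then count_list l b else 0) + invs a b l"

text \<open>The last term counts the pairs that straddle the cut. It measures how far
  \<open>z_k\<close> is from being multiplicative, and the twisting factor in the comultiplication
  accounts for it.\<close>

lemma invs_append: "invs a b (l @ l') = invs a b l + invs a b l' + count_list l a * count_list l' b"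
  by (induction l) auto

lemma transpose_eq_swap:
  "Transposition.transpose c d x = a \<longleftrightarrow> x = Transposition.transpose c d a"
  by (metis transpose_involutory)

lemma count_list_map_transpose:
  "count_list (map (Transposition.transpose c d) l) a = count_list l (Transposition.transpose c d a)"
  by (induction l) (auto simp: transpose_eq_swap)

lemma invs_map_transpose: "invs a b (map (Transposition.transpose c d) l)
    = invs (Transposition.transpose c d a) (Transposition.transpose c d b) l"
  by (induction l) (auto simp: transpose_eq_swap count_list_map_transpose)

text \<open>Each occurrence of \<open>a\<close> and each of \<open>b\<close> form one pair, in one
  of the two orders. This is why applying \<open>z_k\<close> twice leaves a power of
  \<open>q\<close> that depends on the counts alone.\<close>

lemma invs_add_invs: "a \<noteq> b \<Longrightarrow> invs a b l + invs b a l = count_list l a * count_list l b"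
  by (induction l) auto

section \<open>The action on the quantum polynomial ring\<close>

lemma (in kspace) lin_ext_sum:
  assumes "\<And>x y. x \<in> S \<Longrightarrow> y \<in> keys (f x) \<Longrightarrow> \<psi> y \<in> carrier V"
  shows "lin_ext V \<psi> (sum f S) = (\<Oplus>x\<in>S. lin_ext V \<psi> (f x))"
  using assms
proof (induction S rule: infinite_finite_induct)
  case (insert x T)
  then have "(\<lambda>x. lin_ext V \<psi> (f x)) \<in> T \<rightarrow> carrier V"
    by (auto intro!: lin_ext_closed)
  moreover have "lin_ext V \<psi> (f x) \<in> carrier V" using insert by (intro lin_ext_closed) auto
  moreover have "lin_ext V \<psi> (f x + sum f T) = lin_ext V \<psi> (f x) \<oplus> lin_ext V \<psi> (sum f T)"
    using insert.prems keys_sum [of f T] by (intro lin_ext_add) blast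
  moreover have "lin_ext V \<psi> (sum f T) = (\<Oplus>x\<in>T. lin_ext V \<psi> (f x))"
    by (rule insert.IH) (use insert.prems in blast)
  ultimately show ?case using insert.hyps by simp
qed auto

lemma tensor_mult_sum_left:
  "tensor_mult B C (sum f S) t = (\<Sum>x\<in>S. tensor_mult B C (f x) t)"
  by (induction S rule: infinite_finite_induct) (auto simp: tensor_mult_add_left)

definition swap :: "nat \<Rightarrow> nat word \<Rightarrow> nat word" where
  "swap k w = Word (map (Transposition.transpose k (Suc k)) (letters w))"

abbreviation cnt :: "nat \<Rightarrow> nat word \<Rightarrow> nat" where
  "cnt i w \<equiv> count_list (letters w) i"

lemma swap_plus [simp]: "swap k (v + w) = swap k v + swap k w"
  by (simp add: swap_def plus_word_def)

lemma swap_swap [simp]: "swap k (swap k w) = w"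
  by (simp add: swap_def comp_def)

lemma cnt_swap [simp]: "cnt i (swap k w) = cnt (Transposition.transpose k (Suc k) i) w"
  by (simp add: swap_def count_list_map_transpose)

lemma invs_swap [simp]: "invs a b (letters (swap k w))
    = invs (Transposition.transpose k (Suc k) a) (Transposition.transpose k (Suc k) b) (letters w)"
  by (simp add: swap_def invs_map_transpose)

lemma letters_swap:
  "k \<in> {1..<m} \<Longrightarrow> set (letters w) \<subseteq> {1..m} \<Longrightarrow> set (letters (swap k w)) \<subseteq> {1..m}"
  using transpose_in_range [of k m] by (auto simp: swap_def)

locale quantum = hopf_Hnm n q m for n :: nat and q :: "'k::field_char_0" and m :: nat +
  fixes p :: 'k
  assumes p_square: "p ^ 2 = q"
begin

declare One_nat_def [simp del] \<comment> \<open>keeps the index set \<open>{1..m}\<close>, a parameter of the locale \<open>A\<close>, in this form\<close>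

sublocale A: presentation "{1..m}" "quantum_rels m p"
  by unfold_locales (auto simp: quantum_rels_def)

lemma p_nonzero: "p \<noteq> 0"
  using p_square q_nonzero by auto

lemma quantum_poly_eq: "quantum_poly m p = A.P" and qvar_eq: "qvar m p i = A.cls (gen i)"
  unfolding quantum_poly_def qvar_def A.presented_gen_eq by (rule refl)+

lemma swap_in_ideal:
  assumes "set (letters v) \<subseteq> {1..m}" "set (letters w) \<subseteq> {1..m}" "i \<in> {1..m}" "j \<in> {1..m}" "i < j"
  shows "single (v + (Word [j, i] + w)) d - single (v + (Word [i, j] + w)) (d * p)
    \<in> A.I"
proof -
  have "gen j * gen i - const p * gen i * gen j \<in> quantum_rels m p"
    using assms unfolding quantum_rels_def by blast
  then have "gen j * gen i - const p * gen i * gen j \<in> A.I" by (rule A.rels_in_ideal)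
  then have "(gen j * gen i - const p * gen i * gen j) * single w 1 \<in> A.I"
    using A.I.I_r_closed [of "gen j * gen i - const p * gen i * gen j" "single w 1"] assms by simp
  then have "single v d * ((gen j * gen i - const p * gen i * gen j) * single w 1) \<in> A.I"
    using A.I.I_l_closed [of _ "single v d"] assms by simp
  moreover have "single v d * ((gen j * gen i - const p * gen i * gen j) * single w 1)
     = single (v + (Word [j, i] + w)) d - single (v + (Word [i, j] + w)) (d * p)"
    by (simp add: gen_def const_def mult_single algebra_simps plus_word_def)
  ultimately show ?thesis by simp
qed

lemma ideal_induct_swap [consumes 1, case_names zero add uminus swap]:
  assumes "f \<in> A.I" and "Q 0"
    and "\<And>f g. f \<in> A.F \<Longrightarrow> g \<in> A.F \<Longrightarrow> Q f \<Longrightarrow> Q g \<Longrightarrow> Q (f + g)"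
    and "\<And>f. f \<in> A.F \<Longrightarrow> Q f \<Longrightarrow> Q (- f)"
    and swap: "\<And>v w i j d. \<lbrakk>set (letters v) \<subseteq> {1..m}; set (letters w) \<subseteq> {1..m}; i \<in> {1..m}; j \<in> {1..m}; i < j\<rbrakk> \<Longrightarrow>
      Q (single (v + (Word [j, i] + w)) d - single (v + (Word [i, j] + w)) (d * p))"
  shows "Q f"
  using assms(1)
proof (induction f rule: A.ideal_induct)
  case (rel v w c r)
  then obtain i j where ij: "i \<in> {1..m}" "j \<in> {1..m}" "i < j" "r = gen j * gen i - const p * gen i * gen j"
    by (auto simp: quantum_rels_def)
  have "single v c * r * single w 1
     = single (v + (Word [j, i] + w)) c - single (v + (Word [i, j] + w)) (c * p)"
    by (simp add: ij gen_def const_def mult_single algebra_simps plus_word_def)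
  with swap [OF rel(1,2) ij(1-3), of c] show ?case by simp
qed (fact assms)+

definition opx :: "nat \<Rightarrow> (nat, 'k) free \<Rightarrow> (nat, 'k) free" where
  "opx i = mop (\<lambda>w. w) (\<lambda>w. q ^ cnt i w)"

definition opz :: "nat \<Rightarrow> (nat, 'k) free \<Rightarrow> (nat, 'k) free" where
  "opz k = mop (swap k) (\<lambda>w. q ^ invs (Suc k) k (letters w))"

lemma mop_in_ops:
  assumes "\<And>w. set (letters w) \<subseteq> {1..m} \<Longrightarrow> set (letters (\<sigma> w)) \<subseteq> {1..m}"
    and "\<And>v w i j d. \<lbrakk>set (letters v) \<subseteq> {1..m}; set (letters w) \<subseteq> {1..m}; i \<in> {1..m}; j \<in> {1..m}; i < j\<rbrakk> \<Longrightarrow>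
      mop \<sigma> \<chi> (single (v + (Word [j, i] + w)) d
        - single (v + (Word [i, j] + w)) (d * p)) \<in> A.I"
  shows "mop \<sigma> \<chi> \<in> carrier A.ops"
proof -
  have "mop \<sigma> \<chi> f \<in> A.I" if "f \<in> A.I" for f
    using that
  proof (induction f rule: ideal_induct_swap)
    case (uminus f)
    have "- mop \<sigma> \<chi> f = const (-1) * mop \<sigma> \<chi> f" by (simp add: const_def single_uminus)
    with uminus A.I_smult [of "mop \<sigma> \<chi> f" "-1"] show ?case by (simp add: mop_uminus)
  next
    case swap
    then show ?case by (rule assms(2))
  qed (auto simp: mop_add intro: A.I_add A.I_zero)
  then show ?thesis
    by (auto simp: A.ops_iff mop_add mop_smult intro: mop_closed [OF _ assms(1)])
qed

text \<open>Exchanging neighbours does not change how often a letter occurs, so both words of a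
  relation are multiplied by the same scalar.\<close>

lemma opx_closed: "opx i \<in> carrier A.ops"
  unfolding opx_def
proof (rule mop_in_ops)
  fix v w i' j d
  assume "set (letters v) \<subseteq> {1..m}" "set (letters w) \<subseteq> {1..m}" "i' \<in> {1..m}" "j \<in> {1..m}" "i' < j"
  from swap_in_ideal [OF this, of "d * q ^ cnt i (v + (Word [j, i'] + w))"]
  show "mop (\<lambda>w. w) (\<lambda>w. q ^ cnt i w) (single (v + (Word [j, i'] + w)) d
     - single (v + (Word [i', j] + w)) (d * p)) \<in> A.I"
    by (simp add: mop_diff mult_ac split: if_splits)
qed

lemma swap_Word [simp]: "swap k (Word l) = Word (map (Transposition.transpose k (Suc k)) l)"
  by (simp add: swap_def)

lemma opz_closed:
  assumes k: "k \<in> {1..<m}" shows "opz k \<in> carrier A.ops"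
  unfolding opz_def
proof (rule mop_in_ops)
  fix v w i j d
  assume vw: "set (letters v) \<subseteq> {1..m}" "set (letters w) \<subseteq> {1..m}" and ij: "i \<in> {1..m}" "j \<in> {1..m}" "i < j"
  let ?t = "Transposition.transpose k (Suc k)"
  let ?N = "\<lambda>i j. invs (Suc k) k (letters (v + (Word [j, i] + w)))"
  let ?L = "mop (swap k) (\<lambda>w. q ^ invs (Suc k) k (letters w)) (single (v + (Word [j, i] + w)) d
     - single (v + (Word [i, j] + w)) (d * p))"
  have L: "?L = single (swap k v + (Word [?t j, ?t i] + swap k w)) (d * q ^ ?N i j)
      - single (swap k v + (Word [?t i, ?t j] + swap k w)) (d * p * q ^ ?N j i)"
    by (simp add: mop_diff)
  note sw = letters_swap [OF k vw(1)] letters_swap [OF k vw(2)]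
  note t = transpose_in_range [OF k ij(1)] transpose_in_range [OF k ij(2)]
  show "?L \<in> A.I"
  proof (cases "i = k \<and> j = Suc k")
    \<comment> \<open>The one pair whose order \<open>z_k\<close> reverses. The word with
      \<open>k + 1\<close> in front has one inversion more, hence an extra factor \<open>q\<close>;
      the relation read backwards supplies a \<open>p\<close> in addition to the \<open>p\<close>
      already present, and \<open>p ^ 2 = q\<close> makes them agree.\<close>
    case True
    then have N: "?N i j = Suc (?N j i)" by (simp add: invs_append)
    have "const (-1) * (single (swap k v + (Word [?t i, ?t j] + swap k w)) (d * p * q ^ ?N j i)
      - single (swap k v + (Word [?t j, ?t i] + swap k w)) (d * p * q ^ ?N j i * p)) \<in> A.I"
      by (rule A.I_smult, rule swap_in_ideal [OF sw t(2,1)]) (simp add: True)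
    moreover have e: "d * p * q ^ ?N j i * p = d * q ^ ?N i j"
      unfolding N by (simp flip: p_square add: power2_eq_square mult_ac)
    moreover have neg: "const (-1) * (f - g) = g - f" for f g :: "(nat, 'k) free"
      by (simp add: const_def single_uminus)
    ultimately show ?thesis unfolding L by (simp only: e neg)
  next
    case False
    \<comment> \<open>Any other pair keeps its order under the transposition and is itself no
      inversion in either arrangement, so the image is again a multiple of a relation.\<close>
    then have N: "?N i j = ?N j i" using ij(3) by (auto simp: invs_append)
    have "?t i < ?t j" using False ij(3) by (auto simp: Transposition.transpose_def)
    from swap_in_ideal [OF sw t this, of "d * q ^ ?N i j"]
    show ?thesis unfolding L by (simp only: N mult_ac)
  qed
qed (use k letters_swap in blast)

lemma opx_single [simp]: "opx i (single w c) = single w (c * q ^ cnt i w)"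
  by (simp add: opx_def)

lemma opz_single [simp]:
  "opz k (single w c) = single (swap k w) (c * q ^ invs (Suc k) k (letters w))"
  by (simp add: opz_def)

lemma opx_pow: "(opx i ^^ a) = mop (\<lambda>w. w) (\<lambda>w. (q ^ cnt i w) ^ a)"
proof (induction a)
  case 0 then show ?case by (simp add: fun_eq_iff mop_id)
next
  case (Suc a)
  then show ?case by (simp add: fun_eq_iff opx_def mop_mop mult_ac)
qed

definition opgen :: "hgen \<Rightarrow> (nat, 'k) free \<Rightarrow> (nat, 'k) free" where
  "opgen g = (case g of X i \<Rightarrow> opx i | Z k \<Rightarrow> opz k)"

lemma opgen_simps [simp]: "opgen (X i) = opx i" "opgen (Z k) = opz k"
  by (simp_all add: opgen_def)

lemma opgen_closed: "g \<in> Hgens m \<Longrightarrow> opgen g \<in> carrier A.ops"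
  by (cases g) (auto intro: opx_closed opz_closed)

text \<open>After one swap the inversions are the pairs of the original word with \<open>k\<close>
  before \<open>k + 1\<close>, so the two exponents together count all pairs.\<close>

lemma opz_square: "opz k (opz k f) = mop (\<lambda>w. w) (\<lambda>w. q ^ (cnt k w * cnt (Suc k) w)) f"
proof (induction f rule: free_all_induct)
  case (single w c)
  have "invs (Suc k) k (letters w) + invs (Suc k) k (letters (swap k w)) = cnt k w * cnt (Suc k) w"
    using invs_add_invs [of "Suc k" k "letters w"] by (simp add: mult.commute)
  then show ?case by (simp add: mult.assoc flip: power_add)
next
  case (add f g) then show ?case by (simp add: opz_def mop_add)
qed

lemma opz_opx: "opz k (opx i f) = opx (Transposition.transpose k (Suc k) i) (opz k f)"
  by (induction f rule: free_all_induct) (simp_all add: opz_def opx_def mop_add mult_ac)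

lemma opx_opx: "opx i (opx j f) = opx j (opx i f)"
  by (induction f rule: free_all_induct) (simp_all add: opx_def mop_add mult_ac)

lemma opz_opz:
  assumes "\<bar>int k - int l\<bar> > 1" shows "opz k (opz l f) = opz l (opz k f)"
proof (induction f rule: free_all_induct)
  case (single w c)
  have t: "Transposition.transpose k (Suc k) (Transposition.transpose l (Suc l) a)
      = Transposition.transpose l (Suc l) (Transposition.transpose k (Suc k) a)" for a
    using assms by (auto simp: Transposition.transpose_def)
  have "Transposition.transpose l (Suc l) k = k" "Transposition.transpose l (Suc l) (Suc k) = Suc k"
      "Transposition.transpose k (Suc k) l = l" "Transposition.transpose k (Suc k) (Suc l) = Suc l"
    using assms by (auto simp: Transposition.transpose_def)
  moreover have "swap k (swap l w) = swap l (swap k w)" by (simp add: swap_def comp_def t)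
  ultimately show ?case by (simp add: mult_ac)
next
  case (add f g) then show ?case by (simp add: opz_def mop_add)
qed

text \<open>In either order the three exponents count, in the original word, the pairs
  \<open>k + 1\<close> before \<open>k\<close>, \<open>k + 2\<close> before \<open>k\<close> and
  \<open>k + 2\<close> before \<open>k + 1\<close>, each once.\<close>

lemma opz_braid: "opz k (opz (Suc k) (opz k f)) = opz (Suc k) (opz k (opz (Suc k) f))"
proof (induction f rule: free_all_induct)
  case (single w c)
  let ?s = "Transposition.transpose k (Suc k)" and ?t = "Transposition.transpose (Suc k) (Suc (Suc k))"
  have t: "?s (?t (?s a)) = ?t (?s (?t a))" for a
    by (auto simp: Transposition.transpose_def)
  have "?s k = Suc k" "?s (Suc k) = k" "?s (Suc (Suc k)) = Suc (Suc k)"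
    "?t k = k" "?t (Suc k) = Suc (Suc k)" "?t (Suc (Suc k)) = Suc k"
    by (auto simp: Transposition.transpose_def)
  moreover have "swap k (swap (Suc k) (swap k w)) = swap (Suc k) (swap k (swap (Suc k) w))"
    by (simp add: swap_def comp_def t)
  ultimately show ?case by (simp add: mult_ac)
next
  case (add f g) then show ?case by (simp add: opz_def mop_add)
qed

text \<open>The relations hold as equalities of operators on the free algebra, before any quotient
  is taken; this gives a homomorphism from \<open>H\<close> into operators that descend to
  \<open>A\<close>.\<close>

sublocale Ac: presentation_lift "Hgens m" "Hrels n m q" A.ops opgen
proof unfold_locales
  show "opgen g \<in> carrier A.ops" if "g \<in> Hgens m" for g using that by (rule opgen_closed)
  interpret E: free_eval A.ops "Hgens m" opgen by unfold_locales (rule opgen_closed)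
  let ?E = "eval_free A.ops opgen"
  fix r assume r: "r \<in> Hrels n m q"
  have diff: "?E r = \<zero>\<^bsub>A.ops\<^esub>" if "r = f - g" "f \<in> H.F" "g \<in> H.F" "?E f = ?E g" for f g
    unfolding that(1) using that(2-4) by (rule E.eval_diff_eq_zero)
  from r show "?E r = \<zero>\<^bsub>A.ops\<^esub>"
  proof (cases r rule: Hrels_cases)
    case (1 i)
    have "(q ^ a) ^ n = 1" for a
      by (metis power_commutes power_mult mult.commute power_one q_power_n)
    then have "?E (gen (X i) ^ n) = ?E 1"
      using 1 by (simp add: A.ops_pow opx_pow fun_eq_iff mop_id)
    with 1 show ?thesis by (intro diff [OF 1(2)]) auto
  next
    case (2 i j)
    show ?thesis by (rule diff [OF 2(3)]) (use 2 in \<open>auto simp: fun_eq_iff opx_opx\<close>)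
  next
    case (3 k i)
    show ?thesis
      by (rule diff [OF 3(3)]) (use 3 transpose_in_range [OF 3(1,2)] in \<open>auto simp: fun_eq_iff opz_opx\<close>)
  next
    case (4 k l)
    show ?thesis by (rule diff [OF 4(4)]) (use 4 opz_opz in \<open>auto simp: fun_eq_iff\<close>)
  next
    case (5 k)
    show ?thesis by (rule diff [OF 5(3)]) (use 5 in \<open>auto simp: fun_eq_iff opz_braid\<close>)
  next
    case (6 k)
    then have k: "k \<in> {1..m}" "Suc k \<in> {1..m}" by auto
    have E_mult: "?E (const (fc i j) * gen (X k) ^ i * gen (X (Suc k)) ^ j)
        = (\<lambda>f. const (fc i j) * (opx k ^^ i) ((opx (Suc k) ^^ j) f))" for i j
      using k by (simp add: A.ops_pow E.eval_const fun_eq_iff del: atLeastAtMost_iff)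
    have E_sum1: "?E (sum t S) f = (\<Sum>x\<in>S. ?E (t x) f)"
      if t: "\<And>x. x \<in> S \<Longrightarrow> t x \<in> H.F" for t f and S :: "nat set"
    proof -
      have "?E (sum t S) = finsum A.ops (\<lambda>x. ?E (t x)) S" using t by (rule E.eval_sum)
      then have "?E (sum t S) f = finsum A.ops (\<lambda>x. ?E (t x)) S f" by (rule fun_cong)
      also have "\<dots> = (\<Sum>x\<in>S. ?E (t x) f)" by (rule A.ops_finsum) (rule E.eval_closed, erule t)
      finally show ?thesis .
    qed
    have F: "const (fc i j) * gen (X k) ^ i * gen (X (Suc k)) ^ j \<in> H.F" for i j
      using k by auto
    have E_sum: "?E (\<Sum>i<n. \<Sum>j<n. const (fc i j) * gen (X k) ^ i * gen (X (Suc k)) ^ j)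
      = (\<lambda>f. \<Sum>i<n. \<Sum>j<n. const (fc i j) * (opx k ^^ i) ((opx (Suc k) ^^ j) f))"
    proof
      fix f
      have "?E (\<Sum>i<n. \<Sum>j<n. const (fc i j) * gen (X k) ^ i * gen (X (Suc k)) ^ j) f
        = (\<Sum>i<n. ?E (\<Sum>j<n. const (fc i j) * gen (X k) ^ i * gen (X (Suc k)) ^ j) f)"
        by (intro E_sum1 free_carrier_sum F)
      also have "\<dots> = (\<Sum>i<n. \<Sum>j<n. ?E (const (fc i j) * gen (X k) ^ i * gen (X (Suc k)) ^ j) f)"
        by (intro sum.cong refl E_sum1 F)
      finally show "?E (\<Sum>i<n. \<Sum>j<n. const (fc i j) * gen (X k) ^ i * gen (X (Suc k)) ^ j) f
        = (\<Sum>i<n. \<Sum>j<n. const (fc i j) * (opx k ^^ i) ((opx (Suc k) ^^ j) f))"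
        by (simp only: E_mult)
    qed
    \<comment> \<open>Powers of the \<open>opx\<close> are diagonal on words, so
      \<open>fourier\<close> evaluates the sum to the scalar found in
      \<open>opz_square\<close>.\<close>
    have "(\<Sum>i<n. \<Sum>j<n. const (fc i j) * (opx k ^^ i) ((opx (Suc k) ^^ j) f)) = opz k (opz k f)" for f
      by (simp add: opx_pow mop_mop mop_scale mop_sum opz_square flip: fourier)
        (simp add: mult_ac)
    then have "?E (gen (Z k) ^ 2) = ?E (\<Sum>i<n. \<Sum>j<n. const (fc i j) * gen (X k) ^ i * gen (X (Suc k)) ^ j)"
      using 6 unfolding E_sum by (simp add: A.ops_pow numeral_2_eq_2 fun_eq_iff)
    with 6 k show ?thesis by (intro diff [OF 6(2)]) auto
  qed
qed

end

section \<open>The induced action and the module algebra law\<close>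

context quantum
begin

definition act :: "(hgen, 'k) free set \<Rightarrow> (nat, 'k) free set \<Rightarrow> (nat, 'k) free set" where
  "act x = A.induced (Ac.lift x)"

lemma act_cls: "x \<in> carrier H.P \<Longrightarrow> f \<in> A.F \<Longrightarrow> act x (A.cls f) = A.cls (Ac.lift x f)"
  unfolding act_def by (rule A.induced_cls [OF Ac.lift_closed])

lemma lift_F: "x \<in> carrier H.P \<Longrightarrow> f \<in> A.F \<Longrightarrow> Ac.lift x f \<in> A.F"
  using Ac.lift_closed [of x] unfolding A.ops_iff by blast

lemma act_closed: "x \<in> carrier H.P \<Longrightarrow> a \<in> carrier A.P \<Longrightarrow> act x a \<in> carrier A.P"
  by (auto simp: A.carrier_presented act_cls lift_F)

lemma act_add_right: "\<lbrakk>x \<in> carrier H.P; a \<in> carrier A.P; b \<in> carrier A.P\<rbrakk> \<Longrightarrow>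
    act x (a \<oplus>\<^bsub>A.P\<^esub> b) = act x a \<oplus>\<^bsub>A.P\<^esub> act x b"
  using Ac.lift_closed [of x] by (auto simp: A.carrier_presented act_cls lift_F A.ops_iff)

lemma act_smult_right: "\<lbrakk>x \<in> carrier H.P; a \<in> carrier A.P\<rbrakk> \<Longrightarrow>
    act x (c \<odot>\<^bsub>A.P\<^esub> a) = c \<odot>\<^bsub>A.P\<^esub> act x a"
  using Ac.lift_closed [of x] by (auto simp: A.carrier_presented act_cls lift_F A.ops_iff)

lemma act_add_left: "\<lbrakk>x \<in> carrier H.P; y \<in> carrier H.P; a \<in> carrier A.P\<rbrakk> \<Longrightarrow>
    act (x \<oplus>\<^bsub>H.P\<^esub> y) a = act x a \<oplus>\<^bsub>A.P\<^esub> act y a"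
  unfolding A.carrier_presented using H.add.m_closed
  by (auto simp: act_cls lift_F)

lemma act_smult_left: "\<lbrakk>x \<in> carrier H.P; a \<in> carrier A.P\<rbrakk> \<Longrightarrow>
    act (c \<odot>\<^bsub>H.P\<^esub> x) a = c \<odot>\<^bsub>A.P\<^esub> act x a"
  unfolding A.carrier_presented by (auto simp: act_cls lift_F)

lemma act_mult: "\<lbrakk>x \<in> carrier H.P; y \<in> carrier H.P; a \<in> carrier A.P\<rbrakk> \<Longrightarrow>
    act (x \<otimes>\<^bsub>H.P\<^esub> y) a = act x (act y a)"
  unfolding A.carrier_presented by (auto simp: act_cls lift_F)

lemma act_one: "a \<in> carrier A.P \<Longrightarrow> act \<one>\<^bsub>H.P\<^esub> a = a"
  unfolding A.carrier_presented by (auto simp: act_cls)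

lemma act_gen: "g \<in> Hgens m \<Longrightarrow> f \<in> A.F \<Longrightarrow> act (H.cls (gen g)) (A.cls f) = A.cls (opgen g f)"
  by (simp add: act_cls)

text \<open>The right-hand side of the module algebra law as a function of a representative of an
  element of \<open>H \<otimes> H\<close>.\<close>

definition mu where
  "mu a b = lin_ext A.P (\<lambda>gk. act (fst gk) a \<otimes>\<^bsub>A.P\<^esub> act (snd gk) b)"

lemma mu_single:
  "\<lbrakk>a \<in> carrier A.P; b \<in> carrier A.P; g \<in> carrier H.P; k \<in> carrier H.P\<rbrakk> \<Longrightarrow>
    mu a b (single (g, k) c) = c \<odot>\<^bsub>A.P\<^esub> (act g a \<otimes>\<^bsub>A.P\<^esub> act k b)"
  unfolding mu_def by (subst A.lin_ext_single) (auto intro: act_closed)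

lemma mu_term:
  assumes "a \<in> carrier A.P" "b \<in> carrier A.P" "t \<in> HH.T" "gk \<in> keys t"
  shows "act (fst gk) a \<otimes>\<^bsub>A.P\<^esub> act (snd gk) b \<in> carrier A.P"
proof -
  have "fst gk \<in> carrier H.P" "snd gk \<in> carrier H.P"
    using assms(3,4) by (auto simp: pretensor_carrier)
  then show ?thesis using assms(1,2) by (intro A.m_closed act_closed)
qed

lemma mu_closed: "\<lbrakk>a \<in> carrier A.P; b \<in> carrier A.P; t \<in> HH.T\<rbrakk> \<Longrightarrow> mu a b t \<in> carrier A.P"
  unfolding mu_def by (rule A.lin_ext_closed) (rule mu_term)

lemma mu_add: "\<lbrakk>a \<in> carrier A.P; b \<in> carrier A.P; s \<in> HH.T; t \<in> HH.T\<rbrakk> \<Longrightarrow>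
    mu a b (s + t) = mu a b s \<oplus>\<^bsub>A.P\<^esub> mu a b t"
  unfolding mu_def by (rule A.lin_ext_add) (erule UnE; rule mu_term)

lemma mu_diff: "\<lbrakk>a \<in> carrier A.P; b \<in> carrier A.P; s \<in> HH.T; t \<in> HH.T\<rbrakk> \<Longrightarrow>
    mu a b (s - t) = mu a b s \<ominus>\<^bsub>A.P\<^esub> mu a b t"
  unfolding mu_def by (rule A.lin_ext_diff) (erule UnE; rule mu_term)

lemma mu_scale: "\<lbrakk>a \<in> carrier A.P; b \<in> carrier A.P; t \<in> HH.T\<rbrakk> \<Longrightarrow>
    mu a b (Poly_Mapping.map ((*) c) t) = c \<odot>\<^bsub>A.P\<^esub> mu a b t"
  unfolding mu_def by (rule A.lin_ext_scale) (rule mu_term)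

lemma mu_null:
  assumes "a \<in> carrier A.P" "b \<in> carrier A.P" "t \<in> HH.N"
  shows "mu a b t = \<zero>\<^bsub>A.P\<^esub>"
  unfolding mu_def
  by (rule HH.lin_ext_tensor_null [OF A.kspace_axioms _ _ _ _ _ assms(3)])
    (simp_all add: assms(1,2) act_closed act_add_left act_smult_left A.l_distr A.r_distr
      A.smult_mult_left A.smult_mult_right)

text \<open>The module algebra law quantifies over all representatives of the comultiplication; this
  reduces it to exhibiting one for which it holds.\<close>

lemma mu_eq:
  assumes "a \<in> carrier A.P" "b \<in> carrier A.P" "x \<in> carrier HH.BC" "s \<in> x" "t \<in> x"
  shows "mu a b s = mu a b t"
proof -
  have st: "s \<in> HH.T" "t \<in> HH.T" "HH.tc s = HH.tc t"
    using HH.in_carrier_tensor [OF assms(3,4)] HH.in_carrier_tensor [OF assms(3,5)] by simp_all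
  then have "mu a b s \<ominus>\<^bsub>A.P\<^esub> mu a b t = \<zero>\<^bsub>A.P\<^esub>"
    using mu_null [OF assms(1,2), of "s - t"] assms(1,2)
    by (simp add: tensor_class_eq_iff mu_diff)
  then show ?thesis
    using A.r_right_minus_eq mu_closed [OF assms(1,2)] st(1,2) by blast
qed

text \<open>The product step of the module algebra law: if \<open>s\<close> computes how
  \<open>x\<close> acts on products, then letting \<open>x\<close> act on the expression for
  \<open>t\<close> amounts to multiplying the two tensors.\<close>

lemma mu_tensor_mult:
  assumes x: "x \<in> carrier H.P" and s: "s \<in> HH.T" and t: "t \<in> HH.T"
    and "a \<in> carrier A.P" "b \<in> carrier A.P"
    and eq: "\<And>a b. a \<in> carrier A.P \<Longrightarrow> b \<in> carrier A.P \<Longrightarrow> act x (a \<otimes>\<^bsub>A.P\<^esub> b) = mu a b s"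
  shows "act x (mu a b t) = mu a b (HH.tm s t)"
  using t
proof (induction t rule: HH.T_induct)
  case (single g k c)
  have "act x (mu a b (single (g, k) c)) = c \<odot>\<^bsub>A.P\<^esub> mu (act g a) (act k b) s"
    using single assms by (simp add: mu_single act_smult_right act_closed eq)
  also have "\<dots> = mu a b (HH.tm s (single (g, k) c))"
    using s
  proof (induction s rule: HH.T_induct)
    case (single g' k' c')
    then show ?case using \<open>g \<in> _\<close> \<open>k \<in> _\<close> assms
      by (simp add: mu_single act_closed act_mult A.smult_smult mult.commute)
  next
    case (add s s')
    then show ?case using single assms
      by (simp add: tensor_mult_add_left mu_add act_closed A.smult_add mu_closed)
  qed
  finally show ?case .
next
  case (add t t')
  then show ?case using assms
    by (simp add: tensor_mult_add_right mu_add act_add_right mu_closed)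
qed

lemma opx_mult: "opx i (f * g) = opx i f * opx i g"
proof (induction f rule: free_all_induct)
  case (single v c)
  show ?case
  proof (induction g rule: free_all_induct)
    case (single w d) then show ?case by (simp add: mult_single power_add mult_ac)
  next
    case (add g h) then show ?case by (simp add: opx_def mop_add distrib_left)
  qed
next
  case (add f h) then show ?case by (simp add: opx_def mop_add distrib_right)
qed

text \<open>The module algebra law for \<open>z_k\<close>, already on the free algebra. After the
  swap, words \<open>v\<close> and \<open>w\<close> have weight \<open>cnt (k+1) v\<close> for
  \<open>x_k\<close> and \<open>cnt k w\<close> for \<open>x_(k+1)\<close>, so the Fourier sum
  produces the straddling term of \<open>invs_append\<close>.\<close>

lemma opz_mult:
  "opz k (f * g) = (\<Sum>i<n. \<Sum>j<n. const (fc i j) * ((opx k ^^ i) (opz k f) * (opx (Suc k) ^^ j) (opz k g)))"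
proof (induction f rule: free_all_induct)
  case (single v c)
  show ?case
  proof (induction g rule: free_all_induct)
    case (single w d)
    let ?r = "c * d * q ^ invs (Suc k) k (letters v) * q ^ invs (Suc k) k (letters w)"
    have sum_single: "sum (\<lambda>x. single u (h x)) S = single u (sum h S)"
      for u :: "nat word" and h :: "nat \<Rightarrow> 'k" and S
      by (induction S rule: infinite_finite_induct) (auto simp: single_add)
    have "(\<Sum>i<n. \<Sum>j<n. fc i j * (?r * ((q ^ cnt (Suc k) v) ^ i * (q ^ cnt k w) ^ j)))
        = ?r * (\<Sum>i<n. \<Sum>j<n. fc i j * (q ^ cnt (Suc k) v) ^ i * (q ^ cnt k w) ^ j)"
      by (simp add: sum_distrib_left mult_ac)
    also have "\<dots> = ?r * q ^ (cnt (Suc k) v * cnt k w)" by (simp add: fourier)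
    finally show ?case
      by (simp add: opx_pow mult_single const_def sum_single invs_append power_add mult_ac)
  next
    case (add g h)
    then show ?case by (simp add: opz_def opx_pow mop_add distrib_left sum.distrib)
  qed
next
  case (add f h)
  then show ?case by (simp add: opz_def opx_pow mop_add distrib_left distrib_right sum.distrib)
qed

lemma act_cls_gen_power:
  "i \<in> {1..m} \<Longrightarrow> f \<in> A.F \<Longrightarrow> act (H.cls (gen (X i)) [^]\<^bsub>H.P\<^esub> (a::nat)) (A.cls f) = A.cls ((opx i ^^ a) f)"
  and opx_pow_F: "f \<in> A.F \<Longrightarrow> (opx i ^^ a) f \<in> A.F"
proof -
  show F: "(opx i ^^ a) f \<in> A.F" if "f \<in> A.F" for f a
    using opx_closed [of i] that unfolding A.ops_iff by (induction a) auto
  assume i: "i \<in> {1..m}" and "f \<in> A.F"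
  from this(2) show "act (H.cls (gen (X i)) [^]\<^bsub>H.P\<^esub> a) (A.cls f) = A.cls ((opx i ^^ a) f)"
  proof (induction a arbitrary: f)
    case 0
    then show ?case by (simp add: act_one)
  next
    case (Suc a)
    have x: "H.cls (gen (X i)) \<in> carrier H.P" using i by simp
    have "act (H.cls (gen (X i)) [^]\<^bsub>H.P\<^esub> Suc a) (A.cls f)
        = act (H.cls (gen (X i)) [^]\<^bsub>H.P\<^esub> a) (act (H.cls (gen (X i))) (A.cls f))"
      using x Suc.prems unfolding H.nat_pow_Suc by (intro act_mult H.nat_pow_closed) simp_all
    also have "\<dots> = A.cls ((opx i ^^ a) (opx i f))"
    proof -
      have "X i \<in> Hgens m" using i by simp
      then have "act (H.cls (gen (X i))) (A.cls f) = A.cls (opx i f)"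
        using act_gen [OF _ Suc.prems] by (simp only: opgen_simps)
      moreover have "opx i f \<in> A.F" using opx_closed [of i] Suc.prems unfolding A.ops_iff by blast
      ultimately show ?thesis using Suc.IH [of "opx i f"] by (simp only:)
    qed
    finally show ?case by (simp add: funpow_swap1)
  qed
qed

text \<open>\<open>Hcomult_gen\<close> gives a product of cosets; multiplying their evident
  representatives yields one on which \<open>mu\<close> can be evaluated term by term.\<close>

lemma comult_Z:
  assumes "k \<in> {1..<m}"
  shows "(\<Sum>i<n. \<Sum>j<n. single
      (H.cls (gen (X k)) [^]\<^bsub>H.P\<^esub> i \<otimes>\<^bsub>H.P\<^esub> H.cls (gen (Z k)),
       H.cls (gen (X (Suc k))) [^]\<^bsub>H.P\<^esub> j \<otimes>\<^bsub>H.P\<^esub> H.cls (gen (Z k))) (fc i j))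
    \<in> Hcomult_gen n m q (Z k)" (is "?t \<in> _")
proof -
  have k: "k \<in> {1..m}" "Suc k \<in> {1..m}" "Z k \<in> Hgens m" using assms by auto
  let ?s = "\<Sum>i<n. \<Sum>j<n. single
     (H.cls (gen (X k)) [^]\<^bsub>H.P\<^esub> i, H.cls (gen (X (Suc k))) [^]\<^bsub>H.P\<^esub> j) (fc i j)"
  let ?z = "single (H.cls (gen (Z k)), H.cls (gen (Z k))) 1"
  have T_sum: "sum f S \<in> HH.T" if "\<And>x. x \<in> S \<Longrightarrow> f x \<in> HH.T" for f and S :: "nat set"
    using that by (induction S rule: infinite_finite_induct) auto
  have x: "H.cls (gen (X k)) \<in> carrier H.P" "H.cls (gen (X (Suc k))) \<in> carrier H.P"
    using k by auto
  have "?s \<in> HH.T" by (intro T_sum HH.T_single H.nat_pow_closed x)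
  moreover have "?z \<in> HH.T" using k by simp
  moreover have "HH.tm ?s ?z = ?t"
    by (simp only: tensor_mult_sum_left tensor_mult_single mult_1_right)
  moreover have "Hcomult_gen n m q (Z k) = HH.tc ?s \<otimes>\<^bsub>HH.BC\<^esub> HH.tc ?z"
    by (simp add: Halg_eq Hgen_eq fc_def del: H.cls_power flip: Suc_eq_plus1)
  ultimately have "Hcomult_gen n m q (Z k) = HH.tc ?t" by (simp only: HH.tc_mult)
  then show ?thesis by (simp only: HH.tc_self)
qed

lemma comult_act_gen:
  assumes "g \<in> Hgens m"
  shows "\<exists>t\<in>Hcomult_gen n m q g. \<forall>a\<in>carrier A.P. \<forall>b\<in>carrier A.P.
    act (H.cls (gen g)) (a \<otimes>\<^bsub>A.P\<^esub> b) = mu a b t"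
proof (cases g)
  case (X i)
  let ?x = "H.cls (gen (X i))"
  have x: "?x \<in> carrier H.P" "X i \<in> Hgens m" using assms X by auto
  have eq: "act ?x (a \<otimes>\<^bsub>A.P\<^esub> b) = mu a b (single (?x, ?x) 1)"
    if ab: "a \<in> carrier A.P" "b \<in> carrier A.P" for a b
  proof -
    obtain f g where fg: "f \<in> A.F" "g \<in> A.F" "a = A.cls f" "b = A.cls g"
      using ab by (auto simp: A.carrier_presented)
    have F: "opx i f \<in> A.F" "opx i g \<in> A.F"
      using opx_closed [of i] fg(1,2) unfolding A.ops_iff by blast+
    show ?thesis
      unfolding mu_single [OF ab x(1) x(1)]
      by (simp add: fg act_gen x(2) opx_mult F del: Hgens_iff)
  qed
  have "single (?x, ?x) 1 \<in> Hcomult_gen n m q (X i)"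
    by (simp add: Halg_eq Hgen_eq HH.tc_self)
  then show ?thesis unfolding X by (rule bexI [rotated]) (intro ballI eq)
next
  case (Z k)
  then have Zk: "Z k \<in> Hgens m" and k: "k \<in> {1..<m}" "k \<in> {1..m}" "Suc k \<in> {1..m}" using assms by auto
  let ?z = "H.cls (gen (Z k))" and ?x = "H.cls (gen (X k))" and ?y = "H.cls (gen (X (Suc k)))"
  have c: "?z \<in> carrier H.P" "?x \<in> carrier H.P" "?y \<in> carrier H.P" using Zk k by auto
  have eq: "act ?z (a \<otimes>\<^bsub>A.P\<^esub> b) = mu a b (\<Sum>i<n. \<Sum>j<n. single
      (?x [^]\<^bsub>H.P\<^esub> i \<otimes>\<^bsub>H.P\<^esub> ?z, ?y [^]\<^bsub>H.P\<^esub> j \<otimes>\<^bsub>H.P\<^esub> ?z) (fc i j))"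
    if ab: "a \<in> carrier A.P" "b \<in> carrier A.P" for a b
  proof -
    obtain f g where fg: "f \<in> A.F" "g \<in> A.F" "a = A.cls f" "b = A.cls g"
      using ab by (auto simp: A.carrier_presented)
    have zF: "opz k f \<in> A.F" "opz k g \<in> A.F"
      using opz_closed [OF k(1)] fg unfolding A.ops_iff by auto
    let ?h = "\<lambda>i j. const (fc i j) * ((opx k ^^ i) (opz k f) * (opx (Suc k) ^^ j) (opz k g))"
    have hF: "?h i j \<in> A.F" for i j by (intro free_carrier_mult free_carrier_const opx_pow_F zF)
    have mu_sum: "mu a b (sum t S) = finsum A.P (\<lambda>x. mu a b (t x)) S"
      if "\<And>x. x \<in> S \<Longrightarrow> t x \<in> HH.T" for t and S :: "nat set"
      unfolding mu_def using that ab
      by (intro A.lin_ext_sum mu_term)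
    have T_sum: "sum t S \<in> HH.T" if "\<And>x. x \<in> S \<Longrightarrow> t x \<in> HH.T" for t and S :: "nat set"
      using that by (induction S rule: infinite_finite_induct) auto
    have T: "single (?x [^]\<^bsub>H.P\<^esub> i \<otimes>\<^bsub>H.P\<^esub> ?z, ?y [^]\<^bsub>H.P\<^esub> j \<otimes>\<^bsub>H.P\<^esub> ?z) (fc i j) \<in> HH.T"
      for i j by (intro HH.T_single H.m_closed H.nat_pow_closed c)
    have "term": "mu a b (single (?x [^]\<^bsub>H.P\<^esub> i \<otimes>\<^bsub>H.P\<^esub> ?z, ?y [^]\<^bsub>H.P\<^esub> j \<otimes>\<^bsub>H.P\<^esub> ?z) (fc i j))
        = A.cls (?h i j)" for i j
    proof -
      have "act (?x [^]\<^bsub>H.P\<^esub> i \<otimes>\<^bsub>H.P\<^esub> ?z) a = A.cls ((opx k ^^ i) (opz k f))"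
        unfolding fg act_mult [OF H.nat_pow_closed [OF c(2)] c(1) A.cls_closed [OF fg(1)]]
          act_gen [OF Zk fg(1)] opgen_simps
        by (rule act_cls_gen_power [OF k(2) zF(1)])
      moreover have "act (?y [^]\<^bsub>H.P\<^esub> j \<otimes>\<^bsub>H.P\<^esub> ?z) b = A.cls ((opx (Suc k) ^^ j) (opz k g))"
        unfolding fg act_mult [OF H.nat_pow_closed [OF c(3)] c(1) A.cls_closed [OF fg(2)]]
          act_gen [OF Zk fg(2)] opgen_simps
        by (rule act_cls_gen_power [OF k(3) zF(2)])
      ultimately show ?thesis
        using ab by (subst mu_single) (auto intro!: H.m_closed H.nat_pow_closed c simp: opx_pow_F zF
            simp del: H.cls_power H.cls_mult)
    qed
    have "act ?z (a \<otimes>\<^bsub>A.P\<^esub> b) = A.cls (\<Sum>i<n. \<Sum>j<n. ?h i j)"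
      using fg Zk by (simp add: act_gen opz_mult)
    also have "\<dots> = finsum A.P (\<lambda>i. A.cls (\<Sum>j<n. ?h i j)) {..<n}"
      by (intro A.cls_sum free_carrier_sum hF)
    also have "\<dots> = finsum A.P (\<lambda>i. finsum A.P (\<lambda>j. A.cls (?h i j)) {..<n}) {..<n}"
      by (simp only: A.cls_sum [OF hF])
    also have "\<dots> = mu a b (\<Sum>i<n. \<Sum>j<n. single
      (?x [^]\<^bsub>H.P\<^esub> i \<otimes>\<^bsub>H.P\<^esub> ?z, ?y [^]\<^bsub>H.P\<^esub> j \<otimes>\<^bsub>H.P\<^esub> ?z) (fc i j))"
      by (simp only: mu_sum [OF T_sum [OF T]] mu_sum [OF T] "term")
    finally show ?thesis .
  qed
  show ?thesis unfolding Z by (rule bexI [OF _ comult_Z [OF k(1)]]) (intro ballI eq)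
qed

text \<open>The elements of \<open>H\<close> for which some representative of the comultiplication
  computes the action on products form a subalgebra, so generators suffice.\<close>

lemma comult_act:
  assumes "x \<in> carrier H.P"
  shows "\<exists>t\<in>Cm.lift x. \<forall>a\<in>carrier A.P. \<forall>b\<in>carrier A.P. act x (a \<otimes>\<^bsub>A.P\<^esub> b) = mu a b t"
  using assms
proof (induction x rule: H.presented_induct)
  case one
  have "single (\<one>\<^bsub>H.P\<^esub>, \<one>\<^bsub>H.P\<^esub>) 1 \<in> Cm.lift \<one>\<^bsub>H.P\<^esub>"
    by (simp add: HH.pt_one HH.tc_self)
  then show ?case by (rule rev_bexI) (simp add: mu_single act_one)
next
  case (gen g)
  then show ?case using comult_act_gen [OF gen] by simp
next
  case (add x y)
  then obtain s t where st: "s \<in> Cm.lift x" "t \<in> Cm.lift y"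
    "\<And>a b. a \<in> carrier A.P \<Longrightarrow> b \<in> carrier A.P \<Longrightarrow> act x (a \<otimes>\<^bsub>A.P\<^esub> b) = mu a b s"
    "\<And>a b. a \<in> carrier A.P \<Longrightarrow> b \<in> carrier A.P \<Longrightarrow> act y (a \<otimes>\<^bsub>A.P\<^esub> b) = mu a b t" by metis
  note T = HH.in_carrier_tensor [OF Cm.lift_closed [OF add(1)] st(1)]
    HH.in_carrier_tensor [OF Cm.lift_closed [OF add(2)] st(2)]
  have "Cm.lift (x \<oplus>\<^bsub>H.P\<^esub> y) = HH.tc (s + t)"
    using add(1,2) T by (simp flip: HH.tc_add)
  then have "s + t \<in> Cm.lift (x \<oplus>\<^bsub>H.P\<^esub> y)" by (simp only: HH.tc_self)
  then show ?case
    by (rule rev_bexI) (use T add(1,2) in \<open>simp add: mu_add act_add_left flip: st(3,4)\<close>)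
next
  case (smult c x)
  then obtain s where st: "s \<in> Cm.lift x"
    "\<And>a b. a \<in> carrier A.P \<Longrightarrow> b \<in> carrier A.P \<Longrightarrow> act x (a \<otimes>\<^bsub>A.P\<^esub> b) = mu a b s" by metis
  note T = HH.in_carrier_tensor [OF Cm.lift_closed [OF smult(1)] st(1)]
  have "Cm.lift (c \<odot>\<^bsub>H.P\<^esub> x) = HH.tc (Poly_Mapping.map ((*) c) s)"
    using smult(1) T by (simp flip: HH.tc_smult)
  then have "Poly_Mapping.map ((*) c) s \<in> Cm.lift (c \<odot>\<^bsub>H.P\<^esub> x)" by (simp only: HH.tc_self)
  then show ?case
    by (rule rev_bexI) (use T smult(1) in \<open>simp add: mu_scale act_smult_left flip: st(2)\<close>)
next
  case (mult x y)
  then obtain s t where st: "s \<in> Cm.lift x" "t \<in> Cm.lift y"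
    "\<And>a b. a \<in> carrier A.P \<Longrightarrow> b \<in> carrier A.P \<Longrightarrow> act x (a \<otimes>\<^bsub>A.P\<^esub> b) = mu a b s"
    "\<And>a b. a \<in> carrier A.P \<Longrightarrow> b \<in> carrier A.P \<Longrightarrow> act y (a \<otimes>\<^bsub>A.P\<^esub> b) = mu a b t" by metis
  note T = HH.in_carrier_tensor [OF Cm.lift_closed [OF mult(1)] st(1)]
    HH.in_carrier_tensor [OF Cm.lift_closed [OF mult(2)] st(2)]
  have "Cm.lift (x \<otimes>\<^bsub>H.P\<^esub> y) = HH.tc (HH.tm s t)"
    using mult(1,2) T by (simp flip: HH.tc_mult)
  then have "HH.tm s t \<in> Cm.lift (x \<otimes>\<^bsub>H.P\<^esub> y)" by (simp only: HH.tc_self)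
  then show ?case
  proof (rule rev_bexI, intro ballI)
    fix a b assume ab: "a \<in> carrier A.P" "b \<in> carrier A.P"
    have "act (x \<otimes>\<^bsub>H.P\<^esub> y) (a \<otimes>\<^bsub>A.P\<^esub> b) = act x (mu a b t)"
      using mult(1,2) ab by (simp add: act_mult st(4))
    also have "\<dots> = mu a b (HH.tm s t)"
      by (rule mu_tensor_mult [OF mult(1) T(1) T(3) ab st(3)])
    finally show "act (x \<otimes>\<^bsub>H.P\<^esub> y) (a \<otimes>\<^bsub>A.P\<^esub> b) = mu a b (HH.tm s t)" .
  qed
qed

lemma act_counit: "x \<in> carrier H.P \<Longrightarrow> act x \<one>\<^bsub>A.P\<^esub> = Cu.lift x \<odot>\<^bsub>A.P\<^esub> \<one>\<^bsub>A.P\<^esub>"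
proof (induction x rule: H.presented_induct)
  case one
  then show ?case by (simp add: act_one)
next
  case (gen g)
  \<comment> \<open>The empty word has no letters to count, has no inversions and is fixed by every
    swap.\<close>
  have "opgen g 1 = 1" using gen
    by (cases g) (simp_all add: opx_def opz_def swap_def zero_word_def flip: single_one)
  with gen show ?case using act_gen [OF gen, of 1] by (simp add: A.cls_one)
qed (simp_all add: act_add_left act_smult_left act_mult act_smult_right A.smult_add_scalar A.smult_smult mult.commute)

lemma Hnm_simps [simp]:
  "carrier (Hnm n m q) = carrier H.P" "mult (Hnm n m q) = mult H.P" "one (Hnm n m q) = one H.P"
  "zero (Hnm n m q) = zero H.P" "add (Hnm n m q) = add H.P" "smult (Hnm n m q) = smult H.P"
  "comult (Hnm n m q) = Cm.lift" "counit (Hnm n m q) = Cu.lift"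
  by (simp_all add: Hnm_def Halg_eq module.defs hopf.defs)

lemma module_algebra_act: "module_algebra (Hnm n m q) (quantum_poly m p) act"
proof -
  have "left_module (Hnm n m q) A.P act"
    unfolding left_module_def
    using A.kspace_axioms
    by (simp add: kspace_iff act_closed act_add_right act_add_left act_smult_right act_smult_left
        act_mult act_one)
  moreover have "act h (a \<otimes>\<^bsub>A.P\<^esub> b) = (\<Oplus>\<^bsub>A.P\<^esub>gk\<in>keys t.
      lookup t gk \<odot>\<^bsub>A.P\<^esub> (act (fst gk) a \<otimes>\<^bsub>A.P\<^esub> act (snd gk) b))"
    if h: "h \<in> carrier H.P" "a \<in> carrier A.P" "b \<in> carrier A.P" "t \<in> Cm.lift h" for h a b t
  proof -
    obtain s where "s \<in> Cm.lift h" "act h (a \<otimes>\<^bsub>A.P\<^esub> b) = mu a b s"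
      using comult_act [OF h(1)] h(2,3) by blast
    then show ?thesis
      using mu_eq [OF h(2,3) Cm.lift_closed [OF h(1)] _ h(4), of s]
      by (simp add: mu_def lin_ext_def)
  qed
  ultimately show ?thesis
    unfolding module_algebra_def quantum_poly_eq k_algebra_iff
    by (simp add: A.kalg_axioms act_counit)
qed

lemma generator_action_act: "generator_action n m q p act"
  unfolding generator_action_def quantum_poly_eq qvar_eq Hgen_eq
proof (intro conjI ballI)
  fix i j assume "i \<in> {1..m}" "j \<in> {1..m}"
  then show "act (H.cls (gen (X i))) (A.cls (gen j))
      = (if j = i then q \<odot>\<^bsub>A.P\<^esub> A.cls (gen j) else A.cls (gen j))"
    by (simp add: act_gen) (simp add: gen_def const_def mult_single)
next
  fix k j assume kj: "k \<in> {1..<m}" "j \<in> {1..m}"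
  then have "opz k (gen j) = gen (Transposition.transpose k (Suc k) j)"
    by (simp add: gen_def)
  with kj show "act (H.cls (gen (Z k))) (A.cls (gen j))
      = (if j = k then A.cls (gen (k + 1)) else if j = k + 1 then A.cls (gen k) else A.cls (gen j))"
    by (simp add: act_gen Transposition.transpose_def flip: Suc_eq_plus1)
qed

end

section \<open>Words in the quantum polynomial ring\<close>

text \<open>All pairs in decreasing order are counted, not only adjacent ones.\<close>

fun descents :: "nat list \<Rightarrow> nat" where
  "descents [] = 0"
| "descents (x # l) = length (filter (\<lambda>y. y < x) l) + descents l"

context quantum
begin

text \<open>The relation \<open>u\<^sub>j u\<^sub>i = p u\<^sub>i u\<^sub>j\<close> is respected by the functional that sends a word with \<open>d\<close> pairs
  of letters in decreasing order to \<open>p ^ d\<close>, so no word vanishes.\<close>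

lemma word_nonzero:
  assumes "single w c \<in> A.I" shows "c = 0"
proof -
  let ?l = "lin_ext scalar_alg (\<lambda>w. p ^ descents (letters w))"
  have single: "?l (single v d) = d * p ^ descents (letters v)" for v d
    by (subst Cu.E.lin_ext_single) auto
  \<comment> \<open>Exchanging neighbours affects no other pair, so the functional picks up one
    factor \<open>p\<close>, as the relation demands.\<close>
  have desc: "descents (v @ j # i # w) = Suc (descents (v @ i # j # w))" if "i < j" for v w i j
    using that by (induction v) auto
  have "?l f = 0" if "f \<in> A.I" for f
    using that
  proof (induction f rule: ideal_induct_swap)
    case (uminus f)
    then show ?case using Cu.E.lin_ext_uminus [of f "\<lambda>w. p ^ descents (letters w)"] by simp
  next
    case (swap v w i j d)
    then show ?case by (subst Cu.E.lin_ext_diff) (simp_all add: single desc a_minus_def)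
  qed (auto simp: Cu.E.lin_ext_add)
  from this [OF assms] single p_nonzero show ?thesis by simp
qed

lemma swap_letters:
  assumes "a \<in> {1..m}" "g \<in> {1..m}" "set l \<subseteq> {1..m}"
  shows "\<exists>d. A.cls (single (Word (a # g # l)) c) = A.cls (single (Word (g # a # l)) d)"
proof -
  have F: "single (Word (x # y # l)) d \<in> A.F" if "x \<in> {1..m}" "y \<in> {1..m}" for x y d
    using that assms by simp
  have eq: "A.cls (single (Word (j # i # l)) d) = A.cls (single (Word (i # j # l)) (d * p))"
    if "i \<in> {1..m}" "j \<in> {1..m}" "i < j" for i j d
    using swap_in_ideal [of 0 "Word l" i j d] that assms F
    by (subst A.cls_eq_iff) (simp_all add: plus_word_def)
  consider "a = g" | "a < g" | "g < a" by linarith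
  then show ?thesis
  proof cases
    case 2
    \<comment> \<open>The relation is used from right to left here, so \<open>c\<close> is divided
      by \<open>p\<close>.\<close>
    with eq [OF assms(1,2), of "c / p"] p_nonzero show ?thesis by (metis nonzero_eq_divide_eq)
  next
    case 3
    with eq [OF assms(2,1)] show ?thesis by blast
  qed blast
qed

lemma cls_single_Cons:
  "a \<in> {1..m} \<Longrightarrow> set l \<subseteq> {1..m} \<Longrightarrow>
    A.cls (single (Word (a # l)) c) = A.cls (gen a) \<otimes>\<^bsub>A.P\<^esub> A.cls (single (Word l) c)"
  by simp

lemma pass_letters:
  assumes "a \<in> {1..m}" "g \<in> {1..m}" "set l \<subseteq> {1..m}"
  shows "\<exists>d. A.cls (single (Word (a # replicate k g @ l)) c)
    = A.cls (single (Word (replicate k g @ a # l)) d)"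
proof (induction k arbitrary: c)
  case 0 then show ?case by auto
next
  case (Suc k)
  have rg: "set (replicate k g @ l) \<subseteq> {1..m}" "set (replicate k g @ a # l) \<subseteq> {1..m}"
      "set (a # replicate k g @ l) \<subseteq> {1..m}"
    using assms by (auto simp: set_replicate_conv_if)
  obtain d where d: "A.cls (single (Word (a # g # replicate k g @ l)) c)
      = A.cls (single (Word (g # a # replicate k g @ l)) d)"
    using swap_letters [OF assms(1,2) rg(1)] by blast
  obtain e where "A.cls (single (Word (a # replicate k g @ l)) d)
      = A.cls (single (Word (replicate k g @ a # l)) e)"
    using Suc by blast
  then have "A.cls (single (Word (g # a # replicate k g @ l)) d)
      = A.cls (single (Word (g # replicate k g @ a # l)) e)"
    by (simp only: cls_single_Cons [OF assms(2) rg(2)] cls_single_Cons [OF assms(2) rg(3)])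
  with d show ?case by auto
qed

text \<open>The letter \<open>g\<close> passes every other letter at the price of a scalar. The
  value of \<open>d\<close> does not matter, since the subalgebras in question are closed under
  scalars.\<close>

lemma collect_letters:
  assumes "g \<in> {1..m}" "set l \<subseteq> {1..m}"
  shows "\<exists>d. A.cls (single (Word l) 1)
    = A.cls (single (Word (replicate (count_list l g) g @ filter (\<lambda>x. x \<noteq> g) l)) d)"
  using assms(2)
proof (induction l)
  case Nil then show ?case by auto
next
  case (Cons a l)
  let ?l = "replicate (count_list l g) g @ filter (\<lambda>x. x \<noteq> g) l"
  have l: "set l \<subseteq> {1..m}" "a \<in> {1..m}" "set ?l \<subseteq> {1..m}" "set (filter (\<lambda>x. x \<noteq> g) l) \<subseteq> {1..m}"
    using Cons.prems assms(1) by (auto simp: set_replicate_conv_if)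
  obtain d where "A.cls (single (Word l) 1) = A.cls (single (Word ?l) d)"
    using Cons.IH l by blast
  then have d: "A.cls (single (Word (a # l)) 1) = A.cls (single (Word (a # ?l)) d)"
    by (simp only: cls_single_Cons [OF l(2,1)] cls_single_Cons [OF l(2,3)])
  show ?case
  proof (cases "a = g")
    case True
    with d show ?thesis by (auto simp flip: Suc_eq_plus1)
  next
    case False
    with d pass_letters [OF l(2) assms(1) l(4), of "count_list l g" d] show ?thesis by auto
  qed
qed

definition divisible :: "nat word set" where
  "divisible = {w. set (letters w) \<subseteq> {1..m} \<and> (\<forall>i\<in>{1..m}. n dvd cnt i w)}"

text \<open>\<open>S\<close> is arbitrary because \<open>gen_subalgebra\<close> is an intersection.
  Collecting the leading letter \<open>g\<close> splits off a power of \<open>u_g ^ n\<close>; the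
  remaining word is shorter and its counts are still divisible by \<open>n\<close>.\<close>

lemma word_in_power_subalgebra:
  assumes S: "subring S A.P" "\<And>c s. s \<in> S \<Longrightarrow> c \<odot>\<^bsub>A.P\<^esub> s \<in> S"
    and gens: "\<And>i. i \<in> {1..m} \<Longrightarrow> A.cls (gen i) [^]\<^bsub>A.P\<^esub> n \<in> S"
    and w: "Word l \<in> divisible"
  shows "A.cls (single (Word l) 1) \<in> S"
  using w
proof (induction "length l" arbitrary: l rule: less_induct)
  case less
  show ?case
  proof (cases l)
    case Nil
    then show ?thesis using subringE(3) [OF S(1)] by (simp add: A.cls_one flip: zero_word_def)
  next
    case (Cons g l')
    then have g: "g \<in> {1..m}" and l: "set l \<subseteq> {1..m}" using less.prems by (auto simp: divisible_def)
    let ?v = "filter (\<lambda>x. x \<noteq> g) l"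
    have "n dvd count_list l g" using less.prems g by (simp add: divisible_def)
    then obtain k where k: "count_list l g = n * k" by (rule dvdE)
    obtain d where d: "A.cls (single (Word l) 1)
        = A.cls (single (Word (replicate (n * k) g @ ?v)) d)"
      using collect_letters [OF g l] unfolding k by blast
    have cnt: "count_list ?v i = (if i = g then 0 else count_list l i)" for i
      by (induction l) auto
    have v: "Word ?v \<in> divisible" using less.prems by (auto simp: divisible_def cnt)
    have "length ?v < length l" unfolding Cons by (simp add: le_imp_less_Suc)
    then have vS: "A.cls (single (Word ?v) 1) \<in> S" using less.hyps v by blast
    have power: "gen g ^ a * single (Word u) 1 = single (Word (replicate a g @ u)) (1::'k)"
      for a u by (induction a) (simp_all add: mult.assoc)
    have u: "(A.cls (gen g) [^]\<^bsub>A.P\<^esub> n) [^]\<^bsub>A.P\<^esub> a \<in> S" for a :: nat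
      by (induction a) (use subringE(3,6) [OF S(1)] gens [OF g] in auto)
    have vF: "single (Word ?v) 1 \<in> A.F"
      by (rule free_carrier_single) (use l in auto)
    have gF: "gen g ^ a \<in> A.F" for a using g by simp
    have "(A.cls (gen g) [^]\<^bsub>A.P\<^esub> n) [^]\<^bsub>A.P\<^esub> k \<otimes>\<^bsub>A.P\<^esub> A.cls (single (Word ?v) 1) \<in> S"
      by (rule subringE(6) [OF S(1) u vS])
    also have "(A.cls (gen g) [^]\<^bsub>A.P\<^esub> n) [^]\<^bsub>A.P\<^esub> k \<otimes>\<^bsub>A.P\<^esub> A.cls (single (Word ?v) 1)
        = A.cls (single (Word (replicate (n * k) g @ ?v)) 1)"
      using g gF vF power [of "n * k" ?v] by (simp flip: power_mult)
    finally have "d \<odot>\<^bsub>A.P\<^esub> A.cls (single (Word (replicate (n * k) g @ ?v)) 1) \<in> S" by (rule S(2))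
    moreover have "single (Word (replicate (n * k) g @ ?v)) 1 \<in> A.F"
      by (rule free_carrier_single) (use l g in \<open>auto simp: set_replicate_conv_if\<close>)
    ultimately show ?thesis unfolding d by (simp add: const_def mult_single)
  qed
qed

lemma divisible_in_power_subalgebra:
  assumes S: "subring S A.P" "\<And>c s. s \<in> S \<Longrightarrow> c \<odot>\<^bsub>A.P\<^esub> s \<in> S"
    and gens: "\<And>i. i \<in> {1..m} \<Longrightarrow> A.cls (gen i) [^]\<^bsub>A.P\<^esub> n \<in> S"
    and f: "keys f \<subseteq> divisible"
  shows "A.cls f \<in> S"
  using f
proof (induction f rule: poly_mapping_induct_keys)
  case zero
  then show ?case using subringE(2) [OF S(1)] by (simp add: A.cls_zero)
next
  case (single w c)
  then have "A.cls (single w 1) \<in> S"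
    using word_in_power_subalgebra [OF S gens, of "letters w"] by simp
  from S(2) [OF this, of c] show ?case using single by (simp add: const_def mult_single divisible_def)
next
  case (add f g)
  have "f \<in> A.F" "g \<in> A.F" using add(1,2) by (auto simp: free_carrier divisible_def)
  with add subringE(7) [OF S(1)] show ?case by (metis A.cls_add)
qed

section \<open>Averaging over the powers of a generator\<close>

lemma keys_mop_id: "keys (mop (\<lambda>w. w) \<chi> f) \<subseteq> {w \<in> keys f. \<chi> w \<noteq> 0}"
proof -
  have "lookup (mop (\<lambda>w. w) \<chi> f) w = lookup f w * \<chi> w" for w
    by (induction f rule: free_all_induct)
      (simp_all add: mop_add lookup_add distrib_right lookup_single when_def)
  then show ?thesis by (auto simp: in_keys_iff)
qed

text \<open>The geometric sum is \<open>n\<close> if \<open>n\<close> divides the count of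
  \<open>i\<close> and zero otherwise, so the average projects onto the span of the words with
  divisible count.\<close>

lemma average_opx:
  "const (inverse (of_nat n)) * (\<Sum>j<n. (opx i ^^ j) f) = mop (\<lambda>w. w) (\<lambda>w. if n dvd cnt i w then 1 else 0) f"
proof -
  have "inverse (of_nat n) * (\<Sum>j<n. (q ^ a) ^ j) = (if n dvd a then 1 else 0)" for a
  proof -
    have "(q ^ a) ^ n = 1" by (metis power_mult mult.commute power_one q_power_n)
    moreover have "q ^ a = 1 \<longleftrightarrow> n dvd a"
      using q_power_inj [of "a mod n" 0] n_pos by (auto simp: q_power_mod mod_eq_0_iff_dvd)
         (metis q_power_n power_mult power_one dvd_def)
    ultimately show ?thesis using n_pos by (simp add: sum_root_of_unity)
  qed
  then show ?thesis by (simp add: opx_pow mop_sum mop_scale)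
qed

text \<open>Averaging does not move a class that \<open>x_i\<close> fixes, yet it deletes words from
  the representative. Such a class therefore has a representative in which only words with divisible
  count of \<open>i\<close> occur.\<close>

lemma cls_filter:
  assumes f: "f \<in> A.F" and fixed: "A.cls (opx i f) = A.cls f"
  shows "A.cls (mop (\<lambda>w. w) (\<lambda>w. if n dvd cnt i w then 1 else 0) f) = A.cls f"
proof -
  have xF: "(opx i ^^ j) f \<in> A.F" for j using f by (rule opx_pow_F)
  have x1F: "opx i f \<in> A.F" using opx_closed [of i] f unfolding A.ops_iff by blast
  have j: "(opx i ^^ j) f - f \<in> A.I" for j
  proof (induction j)
    case 0 show ?case using A.I_zero by simp
  next
    case (Suc j)
    \<comment> \<open>The difference for \<open>j + 1\<close> is \<open>x_i\<close> applied to the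
      one for \<open>j\<close>, plus the one for 1.\<close>
    have "opx i ((opx i ^^ j) f - f) \<in> A.I" using opx_closed [of i] Suc unfolding A.ops_iff by blast
    moreover have "opx i f - f \<in> A.I" using fixed A.cls_eq_iff [OF x1F f] by blast
    ultimately have "opx i ((opx i ^^ j) f - f) + (opx i f - f) \<in> A.I" by (rule A.I_add)
    then show ?case by (simp add: A.ops_diff [OF opx_closed])
  qed
  have sum: "(\<Sum>j<k. (opx i ^^ j) f - f) \<in> A.I" for k
    by (induction k) (auto intro: A.I_zero A.I_add j)
  have "const (inverse (of_nat n)) * (\<Sum>j<n. (opx i ^^ j) f - f) \<in> A.I"
    by (rule A.I_smult [OF sum])
  also have "const (inverse (of_nat n)) * (\<Sum>j<n. (opx i ^^ j) f - f)
      = mop (\<lambda>w. w) (\<lambda>w. if n dvd cnt i w then 1 else 0) f - f"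
  proof -
    have "const (inverse (of_nat n)) * (of_nat n * f) = f"
    proof -
      have "(of_nat n :: (nat, 'k) free) = const (of_nat n)" by (simp add: const_def)
      then have "const (inverse (of_nat n)) * (of_nat n * f) = const (inverse (of_nat n) * of_nat n) * f"
        by (simp add: const_mult mult.assoc)
      then show ?thesis using n_pos by simp
    qed
    then show ?thesis by (simp add: sum_subtractf right_diff_distrib average_opx)
  qed
  finally have "mop (\<lambda>w. w) (\<lambda>w. if n dvd cnt i w then 1 else 0) f - f \<in> A.I" .
  moreover have "mop (\<lambda>w. w) (\<lambda>w. if n dvd cnt i w then 1 else 0) f \<in> A.F"
    using f by (rule mop_closed)
  ultimately show ?thesis using A.cls_eq_iff f by blast
qed

section \<open>An arbitrary action extending the action of the generators\<close>

lemma kalg_Hnm: "kalg (Hnm n m q)"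
  by (rule kalg_image [OF H.kalg_axioms, of _ "\<lambda>x. x"]) auto

context
  fixes act' :: "(hgen, 'k) free set \<Rightarrow> (nat, 'k) free set \<Rightarrow> (nat, 'k) free set"
  assumes module_algebra_act': "module_algebra (Hnm n m q) (quantum_poly m p) act'"
    and generator_action_act': "generator_action n m q p act'"
begin

lemma left_module_act': "left_module (Hnm n m q) A.P act'"
  using module_algebra_act' by (simp add: module_algebra_def quantum_poly_eq)

lemma act'_closed: "x \<in> carrier H.P \<Longrightarrow> a \<in> carrier A.P \<Longrightarrow> act' x a \<in> carrier A.P"
  and act'_add: "\<lbrakk>x \<in> carrier H.P; a \<in> carrier A.P; b \<in> carrier A.P\<rbrakk> \<Longrightarrow>
    act' x (a \<oplus>\<^bsub>A.P\<^esub> b) = act' x a \<oplus>\<^bsub>A.P\<^esub> act' x b"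
  and act'_smult: "\<lbrakk>x \<in> carrier H.P; a \<in> carrier A.P\<rbrakk> \<Longrightarrow> act' x (c \<odot>\<^bsub>A.P\<^esub> a) = c \<odot>\<^bsub>A.P\<^esub> act' x a"
  and act'_add_left: "\<lbrakk>x \<in> carrier H.P; y \<in> carrier H.P; a \<in> carrier A.P\<rbrakk> \<Longrightarrow>
    act' (x \<oplus>\<^bsub>H.P\<^esub> y) a = act' x a \<oplus>\<^bsub>A.P\<^esub> act' y a"
  and act'_smult_left: "\<lbrakk>x \<in> carrier H.P; a \<in> carrier A.P\<rbrakk> \<Longrightarrow> act' (c \<odot>\<^bsub>H.P\<^esub> x) a = c \<odot>\<^bsub>A.P\<^esub> act' x a"
  and act'_mult: "\<lbrakk>x \<in> carrier H.P; y \<in> carrier H.P; a \<in> carrier A.P\<rbrakk> \<Longrightarrow>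
    act' (x \<otimes>\<^bsub>H.P\<^esub> y) a = act' x (act' y a)"
  and act'_one: "a \<in> carrier A.P \<Longrightarrow> act' \<one>\<^bsub>H.P\<^esub> a = a"
  using left_module_act' unfolding left_module_def Hnm_simps by simp_all

text \<open>\<open>x_i\<close> is group-like, so \<open>x_i \<otimes> x_i\<close> is a
  representative to which the module algebra law applies.\<close>

lemma act'_x_mult:
  assumes "i \<in> {1..m}" "a \<in> carrier A.P" "b \<in> carrier A.P"
  shows "act' (H.cls (gen (X i))) (a \<otimes>\<^bsub>A.P\<^esub> b)
    = act' (H.cls (gen (X i))) a \<otimes>\<^bsub>A.P\<^esub> act' (H.cls (gen (X i))) b"
proof -
  let ?x = "H.cls (gen (X i))" and ?t = "single (H.cls (gen (X i)), H.cls (gen (X i))) (1::'k)"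
  have x: "?x \<in> carrier H.P" and Xi: "X i \<in> Hgens m" using assms(1) by auto
  have "Cm.lift ?x = HH.pt ?x ?x" using Xi by (simp add: Halg_eq Hgen_eq del: Hgens_iff)
  then have "?t \<in> Cm.lift ?x" by (simp only: HH.tc_self)
  then have "act' ?x (a \<otimes>\<^bsub>A.P\<^esub> b) = lin_ext A.P (\<lambda>gk. act' (fst gk) a \<otimes>\<^bsub>A.P\<^esub> act' (snd gk) b) ?t"
    using module_algebra_act' x assms(2,3) unfolding module_algebra_def quantum_poly_eq Hnm_simps lin_ext_def by blast
  also have "\<dots> = act' ?x a \<otimes>\<^bsub>A.P\<^esub> act' ?x b"
    using act'_closed [OF x] assms(2,3) by (subst A.lin_ext_single) simp_all
  finally show ?thesis .
qed

lemma act'_x_one: "i \<in> {1..m} \<Longrightarrow> act' (H.cls (gen (X i))) \<one>\<^bsub>A.P\<^esub> = \<one>\<^bsub>A.P\<^esub>"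
proof -
  assume i: "i \<in> {1..m}"
  then have Xi: "X i \<in> Hgens m" by simp
  then have "H.cls (gen (X i)) \<in> carrier H.P" by simp
  then have "act' (H.cls (gen (X i))) \<one>\<^bsub>A.P\<^esub> = Cu.lift (H.cls (gen (X i))) \<odot>\<^bsub>A.P\<^esub> \<one>\<^bsub>A.P\<^esub>"
    using module_algebra_act' unfolding module_algebra_def quantum_poly_eq Hnm_simps by blast
  then show ?thesis using Xi by simp
qed

lemma act'_x_gen: "i \<in> {1..m} \<Longrightarrow> j \<in> {1..m} \<Longrightarrow>
    act' (H.cls (gen (X i))) (A.cls (gen j)) = A.cls (opx i (gen j))"
proof -
  assume ij: "i \<in> {1..m}" "j \<in> {1..m}"
  then have "act' (H.cls (gen (X i))) (A.cls (gen j))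
      = (if j = i then q \<odot>\<^bsub>A.P\<^esub> A.cls (gen j) else A.cls (gen j))"
    using generator_action_act' unfolding generator_action_def quantum_poly_eq qvar_eq Hgen_eq by blast
  also have "\<dots> = A.cls (opx i (gen j))"
    using ij by simp (simp add: gen_def const_def mult_single)
  finally show ?thesis .
qed

text \<open>A linear map that respects products and the unit is determined on generators, so
  \<open>x_i\<close> acts by the operator built above whatever the action. Facts about
  \<open>opx\<close> thereby hold for every action considered.\<close>

lemma act'_x:
  assumes i: "i \<in> {1..m}" and f: "f \<in> A.F"
  shows "act' (H.cls (gen (X i))) (A.cls f) = A.cls (opx i f)"
proof -
  have x: "H.cls (gen (X i)) \<in> carrier H.P" using i by simp
  have F: "opx i f \<in> A.F" if "f \<in> A.F" for f
    using opx_closed [of i] that unfolding A.ops_iff by blast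
  show ?thesis using f
  proof (induction f rule: free_induct)
    case (single w c)
    then have "act' (H.cls (gen (X i))) (A.cls (single w 1)) = A.cls (opx i (single w 1))"
    proof (induction w rule: word_induct)
      case Nil
      have "opx i 1 = 1" by (simp flip: single_one)
      with act'_x_one [OF i] show ?case by (simp add: A.cls_one)
    next
      case (Cons g w)
      have wF: "single w 1 \<in> A.F" and gF: "gen g \<in> A.F" using Cons by auto
      have "act' (H.cls (gen (X i))) (A.cls (gen g) \<otimes>\<^bsub>A.P\<^esub> A.cls (single w 1))
         = A.cls (opx i (gen g)) \<otimes>\<^bsub>A.P\<^esub> A.cls (opx i (single w 1))"
        using wF gF by (simp only: act'_x_mult [OF i] A.cls_closed act'_x_gen [OF i Cons(1)] Cons(3))
      also have "\<dots> = A.cls (opx i (gen g * single w 1))"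
        unfolding opx_mult by (rule A.cls_mult [OF F [OF gF] F [OF wF]])
      also have "A.cls (gen g) \<otimes>\<^bsub>A.P\<^esub> A.cls (single w 1) = A.cls (gen g * single w 1)"
        by (rule A.cls_mult [OF gF wF])
      finally show ?case by (simp only: gen_mult_single)
    qed
    moreover have wF: "single w 1 \<in> A.F" using single by simp
    moreover have c: "single w c = const c * single w 1"
      by (simp add: const_def mult_single)
    ultimately have "act' (H.cls (gen (X i))) (A.cls (single w c))
        = c \<odot>\<^bsub>A.P\<^esub> A.cls (opx i (single w 1))"
      using act'_smult [OF x A.cls_closed [OF wF], of c] A.cls_smult [OF wF] by (simp only:)
    also have "\<dots> = A.cls (opx i (single w c))"
      unfolding c A.cls_smult [OF F [OF wF]] by (simp add: opx_def mop_smult)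
    finally show ?case .
  next
    case (add f g)
    have "act' (H.cls (gen (X i))) (A.cls (f + g)) = A.cls (opx i f) \<oplus>\<^bsub>A.P\<^esub> A.cls (opx i g)"
      using act'_add [OF x A.cls_closed [OF add(1)] A.cls_closed [OF add(2)]]
      by (simp only: A.cls_add [OF add(1,2)] add(3,4))
    also have "\<dots> = A.cls (opx i (f + g))"
      by (simp only: A.cls_add [OF F [OF add(1)] F [OF add(2)]]) (simp add: opx_def mop_add)
    finally show ?case .
  qed
qed

section \<open>Invariants\<close>

lemma invariants_subset:
  "invariants (Hnm n m q) A.P act' \<subseteq> gen_subalgebra A.P ((\<lambda>i. A.cls (gen i) [^]\<^bsub>A.P\<^esub> n) ` {1..m})"
proof
  fix a assume a: "a \<in> invariants (Hnm n m q) A.P act'"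
  then obtain f where f: "f \<in> A.F" "a = A.cls f" by (auto simp: invariants_def A.carrier_presented)
  have fixed: "A.cls (opx i g) = A.cls g" if "i \<in> {1..m}" "g \<in> A.F" "A.cls g = a" for i g
  proof -
    have Xi: "X i \<in> Hgens m" using that by simp
    then have "H.cls (gen (X i)) \<in> carrier H.P" by simp
    then have "act' (H.cls (gen (X i))) a = Cu.lift (H.cls (gen (X i))) \<odot>\<^bsub>A.P\<^esub> a"
      using a unfolding invariants_def Hnm_simps by blast
    then have "act' (H.cls (gen (X i))) (A.cls g) = A.cls g"
      by (simp only: Cu.lift_gen [OF Xi] that(3) [symmetric] A.smult_one [OF A.cls_closed [OF that(2)]])
    then show ?thesis by (simp only: act'_x [OF that(1,2)])
  qed
  \<comment> \<open>The letters are filtered one at a time. Filtering only removes keys, so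
    divisibility for the earlier letters survives.\<close>
  have "\<exists>g\<in>A.F. A.cls g = a \<and> (\<forall>w\<in>keys g. \<forall>i\<in>{1..k}. n dvd cnt i w)" if "k \<le> m" for k
    using that
  proof (induction k)
    case 0
    then show ?case using f by auto
  next
    case (Suc k)
    then obtain g where g: "g \<in> A.F" "A.cls g = a"
      "\<And>w i. w \<in> keys g \<Longrightarrow> i \<in> {1..k} \<Longrightarrow> n dvd cnt i w" by auto
    let ?g = "mop (\<lambda>w. w) (\<lambda>w. if n dvd cnt (Suc k) w then 1 else 0) g"
    have k: "Suc k \<in> {1..m}" using Suc.prems by simp
    have "A.cls ?g = a" using cls_filter [OF g(1) fixed [OF k g(1,2)]] g(2) by simp
    moreover have "?g \<in> A.F" using g(1) by (rule mop_closed)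
    moreover have "n dvd cnt i w" if "w \<in> keys ?g" "i \<in> {1..Suc k}" for w i
    proof -
      have "w \<in> keys g" "n dvd cnt (Suc k) w"
        using keys_mop_id [of "\<lambda>w. if n dvd cnt (Suc k) w then 1 else 0" g] that(1) by (auto split: if_splits)
      with g(3) [of w i] that(2) show ?thesis by (cases "i = Suc k") auto
    qed
    ultimately show ?case by blast
  qed
  from this [of m] obtain g where g: "g \<in> A.F" "A.cls g = a"
    "\<forall>w\<in>keys g. \<forall>i\<in>{1..m}. n dvd cnt i w" by blast
  then have "keys g \<subseteq> divisible" by (auto simp: free_carrier divisible_def)
  then show "a \<in> gen_subalgebra A.P ((\<lambda>i. A.cls (gen i) [^]\<^bsub>A.P\<^esub> n) ` {1..m})"
    unfolding gen_subalgebra_def g(2) [symmetric]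
    by (intro InterI) (auto intro!: divisible_in_power_subalgebra simp del: A.cls_power)
qed

section \<open>Faithfulness over \<open>R\<close>\<close>

lemma joint_eigen_annihilated:
  assumes h: "h \<in> gen_subalgebra (Hnm n m q) ((\<lambda>i. H.cls (gen (X i))) ` {1..m})"
    and zero: "\<And>v. v \<in> carrier A.P \<Longrightarrow> act' h v = \<zero>\<^bsub>A.P\<^esub>"
    and e: "e \<in> carrier H.P"
    and eigen: "\<And>i. i \<in> {1..m} \<Longrightarrow> \<exists>a. H.cls (gen (X i)) \<otimes>\<^bsub>H.P\<^esub> e = (q ^ a) \<odot>\<^bsub>H.P\<^esub> e"
  shows "h \<otimes>\<^bsub>H.P\<^esub> e = \<zero>\<^bsub>H.P\<^esub>"
proof -
  interpret Hn: kalg "Hnm n m q" by (rule kalg_Hnm)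
  obtain \<alpha> where \<alpha>: "\<And>i. i \<in> {1..m} \<Longrightarrow> H.cls (gen (X i)) \<otimes>\<^bsub>H.P\<^esub> e = (q ^ \<alpha> i) \<odot>\<^bsub>H.P\<^esub> e"
    using eigen by metis
  \<comment> \<open>The word with \<open>\<alpha> i\<close> copies of each letter \<open>i\<close>
    has, for every \<open>x_i\<close>, the same eigenvalue as \<open>e\<close>.\<close>
  define l where "l k = concat (map (\<lambda>i. replicate (\<alpha> i) i) [1..<Suc k])" for k
  have cnt_l: "count_list (l k) i = (if i \<in> {1..k} then \<alpha> i else 0)" for k i
  proof (induction k)
    case (Suc k)
    have "count_list (replicate a j) i = (if i = j then a else 0)" for a j :: nat
      by (induction a) auto
    with Suc show ?case by (auto simp: l_def)
  qed (simp add: l_def)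
  have set_l: "set (l m) \<subseteq> {1..m}" by (auto simp: l_def)
  let ?f = "single (Word (l m)) (1::'k)"
  have fF: "?f \<in> A.F" using set_l by simp
  let ?v = "A.cls ?f"
  have v: "?v \<in> carrier A.P" using fF by (rule A.cls_closed)
  \<comment> \<open>The elements that act on \<open>e\<close> and on \<open>?v\<close> by one and
    the same scalar. They form a subalgebra containing all \<open>x_i\<close>, so \<open>h\<close>
    is among them.\<close>
  define K where "K = {h \<in> carrier H.P. \<exists>c. h \<otimes>\<^bsub>H.P\<^esub> e = c \<odot>\<^bsub>H.P\<^esub> e \<and> act' h ?v = c \<odot>\<^bsub>A.P\<^esub> ?v}"
  have KI: "h \<in> K" if "h \<in> carrier H.P" "h \<otimes>\<^bsub>H.P\<^esub> e = c \<odot>\<^bsub>H.P\<^esub> e" "act' h ?v = c \<odot>\<^bsub>A.P\<^esub> ?v" for h c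
    using that unfolding K_def by blast
  have smult: "c \<odot>\<^bsub>H.P\<^esub> h \<in> K" if hK: "h \<in> K" for c h
  proof -
    obtain d where d: "h \<in> carrier H.P" "h \<otimes>\<^bsub>H.P\<^esub> e = d \<odot>\<^bsub>H.P\<^esub> e" "act' h ?v = d \<odot>\<^bsub>A.P\<^esub> ?v"
      using hK unfolding K_def by blast
    show ?thesis
      by (rule KI [of _ "c * d"])
        (use d e v in \<open>simp_all add: H.smult_mult_left H.smult_smult A.smult_smult act'_smult_left del: A.cls_smult\<close>)
  qed
  have "subring K (Hnm n m q)"
  proof (rule Hn.subringI)
    show "K \<subseteq> carrier (Hnm n m q)" by (auto simp: K_def)
    show "\<one>\<^bsub>Hnm n m q\<^esub> \<in> K"
      using e v by (simp add: KI [of _ 1] act'_one del: A.cls_smult)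
    show "\<ominus>\<^bsub>Hnm n m q\<^esub> h \<in> K" if "h \<in> K" for h
      using smult [OF that, of "-1"] Hn.smult_minus_one [of h] that by (simp add: K_def)
    fix g h assume "g \<in> K" "h \<in> K"
    then obtain c d where c: "g \<in> carrier H.P" "g \<otimes>\<^bsub>H.P\<^esub> e = c \<odot>\<^bsub>H.P\<^esub> e" "act' g ?v = c \<odot>\<^bsub>A.P\<^esub> ?v"
      and d: "h \<in> carrier H.P" "h \<otimes>\<^bsub>H.P\<^esub> e = d \<odot>\<^bsub>H.P\<^esub> e" "act' h ?v = d \<odot>\<^bsub>A.P\<^esub> ?v"
      unfolding K_def by blast
    have "g \<oplus>\<^bsub>H.P\<^esub> h \<in> K"
      by (rule KI [of _ "c + d"])
        (use c d e v in \<open>simp_all add: H.l_distr H.smult_add_scalar A.smult_add_scalar act'_add_left del: A.cls_smult\<close>)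
    then show "g \<oplus>\<^bsub>Hnm n m q\<^esub> h \<in> K" by simp
    have "g \<otimes>\<^bsub>H.P\<^esub> h \<in> K"
      by (rule KI [of _ "d * c"])
        (use c d e v in \<open>simp_all add: H.m_assoc H.smult_mult_right H.smult_smult A.smult_smult act'_mult act'_smult
          del: A.cls_smult\<close>)
    then show "g \<otimes>\<^bsub>Hnm n m q\<^esub> h \<in> K" by simp
  qed
  moreover have "H.cls (gen (X i)) \<in> K" if "i \<in> {1..m}" for i
  proof (rule KI [OF _ \<alpha> [OF that]])
    show "H.cls (gen (X i)) \<in> carrier H.P" using that by simp
    have "act' (H.cls (gen (X i))) ?v = A.cls (const (q ^ \<alpha> i) * ?f)"
      unfolding act'_x [OF that fF] using that by (simp add: cnt_l const_def mult_single)
    then show "act' (H.cls (gen (X i))) ?v = (q ^ \<alpha> i) \<odot>\<^bsub>A.P\<^esub> ?v" by (simp only: A.cls_smult [OF fF])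
  qed
  ultimately have "gen_subalgebra (Hnm n m q) ((\<lambda>i. H.cls (gen (X i))) ` {1..m}) \<subseteq> K"
    unfolding gen_subalgebra_def using smult by (intro Inter_lower) auto
  with h obtain c where c: "h \<otimes>\<^bsub>H.P\<^esub> e = c \<odot>\<^bsub>H.P\<^esub> e" "act' h ?v = c \<odot>\<^bsub>A.P\<^esub> ?v"
    unfolding K_def by blast
  \<comment> \<open>\<open>h\<close> kills \<open>?v\<close>, so \<open>c\<close> times a word is
    zero in \<open>A\<close>. Words do not vanish there, whence \<open>c = 0\<close>, and
    \<open>c\<close> is also the scalar by which \<open>h\<close> acts on \<open>e\<close>.\<close>
  have "A.cls (single (Word (l m)) c) = A.cls 0"
    using zero [OF v] c(2) fF by (simp add: const_def mult_single A.cls_zero)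
  then have "single (Word (l m)) c \<in> A.I"
    using A.cls_eq_iff [of "single (Word (l m)) c" 0] set_l by simp
  then have "c = 0" by (rule word_nonzero)
  with c(1) e show ?thesis by simp
qed

lemma gen_subalgebra_subset_carrier:
  "gen_subalgebra (Hnm n m q) ((\<lambda>i. H.cls (gen (X i))) ` {1..m}) \<subseteq> carrier H.P"
proof -
  interpret Hn: kalg "Hnm n m q" by (rule kalg_Hnm)
  show ?thesis
    unfolding gen_subalgebra_def using Hn.carrier_is_subring
    by (intro Inter_lower) auto
qed

text \<open>Left multiplication by \<open>h\<close> kills every joint eigenvector in
  \<open>H\<close>, and by \<open>joint_eigen\<close> this forces \<open>h\<close> to
  vanish.\<close>

lemma faithful:
  assumes h: "h \<in> gen_subalgebra (Hnm n m q) ((\<lambda>i. H.cls (gen (X i))) ` {1..m})"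
    and zero: "\<And>v. v \<in> carrier A.P \<Longrightarrow> act' h v = \<zero>\<^bsub>A.P\<^esub>"
  shows "h = \<zero>\<^bsub>H.P\<^esub>"
proof (rule joint_eigen [of H.P h "(\<lambda>i. H.cls (gen (X i))) ` {1..m}"])
  show "kalg H.P" by (rule H.kalg_axioms)
  show "h \<in> carrier H.P" using h gen_subalgebra_subset_carrier by blast
  show "x [^]\<^bsub>H.P\<^esub> n = \<one>\<^bsub>H.P\<^esub>" if x: "x \<in> (\<lambda>i. H.cls (gen (X i))) ` {1..m}" for x
  proof -
    obtain i where i: "i \<in> {1..m}" "x = H.cls (gen (X i))" using x by blast
    then have "gen (X i) ^ n - 1 \<in> Hrels n m q" unfolding Hrels_def by blast
    then have "gen (X i) ^ n - 1 \<in> H.I" by (rule H.rels_in_ideal)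
    moreover have "gen (X i) \<in> H.F" using i by simp
    ultimately show ?thesis using H.cls_eq_iff [of "gen (X i) ^ n" 1] i(2) by (simp add: H.cls_one)
  qed
  show "x \<otimes>\<^bsub>H.P\<^esub> y = y \<otimes>\<^bsub>H.P\<^esub> x"
    if xy: "x \<in> (\<lambda>i. H.cls (gen (X i))) ` {1..m}" "y \<in> (\<lambda>i. H.cls (gen (X i))) ` {1..m}" for x y
  proof -
    obtain i j where ij: "i \<in> {1..m}" "x = H.cls (gen (X i))" "j \<in> {1..m}" "y = H.cls (gen (X j))"
      using xy by blast
    then have "gen (X i) * gen (X j) - gen (X j) * gen (X i) \<in> Hrels n m q" unfolding Hrels_def by blast
    then have "gen (X i) * gen (X j) - gen (X j) * gen (X i) \<in> H.I" by (rule H.rels_in_ideal)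
    moreover have "gen (X i) \<in> H.F" "gen (X j) \<in> H.F" using ij by simp_all
    ultimately show ?thesis
      using H.cls_eq_iff [of "gen (X i) * gen (X j)" "gen (X j) * gen (X i)"] unfolding ij by simp
  qed
  show "h \<otimes>\<^bsub>H.P\<^esub> e = \<zero>\<^bsub>H.P\<^esub>"
    if "e \<in> carrier H.P" "\<And>x. x \<in> (\<lambda>i. H.cls (gen (X i))) ` {1..m} \<Longrightarrow> \<exists>a. x \<otimes>\<^bsub>H.P\<^esub> e = (q ^ a) \<odot>\<^bsub>H.P\<^esub> e" for e
    using joint_eigen_annihilated [OF h zero] that by blast
qed auto

lemma Rnm_simps [simp]:
  "carrier (Rnm n m q) = gen_subalgebra (Hnm n m q) ((\<lambda>i. H.cls (gen (X i))) ` {1..m})"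
  "mult (Rnm n m q) = mult H.P" "one (Rnm n m q) = one H.P"
  "zero (Rnm n m q) = zero H.P" "add (Rnm n m q) = add H.P" "smult (Rnm n m q) = smult H.P"
  by (simp_all add: Rnm_def hopf_restrict_def Hgen_eq)

text \<open>Each element of an annihilating ideal itself annihilates \<open>A\<close>, so
  \<open>faithful\<close> leaves only zero: inner faithfulness is deduced from faithfulness.\<close>

lemma inner_faithful_Rnm: "inner_faithful (Rnm n m q) A.P act'"
  unfolding inner_faithful_def
proof (intro conjI allI impI)
  show "left_module (Rnm n m q) A.P act'"
    unfolding left_module_def Rnm_simps
  proof (intro conjI allI ballI)
    show "module scalar_alg A.P" using A.kspace_axioms by (simp only: kspace_iff)
  qed (simp_all only: act'_closed act'_add act'_add_left act'_smult act'_smult_left act'_mult act'_one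
      subsetD [OF gen_subalgebra_subset_carrier])
  fix J assume J: "hopf_ideal (Rnm n m q) J \<and> (\<forall>h\<in>J. \<forall>v\<in>carrier A.P. act' h v = \<zero>\<^bsub>A.P\<^esub>)"
  then interpret J: ideal J "Rnm n m q" by (simp add: hopf_ideal_def)
  have "J \<subseteq> {\<zero>\<^bsub>Rnm n m q\<^esub>}"
  proof
    fix h assume h: "h \<in> J"
    then have "h \<in> carrier (Rnm n m q)" by (rule subsetD [OF J.a_subset])
    then have "h = \<zero>\<^bsub>H.P\<^esub>" using J h by (intro faithful) (auto simp only: Rnm_simps)
    then show "h \<in> {\<zero>\<^bsub>Rnm n m q\<^esub>}" by simp
  qed
  moreover have "\<zero>\<^bsub>Rnm n m q\<^esub> \<in> J" by (rule additive_subgroup.zero_closed [OF J.is_additive_subgroup])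
  ultimately show "J = {\<zero>\<^bsub>Rnm n m q\<^esub>}" by blast
qed

end

end

theorem theorem20:
  fixes n m :: nat and q p :: "'k::field_char_0"
  assumes "n \<ge> 2" and "m \<ge> 2"
    and "primitive_root_of_unity q n"
    and "p ^ 2 = q"
  shows "(\<exists>act. module_algebra (Hnm n m q) (quantum_poly m p) act \<and>
            generator_action n m q p act) \<and>
         (\<forall>act. module_algebra (Hnm n m q) (quantum_poly m p) act \<and>
            generator_action n m q p act \<longrightarrow>
              inner_faithful (Rnm n m q) (quantum_poly m p) act \<and>
              (even n \<longrightarrow>
                 invariants (Hnm n m q) (quantum_poly m p) act
                   \<subseteq> gen_subalgebra (quantum_poly m p)
                       ((\<lambda>i. qvar m p i [^]\<^bsub>quantum_poly m p\<^esub> n) ` {1..m})))"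
proof -
  interpret quantum n q m p by unfold_locales (use assms in auto)
  show ?thesis
    using module_algebra_act generator_action_act inner_faithful_Rnm invariants_subset
    unfolding quantum_poly_eq qvar_eq by blast
qed

end
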